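(* Let $K\in\{K_0,K_1\}$, let $\sigma$ be a weight of $K$, and let $\pi$ be a smooth representation of $G$ containing $\sigma$, with induced $G$-map $\iota:\mathrm{ind}_K^G\sigma\to\pi$. Assume that $\iota$ is surjective and factors through a quotient $\mathrm{ind}_K^G\sigma/(P(T))$ for some polynomial $P$ over $\overline{\mathbf F}_p$ of degree $\ge1$, where $(P(T))$ is the image of $P(T)$. For $f\in\mathrm{ind}_K^G\sigma$ write $\overline f=\iota(f)$, and let $R_n^{\pm}(\sigma,\pi)=\iota(R_n^{\pm}(\sigma))$. Then: (1) $\overline{f_0}\in\sum_{n\ge0}R_n^-(\sigma,\pi)$; (2) $\overline{f_1}\in\sum_{n\ge0}R_n^+(\sigma,\pi)$.
   Context: Group. $F$ is a non-archimedean local field of odd residue characteristic $p$, $E/F$ the unramified quadratic extension with ring of integers $\mathfrak o_E$, maximal ideal $\mathfrak p_E$, and $x\mapsto\bar x$ the non-trivial Galois conjugation; $k_F,k_E$ are the residue fields; $\varpi_E\in F$ is a uniformizer of $E$. Let $\beta=\begin{pmatrix}0&0&1\\0&1&0\\1&0&0\end{pmatrix}$ and $G=\{g\in GL_3(E): g^{T}\beta\bar g=\beta\}$ (the unramified $U(2,1)(E/F)$). Put $\alpha=\mathrm{diag}(\varpi_E^{-1},1,\varpi_E)\in G$. Let $K_0=G\cap GL_3(\mathfrak o_E)$ and $K_1=G\cap\begin{pmatrix}\mathfrak o_E&\mathfrak o_E&\mathfrak p_E^{-1}\\\mathfrak p_E&\mathfrak o_E&\mathfrak o_E\\\mathfrak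 p_E&\mathfrak p_E&\mathfrak o_E\end{pmatrix}$; up to conjugacy these are the maximal compact open subgroups of $G$. For $K\in\{K_0,K_1\}$ let $K^1$ be its maximal normal pro-$p$ subgroup, $\Gamma_K=K/K^1$ (which is $U(2,1)(k_E/k_F)$ for $K_0$ and $(U(1,1)\times U(1))(k_E/k_F)$ for $K_1$), and $\beta_K=\beta$ if $K=K_0$, $\beta_K=\beta\alpha^{-1}$ if $K=K_1$. The Iwahori subgroup $I_K$ (resp. $I'_K$) is the inverse image in $K$ of the upper (resp. lower) triangular subgroup of $\Gamma_K$, and the pro-$p$ Iwahori subgroup $I_{1,K}$ (resp. $I'_{1,K}$) is the inverse image of its unipotent radical. Weights and Hecke operator. All representations are smooth over $\overline{\mathbf F}_p$. A weight of $K$ is an irreducible smooth representation $\sigma$ of $K$; it factors through $\Gamma_K$. The space $\sigma^{I_{1,K}}$ and the coinvariants $\sigma_{I'_{1,K}}$ are one-dimensional and the composition $\sigma^{I_{1,K}}\hookrightarrow\sigma\twoheadrightarrow\sigma_{I'_{1,K}}$ is an isomorphism; let $j_\sigma:\sigma\to\sigma^{I_{1,K}}$ be the projection $\sigma\to\sigma_{I'_{1,K}}$ followed by the inverse of this isomorphism. $\mathrm{ind}_K^G\sigma$ is the compact induction: locally constant compactly supported $f:G\to\sigma$ with $f(kg)=\sigma(k)f(g)$ for $k\in K$, $G$ acting by right translation. Let $\varphi:G\to\mathrm{End}(\sigma)$ be the function supported on $K\alpha K$ with $\varphi(kgk')=\sigma(k)\varphi(g)\sigma(k')$ ($k,k'\in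 K$) and $\varphi(\alpha)=j_\sigma$; $T\in\mathrm{End}_G(\mathrm{ind}_K^G\sigma)$ is given by $(Tf)(g)=\sum_{Ky\in K\backslash G}\varphi(gy^{-1})f(y)$. For $\pi$ containing $\sigma$ (with an embedding of $\sigma$ in $\pi|_K$), $\iota$ is the $G$-map corresponding to the embedding by Frobenius reciprocity. Functions and subspaces. Fix a non-zero $v_0\in\sigma^{I_{1,K}}$. For $n\in\mathbb Z$, $f_n\in(\mathrm{ind}_K^G\sigma)^{I_{1,K}}$ is the function supported on $K\alpha^{-n}I_{1,K}$ with $f_n(\alpha^{-n})=\beta_Kv_0$ if $n>0$ and $f_n(\alpha^{-n})=v_0$ if $n\le 0$. For $n\ge 0$, $R_n^+(\sigma)$ (resp. $R_n^-(\sigma)$) is the space of functions in $\mathrm{ind}_K^G\sigma$ supported in $K\alpha^nI_K$ (resp. $K\alpha^{-(n+1)}I_K$). *)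

theory Defs
  imports
    "HOL-Analysis.Analysis"
    "HOL-Algebra.Coset"
    "HOL-Computational_Algebra.Polynomial"
begin

section \<open>The unramified quadratic extension\<close>

text \<open>
  The ambient type is the field \<open>E\<close>; \<open>F\<close> is a subset of it.  A valuation is a function to the
  integers whose value at \<open>0\<close> is irrelevant.
\<close>

definition frac_ideal :: "('e::field \<Rightarrow> int) \<Rightarrow> int \<Rightarrow> 'e set" where
  "frac_ideal v n = {x. x = 0 \<or> n \<le> v x}"

definition is_subfield :: "'e::field set \<Rightarrow> bool" where
  "is_subfield L \<longleftrightarrow> 0 \<in> L \<and> 1 \<in> L \<and>
     (\<forall>x\<in>L. \<forall>y\<in>L. x + y \<in> L \<and> x * y \<in> L) \<and> (\<forall>x\<in>L. - x \<in> L \<and> inverse x \<in> L)"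

text \<open>A field complete for a normalized discrete valuation, with finite residue field.\<close>

definition nonarch_local_field :: "'e::field set \<Rightarrow> ('e \<Rightarrow> int) \<Rightarrow> bool" where
  "nonarch_local_field L v \<longleftrightarrow>
     is_subfield L \<and>
     (\<forall>x\<in>L - {0}. \<forall>y\<in>L - {0}. v (x * y) = v x + v y) \<and>
     (\<forall>x\<in>L - {0}. \<forall>y\<in>L - {0}. x + y \<noteq> 0 \<longrightarrow> min (v x) (v y) \<le> v (x + y)) \<and>
     v ` (L - {0}) = UNIV \<and>
     finite ((\<lambda>x. {y \<in> L. y - x \<in> frac_ideal v 1}) ` (L \<inter> frac_ideal v 0)) \<and>
     (\<forall>X::nat \<Rightarrow> 'e. (\<forall>i. X i \<in> L) \<and>
          (\<forall>n. \<exists>N. \<forall>i\<ge>N. \<forall>j\<ge>N. X i - X j \<in> frac_ideal v n) \<longrightarrow>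
        (\<exists>x\<in>L. \<forall>n. \<exists>N. \<forall>i\<ge>N. X i - x \<in> frac_ideal v n))"

record 'e unram_datum =
  baseF :: "'e set"
  val :: "'e \<Rightarrow> int"
  gal :: "'e \<Rightarrow> 'e"
  unif :: 'e

text \<open>
  Both \<open>F\<close> and \<open>E\<close> are local fields for the same function \<open>val\<close>, normalized on each of them.
  This says that the ramification index is \<open>1\<close>, i.e. that \<open>E/F\<close> is unramified (the residue
  fields are finite, so the residue extension is separable).
\<close>

definition unramified_quadratic :: "'e::field unram_datum \<Rightarrow> bool" where
  "unramified_quadratic D \<longleftrightarrow>
     nonarch_local_field (baseF D) (val D) \<and>
     nonarch_local_field UNIV (val D) \<and>
     (\<exists>t. t \<notin> baseF D \<and> (\<forall>x. \<exists>a\<in>baseF D. \<exists>b\<in>baseF D. x = a + b * t)) \<and>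
     bij (gal D) \<and>
     (\<forall>x y. gal D (x + y) = gal D x + gal D y) \<and>
     (\<forall>x y. gal D (x * y) = gal D x * gal D y) \<and>
     (\<forall>x\<in>baseF D. gal D x = x) \<and>
     gal D \<noteq> id \<and>
     unif D \<in> baseF D \<and> unif D \<noteq> 0 \<and> val D (unif D) = 1"

definition residue_char :: "'e::field unram_datum \<Rightarrow> nat \<Rightarrow> bool" where
  "residue_char D p \<longleftrightarrow> prime p \<and> of_nat p \<in> frac_ideal (val D) 1"

text \<open>
  The type \<open>'c\<close> is an algebraic closure of \<open>F_p\<close>; in characteristic \<open>p\<close> the set \<open>\<int>\<close> is the
  prime field.
\<close>

definition is_Fp_bar :: "'c::alg_closed_field itself \<Rightarrow> nat \<Rightarrow> bool" where
  "is_Fp_bar _ p \<longleftrightarrow> CHAR('c) = p \<and>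
     (\<forall>x::'c. \<exists>q. q \<noteq> 0 \<and> (\<forall>i. coeff q i \<in> \<int>) \<and> poly q x = 0)"


section \<open>The group and its subgroups\<close>

type_synonym 'e mat3 = "'e^3^3"

text \<open>
  The index type \<open>3\<close> has elements \<open>1\<close>, \<open>2\<close>, \<open>3\<close>, but \<open>3 = 0\<close> is its least element; so triangular
  shapes are written out entrywise.
\<close>

definition matrix3 :: "'a::zero \<Rightarrow> 'a \<Rightarrow> 'a \<Rightarrow> 'a \<Rightarrow> 'a \<Rightarrow> 'a \<Rightarrow> 'a \<Rightarrow> 'a \<Rightarrow> 'a \<Rightarrow> 'a mat3" where
  "matrix3 a b c d e f g h i = vector [vector [a, b, c], vector [d, e, f], vector [g, h, i]]"

definition beta :: "'e::field mat3" where
  "beta = matrix3 0 0 1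
                  0 1 0
                  1 0 0"

definition U21 :: "'e::field unram_datum \<Rightarrow> 'e mat3 monoid" where
  "U21 D = \<lparr>carrier = {g. invertible g \<and>
                transpose g ** beta ** (\<chi> i j. gal D (g $ i $ j)) = beta},
            mult = (**), one = mat 1\<rparr>"

definition alpha :: "'e::field unram_datum \<Rightarrow> 'e mat3" where
  "alpha D = matrix3 (inverse (unif D)) 0 0
                     0                  1 0
                     0                  0 (unif D)"

text \<open>
  The valuation topology on the space of matrices (product of the topologies on the entries);
  subgroups of \<open>U21\<close> carry the induced topology.
\<close>

definition mat_topology :: "'e::field unram_datum \<Rightarrow> 'e mat3 topology" where
  "mat_topology D = topology (\<lambda>U. \<forall>A\<in>U. \<exists>n. \<forall>B.
      (\<forall>i j. B $ i $ j - A $ i $ j \<in> frac_ideal (val D) n) \<longrightarrow> B \<in> U)"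

lemma openin_mat_topology:
  "openin (mat_topology D) U \<longleftrightarrow> (\<forall>A\<in>U. \<exists>n. \<forall>B.
      (\<forall>i j. B $ i $ j - A $ i $ j \<in> frac_ideal (val D) n) \<longrightarrow> B \<in> U)"
proof -
  let ?P = "\<lambda>U. \<forall>A\<in>U. \<exists>n. \<forall>B.
      (\<forall>i j. B $ i $ j - A $ i $ j \<in> frac_ideal (val D) n) \<longrightarrow> B \<in> U"
  have mono: "frac_ideal (val D) m \<subseteq> frac_ideal (val D) n" if "n \<le> m" for m n
    using that by (auto simp: frac_ideal_def)
  have "?P (S \<inter> T)" if S: "?P S" and T: "?P T" for S T
  proof
    fix A assume A: "A \<in> S \<inter> T"
    obtain m where m: "\<And>B. (\<forall>i j. B $ i $ j - A $ i $ j \<in> frac_ideal (val D) m) \<Longrightarrow> B \<in> S"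
      using S A by blast
    obtain n where n: "\<And>B. (\<forall>i j. B $ i $ j - A $ i $ j \<in> frac_ideal (val D) n) \<Longrightarrow> B \<in> T"
      using T A by blast
    have "\<forall>B. (\<forall>i j. B $ i $ j - A $ i $ j \<in> frac_ideal (val D) (max m n)) \<longrightarrow> B \<in> S \<inter> T"
      using m n mono[of m "max m n"] mono[of n "max m n"]
      by (meson IntI max.cobounded1 max.cobounded2 subsetD)
    then show "\<exists>n. \<forall>B. (\<forall>i j. B $ i $ j - A $ i $ j \<in> frac_ideal (val D) n) \<longrightarrow> B \<in> S \<inter> T"
      by blast
  qed
  moreover have "?P (\<Union>\<K>)" if "\<forall>S\<in>\<K>. ?P S" for \<K>
    using that by (meson UnionE UnionI)
  ultimately have "istopology ?P"
    unfolding istopology_def by blast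
  from topology_inverse'[OF this] show ?thesis
    unfolding mat_topology_def by (rule fun_cong)
qed

datatype maxcpt = K0 | K1

fun max_compact :: "'e::field unram_datum \<Rightarrow> maxcpt \<Rightarrow> 'e mat3 set" where
  "max_compact D K0 = {g \<in> carrier (U21 D).
      \<forall>i j. g $ i $ j \<in> frac_ideal (val D) 0 \<and> matrix_inv g $ i $ j \<in> frac_ideal (val D) 0}"
| "max_compact D K1 = {g \<in> carrier (U21 D).
      \<forall>i j. g $ i $ j \<in> frac_ideal (val D) (matrix3 0 0 (-1)
                                                  1 0 0
                                                  1 1 0 $ i $ j)}"

fun betaK :: "'e::field unram_datum \<Rightarrow> maxcpt \<Rightarrow> 'e mat3" where
  "betaK D K0 = beta"
| "betaK D K1 = beta ** matrix_inv (alpha D)"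

text \<open>
  An integral matrix whose entrywise residue class is the image of \<open>g \<in> K\<close> in \<open>\<Gamma>\<^sub>K\<close>.  For \<open>K1\<close> the
  factor \<open>U(1,1)\<close> of \<open>\<Gamma>\<^sub>K\<close> occupies the rows and columns \<open>1, 3\<close>, and \<open>U(1)\<close> the middle entry.  The
  kernel of \<open>g \<mapsto> reduction D \<kappa> g\<close> modulo the maximal ideal is \<open>K\<^sup>1\<close>.
\<close>

fun reduction :: "'e::field unram_datum \<Rightarrow> maxcpt \<Rightarrow> 'e mat3 \<Rightarrow> 'e mat3" where
  "reduction D K0 g = g"
| "reduction D K1 g = matrix3 (g$1$1)          0       (unif D * g$1$3)
                              0                (g$2$2) 0
                              (g$3$1 / unif D) 0       (g$3$3)"

definition iwahori :: "'e::field unram_datum \<Rightarrow> maxcpt \<Rightarrow> 'e mat3 set" where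
  "iwahori D \<kappa> = {g \<in> max_compact D \<kappa>. let r = reduction D \<kappa> g in
      {r$2$1, r$3$1, r$3$2} \<subseteq> frac_ideal (val D) 1}"

definition iwahori' :: "'e::field unram_datum \<Rightarrow> maxcpt \<Rightarrow> 'e mat3 set" where
  "iwahori' D \<kappa> = {g \<in> max_compact D \<kappa>. let r = reduction D \<kappa> g in
      {r$1$2, r$1$3, r$2$3} \<subseteq> frac_ideal (val D) 1}"

definition pro_p_iwahori :: "'e::field unram_datum \<Rightarrow> maxcpt \<Rightarrow> 'e mat3 set" where
  "pro_p_iwahori D \<kappa> = {g \<in> iwahori D \<kappa>.
      \<forall>i. reduction D \<kappa> g $ i $ i - 1 \<in> frac_ideal (val D) 1}"

definition pro_p_iwahori' :: "'e::field unram_datum \<Rightarrow> maxcpt \<Rightarrow> 'e mat3 set" where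
  "pro_p_iwahori' D \<kappa> = {g \<in> iwahori' D \<kappa>.
      \<forall>i. reduction D \<kappa> g $ i $ i - 1 \<in> frac_ideal (val D) 1}"


section \<open>Smooth representations and weights\<close>

text \<open>
  A representation lives on a whole type \<open>'v\<close>, with scalar multiplication \<open>s\<close>; the values of the
  action \<open>\<rho>\<close> off the group \<open>H\<close> are irrelevant.
\<close>

definition representation ::
  "'e::field mat3 set \<Rightarrow> ('c::field \<Rightarrow> 'v::ab_group_add \<Rightarrow> 'v) \<Rightarrow> ('e mat3 \<Rightarrow> 'v \<Rightarrow> 'v) \<Rightarrow> bool" where
  "representation H s \<rho> \<longleftrightarrow>
     vector_space s \<and>
     (\<forall>g\<in>H. Vector_Spaces.linear s s (\<rho> g)) \<and>
     (\<forall>x. \<rho> (mat 1) x = x) \<and>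
     (\<forall>g\<in>H. \<forall>h\<in>H. \<forall>x. \<rho> (g ** h) x = \<rho> g (\<rho> h x))"

definition smooth_rep ::
  "'e::field unram_datum \<Rightarrow> 'e mat3 set \<Rightarrow> ('c::field \<Rightarrow> 'v::ab_group_add \<Rightarrow> 'v) \<Rightarrow>
     ('e mat3 \<Rightarrow> 'v \<Rightarrow> 'v) \<Rightarrow> bool" where
  "smooth_rep D H s \<rho> \<longleftrightarrow>
     representation H s \<rho> \<and>
     (\<forall>x. openin (subtopology (mat_topology D) H) {g \<in> H. \<rho> g x = x})"

definition irreducible_rep ::
  "'e::field mat3 set \<Rightarrow> ('c::field \<Rightarrow> 'v::ab_group_add \<Rightarrow> 'v) \<Rightarrow> ('e mat3 \<Rightarrow> 'v \<Rightarrow> 'v) \<Rightarrow> bool" where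
  "irreducible_rep H s \<rho> \<longleftrightarrow>
     (\<exists>x::'v. x \<noteq> 0) \<and>
     (\<forall>W. module.subspace s W \<and> (\<forall>g\<in>H. \<rho> g ` W \<subseteq> W) \<longrightarrow> W = {0} \<or> W = UNIV)"

definition weight ::
  "'e::field unram_datum \<Rightarrow> maxcpt \<Rightarrow> ('c::field \<Rightarrow> 'v::ab_group_add \<Rightarrow> 'v) \<Rightarrow>
     ('e mat3 \<Rightarrow> 'v \<Rightarrow> 'v) \<Rightarrow> bool" where
  "weight D \<kappa> s \<sigma> \<longleftrightarrow>
     smooth_rep D (max_compact D \<kappa>) s \<sigma> \<and> irreducible_rep (max_compact D \<kappa>) s \<sigma>"

definition invariants :: "'g set \<Rightarrow> ('g \<Rightarrow> 'v \<Rightarrow> 'v) \<Rightarrow> 'v set" where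
  "invariants H \<rho> = {x. \<forall>g\<in>H. \<rho> g x = x}"

text \<open>The kernel of the projection to the coinvariants.\<close>

definition coinv_kernel ::
  "('c::field \<Rightarrow> 'v::ab_group_add \<Rightarrow> 'v) \<Rightarrow> 'g set \<Rightarrow> ('g \<Rightarrow> 'v \<Rightarrow> 'v) \<Rightarrow> 'v set" where
  "coinv_kernel s H \<rho> = module.span s {\<rho> g x - x | g x. g \<in> H}"

text \<open>
  \<open>j\<^sub>\<sigma> x\<close> is the unique \<open>I\<^sub>1\<close>-invariant vector with the same class as \<open>x\<close> in the
  \<open>I'\<^sub>1\<close>-coinvariants.
\<close>

definition j_proj ::
  "'e::field unram_datum \<Rightarrow> maxcpt \<Rightarrow> ('c::field \<Rightarrow> 'v::ab_group_add \<Rightarrow> 'v) \<Rightarrow>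
     ('e mat3 \<Rightarrow> 'v \<Rightarrow> 'v) \<Rightarrow> 'v \<Rightarrow> 'v" where
  "j_proj D \<kappa> s \<sigma> x = (THE y. y \<in> invariants (pro_p_iwahori D \<kappa>) \<sigma> \<and>
      x - y \<in> coinv_kernel s (pro_p_iwahori' D \<kappa>) \<sigma>)"


section \<open>Compact induction and the Hecke operator\<close>

text \<open>
  Functions on \<open>G\<close> are extended by \<open>0\<close> to all matrices.
\<close>

definition comp_ind ::
  "'e::field unram_datum \<Rightarrow> maxcpt \<Rightarrow> ('e mat3 \<Rightarrow> 'v \<Rightarrow> 'v) \<Rightarrow> ('e mat3 \<Rightarrow> 'v::ab_group_add) set" where
  "comp_ind D \<kappa> \<sigma> = {f.
     (let G = carrier (U21 D); X = subtopology (mat_topology D) G in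
     (\<forall>g. g \<notin> G \<longrightarrow> f g = 0) \<and>
     (\<forall>g\<in>G. \<exists>U. openin X U \<and> g \<in> U \<and> (\<forall>h\<in>U. f h = f g)) \<and>
     compactin X (X closure_of {g \<in> G. f g \<noteq> 0}) \<and>
     (\<forall>k\<in>max_compact D \<kappa>. \<forall>g\<in>G. f (k ** g) = \<sigma> k (f g)))}"

definition right_translate :: "'e::field mat3 \<Rightarrow> ('e mat3 \<Rightarrow> 'v) \<Rightarrow> 'e mat3 \<Rightarrow> 'v" where
  "right_translate h f = (\<lambda>g. f (g ** h))"

text \<open>The set \<open>K \<alpha>\<^sup>n H\<close>.\<close>

definition double_coset ::
  "'e::field unram_datum \<Rightarrow> maxcpt \<Rightarrow> int \<Rightarrow> 'e mat3 set \<Rightarrow> 'e mat3 set" where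
  "double_coset D \<kappa> n H = {k ** (alpha D [^]\<^bsub>U21 D\<^esub> n) ** h | k h. k \<in> max_compact D \<kappa> \<and> h \<in> H}"

definition hecke_fun ::
  "'e::field unram_datum \<Rightarrow> maxcpt \<Rightarrow> ('c::field \<Rightarrow> 'v::ab_group_add \<Rightarrow> 'v) \<Rightarrow>
     ('e mat3 \<Rightarrow> 'v \<Rightarrow> 'v) \<Rightarrow> 'e mat3 \<Rightarrow> 'v \<Rightarrow> 'v" where
  "hecke_fun D \<kappa> s \<sigma> = (THE \<phi>.
     (\<forall>g. g \<notin> double_coset D \<kappa> 1 (max_compact D \<kappa>) \<longrightarrow> \<phi> g = (\<lambda>x. 0)) \<and>
     (\<forall>k\<in>max_compact D \<kappa>. \<forall>g\<in>carrier (U21 D). \<forall>k'\<in>max_compact D \<kappa>.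
        \<phi> (k ** g ** k') = \<sigma> k \<circ> \<phi> g \<circ> \<sigma> k') \<and>
     \<phi> (alpha D) = j_proj D \<kappa> s \<sigma>)"

text \<open>
  The summand does not depend on the representative \<open>y\<close> of the coset \<open>C = K y\<close>.
\<close>

definition hecke_term ::
  "'e::field unram_datum \<Rightarrow> maxcpt \<Rightarrow> ('c::field \<Rightarrow> 'v::ab_group_add \<Rightarrow> 'v) \<Rightarrow>
     ('e mat3 \<Rightarrow> 'v \<Rightarrow> 'v) \<Rightarrow> ('e mat3 \<Rightarrow> 'v) \<Rightarrow> 'e mat3 \<Rightarrow> 'e mat3 set \<Rightarrow> 'v" where
  "hecke_term D \<kappa> s \<sigma> f g C =
     (let y = (SOME y. y \<in> C) in hecke_fun D \<kappa> s \<sigma> (g ** inv\<^bsub>U21 D\<^esub> y) (f y))"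

text \<open>
  The sum is restricted to the (finitely many) nonzero summands, because \<open>sum\<close> is \<open>0\<close> on infinite
  index sets.
\<close>

definition hecke_op ::
  "'e::field unram_datum \<Rightarrow> maxcpt \<Rightarrow> ('c::field \<Rightarrow> 'v::ab_group_add \<Rightarrow> 'v) \<Rightarrow>
     ('e mat3 \<Rightarrow> 'v \<Rightarrow> 'v) \<Rightarrow> ('e mat3 \<Rightarrow> 'v) \<Rightarrow> 'e mat3 \<Rightarrow> 'v" where
  "hecke_op D \<kappa> s \<sigma> f g =
     (\<Sum>C\<in>{C \<in> rcosets\<^bsub>U21 D\<^esub> (max_compact D \<kappa>). hecke_term D \<kappa> s \<sigma> f g C \<noteq> 0}.
        hecke_term D \<kappa> s \<sigma> f g C)"

definition poly_op ::
  "('c::field \<Rightarrow> 'v::ab_group_add \<Rightarrow> 'v) \<Rightarrow> 'c poly \<Rightarrow> (('g \<Rightarrow> 'v) \<Rightarrow> 'g \<Rightarrow> 'v) \<Rightarrow> ('g \<Rightarrow> 'v) \<Rightarrow> 'g \<Rightarrow> 'v" where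
  "poly_op s P T f g = (\<Sum>i\<le>degree P. s (coeff P i) ((T ^^ i) f g))"

text \<open>\<open>e\<close> is an embedding of \<open>\<sigma>\<close> in the restriction of \<open>\<pi>\<close> to \<open>K\<close>.\<close>

definition weight_embedding ::
  "'e::field unram_datum \<Rightarrow> maxcpt \<Rightarrow> ('c::field \<Rightarrow> 'v::ab_group_add \<Rightarrow> 'v) \<Rightarrow>
     ('e mat3 \<Rightarrow> 'v \<Rightarrow> 'v) \<Rightarrow> ('c \<Rightarrow> 'w::ab_group_add \<Rightarrow> 'w) \<Rightarrow> ('e mat3 \<Rightarrow> 'w \<Rightarrow> 'w) \<Rightarrow>
     ('v \<Rightarrow> 'w) \<Rightarrow> bool" where
  "weight_embedding D \<kappa> s \<sigma> s' \<pi> e \<longleftrightarrow>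
     Vector_Spaces.linear s s' e \<and> inj e \<and> (\<forall>k\<in>max_compact D \<kappa>. \<forall>x. e (\<sigma> k x) = \<pi> k (e x))"

text \<open>
  \<open>\<iota>\<close> is a linear \<open>G\<close>-map on the compact induction, and it corresponds to \<open>e\<close> under Frobenius
  reciprocity: its composition with the canonical \<open>K\<close>-embedding of \<open>\<sigma>\<close> (which sends \<open>x\<close> to the
  function supported on \<open>K\<close> with value \<open>x\<close> at \<open>1\<close>) is \<open>e\<close>.
\<close>

definition frobenius_map ::
  "'e::field unram_datum \<Rightarrow> maxcpt \<Rightarrow> ('c::field \<Rightarrow> 'v::ab_group_add \<Rightarrow> 'v) \<Rightarrow>
     ('e mat3 \<Rightarrow> 'v \<Rightarrow> 'v) \<Rightarrow> ('c \<Rightarrow> 'w::ab_group_add \<Rightarrow> 'w) \<Rightarrow> ('e mat3 \<Rightarrow> 'w \<Rightarrow> 'w) \<Rightarrow>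
     ('v \<Rightarrow> 'w) \<Rightarrow> (('e mat3 \<Rightarrow> 'v) \<Rightarrow> 'w) \<Rightarrow> bool" where
  "frobenius_map D \<kappa> s \<sigma> s' \<pi> e \<iota> \<longleftrightarrow>
     (\<forall>f\<in>comp_ind D \<kappa> \<sigma>. \<forall>f'\<in>comp_ind D \<kappa> \<sigma>. \<iota> (\<lambda>g. f g + f' g) = \<iota> f + \<iota> f') \<and>
     (\<forall>c. \<forall>f\<in>comp_ind D \<kappa> \<sigma>. \<iota> (\<lambda>g. s c (f g)) = s' c (\<iota> f)) \<and>
     (\<forall>h\<in>carrier (U21 D). \<forall>f\<in>comp_ind D \<kappa> \<sigma>. \<iota> (right_translate h f) = \<pi> h (\<iota> f)) \<and>
     (\<forall>x. \<iota> (\<lambda>g. if g \<in> max_compact D \<kappa> then \<sigma> g x else 0) = e x)"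


section \<open>The functions \<open>f\<^sub>n\<close> and the spaces \<open>R\<^sub>n\<^sup>\<plusminus>\<close>\<close>

definition f_fun ::
  "'e::field unram_datum \<Rightarrow> maxcpt \<Rightarrow> ('e mat3 \<Rightarrow> 'v \<Rightarrow> 'v) \<Rightarrow> 'v \<Rightarrow> int \<Rightarrow>
     'e mat3 \<Rightarrow> 'v::ab_group_add" where
  "f_fun D \<kappa> \<sigma> v0 n = (THE f.
     f \<in> comp_ind D \<kappa> \<sigma> \<and>
     (\<forall>h\<in>pro_p_iwahori D \<kappa>. right_translate h f = f) \<and>
     (\<forall>g. g \<notin> double_coset D \<kappa> (- n) (pro_p_iwahori D \<kappa>) \<longrightarrow> f g = 0) \<and>
     f (alpha D [^]\<^bsub>U21 D\<^esub> (- n)) = (if n > 0 then \<sigma> (betaK D \<kappa>) v0 else v0))"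

definition R_plus ::
  "'e::field unram_datum \<Rightarrow> maxcpt \<Rightarrow> ('e mat3 \<Rightarrow> 'v \<Rightarrow> 'v) \<Rightarrow> nat \<Rightarrow>
     ('e mat3 \<Rightarrow> 'v::ab_group_add) set" where
  "R_plus D \<kappa> \<sigma> n = {f \<in> comp_ind D \<kappa> \<sigma>.
     \<forall>g. g \<notin> double_coset D \<kappa> (int n) (iwahori D \<kappa>) \<longrightarrow> f g = 0}"

definition R_minus ::
  "'e::field unram_datum \<Rightarrow> maxcpt \<Rightarrow> ('e mat3 \<Rightarrow> 'v \<Rightarrow> 'v) \<Rightarrow> nat \<Rightarrow>
     ('e mat3 \<Rightarrow> 'v::ab_group_add) set" where
  "R_minus D \<kappa> \<sigma> n = {f \<in> comp_ind D \<kappa> \<sigma>.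
     \<forall>g. g \<notin> double_coset D \<kappa> (- (int n + 1)) (iwahori D \<kappa>) \<longrightarrow> f g = 0}"

end

theory Submission
  imports Defs "HOL-Library.Function_Algebras"
begin

text \<open>
  Write \<open>d = degree P\<close> and \<open>s = \<beta>\<^sub>K\<close>.  Since \<open>G\<close> is the union of the double cosets \<open>K \<alpha>\<^sup>n I\<close>, every function supported on
  finitely many cosets of \<open>K\<close> is a sum of elements of the spaces \<open>R\<^sub>n\<^sup>\<plusminus>\<close>.  Let \<open>h\<close> be supported on \<open>K \<alpha>\<^sup>-\<^sup>d\<close> with
  value \<open>v0\<close> there.  The Hecke operator moves supports by one step of the tree, measured by the size of the first
  column relative to the lattice stabilized by \<open>K\<close>; so \<open>T\<^sup>i h\<close> lies in the sum of the \<open>R\<^sub>n\<^sup>-\<close> for \<open>i < d\<close>, while \<open>T\<^sup>d h\<close>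
  is \<open>f\<^sub>0\<close> plus an element of that sum, because only one path of length \<open>d\<close> leads to \<open>K\<close> and \<open>j v0 = v0\<close>.  As \<open>\<iota>\<close>
  kills \<open>P(T) h\<close>, this proves (1).  Part (2) is the same argument with third columns, starting from the value
  \<open>s v0\<close> on \<open>K \<alpha>\<^sup>d\<^sup>-\<^sup>1\<close>.

  The Hecke operator makes sense because \<open>\<sigma>\<close> is the direct sum of its \<open>I\<^sub>1\<close>-invariants and the kernel of the projection
  to the \<open>I\<^sub>1'\<close>-coinvariants.  This follows from the fixed vector property of pro-\<open>p\<close> groups in characteristic \<open>p\<close>,
  applied to \<open>\<sigma>\<close> and to its dual, once it is known that for a torus eigenvector \<open>x\<close> in the invariants the
  \<open>I\<^sub>1\<close>-translates of \<open>s x\<close> span \<open>\<sigma>\<close>.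
\<close>

section \<open>The valuation and the Galois involution\<close>

text \<open>\<open>j_proj\<close>, \<open>hecke_fun\<close> and \<open>f_fun\<close> are definite
  descriptions, so nothing can be evaluated before existence and uniqueness are established. For
  \<open>j_proj\<close> no classification of weights is invoked: irreducibility, the rank-one Bruhat
  decomposition of \<open>K\<close> and the finiteness of the image of \<open>I1\<close> suffice.
  Both maximal compact subgroups are treated at once through the integer \<open>c\<close>.

  The column sizes work as a distance because left multiplication by \<open>K\<close> does not
  change them, a step of the Hecke operator lowers them by at most one, and they bound the exponent
  \<open>n\<close> on \<open>K \<alpha>^n I\<close>.

  The two parts differ in one respect. The target of (1) is the single coset \<open>K\<close>,
  whereas the support of \<open>f_1\<close> consists of all cosets of \<open>al (- 1) ** u\<close>
  with \<open>u\<close> in \<open>I1\<close>. In (2) the top power of the Hecke operator must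
  therefore be evaluated at each of them.

  All functions that occur have support in finitely many cosets of \<open>K\<close>, so compactness
  enters only through the fact that such functions belong to the compact induction.\<close>

locale unramified =
  fixes D :: "'e::field unram_datum"
  assumes unramified: "unramified_quadratic D"
begin

abbreviation v where "v \<equiv> val D"
abbreviation cj where "cj \<equiv> gal D"
abbreviation w where "w \<equiv> unif D"
abbreviation P where "P \<equiv> frac_ideal (val D)"

lemma local_E: "nonarch_local_field UNIV v" and local_F: "nonarch_local_field (baseF D) v"
  using unramified by (auto simp: unramified_quadratic_def)

lemma val_mult: "x \<noteq> 0 \<Longrightarrow> y \<noteq> 0 \<Longrightarrow> v (x * y) = v x + v y"
  using local_E by (simp add: nonarch_local_field_def)

lemma val_add: "x \<noteq> 0 \<Longrightarrow> y \<noteq> 0 \<Longrightarrow> x + y \<noteq> 0 \<Longrightarrow> min (v x) (v y) \<le> v (x + y)"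
  using local_E by (simp add: nonarch_local_field_def)

lemma val_1 [simp]: "v 1 = 0"
  using val_mult[of 1 1] by simp

lemma val_minus [simp]: "v (- x) = v x"
proof (cases "x = 0")
  case False
  have "v ((-1) * (-1)) = v (-1) + v (-1)"
    by (rule val_mult) auto
  then have "v (-1) = 0"
    by simp
  then show ?thesis
    using val_mult[of "-1" x] False by simp
qed simp

lemma val_inverse: "x \<noteq> 0 \<Longrightarrow> v (inverse x) = - v x"
  using val_mult[of x "inverse x"] by simp

lemma val_divide: "x \<noteq> 0 \<Longrightarrow> y \<noteq> 0 \<Longrightarrow> v (x / y) = v x - v y"
  using val_mult[of x "inverse y"] by (simp add: divide_inverse val_inverse)

lemma unif_nonzero [simp]: "w \<noteq> 0" and val_unif [simp]: "v w = 1" and unif_in_F: "w \<in> baseF D"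
  using unramified by (auto simp: unramified_quadratic_def)

lemma val_power: "x \<noteq> 0 \<Longrightarrow> v (x ^ n) = int n * v x"
  by (induction n) (auto simp: val_mult algebra_simps)

lemma val_power_int: "x \<noteq> 0 \<Longrightarrow> v (x powi n) = n * v x"
  by (auto simp: power_int_def val_power val_inverse)

lemma P_iff: "x \<in> P n \<longleftrightarrow> x = 0 \<or> n \<le> v x"
  by (simp add: frac_ideal_def)

lemma P_0 [simp]: "0 \<in> P n"
  by (simp add: P_iff)

lemma P_1 [simp]: "1 \<in> P n \<longleftrightarrow> n \<le> 0"
  by (simp add: P_iff)

lemma P_add: "x \<in> P n \<Longrightarrow> y \<in> P n \<Longrightarrow> x + y \<in> P n"
  using val_add[of x y] by (cases "x = 0"; cases "y = 0"; cases "x + y = 0") (auto simp: P_iff)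

lemma P_minus [simp]: "- x \<in> P n \<longleftrightarrow> x \<in> P n"
  by (simp add: P_iff)

lemma P_diff: "x \<in> P n \<Longrightarrow> y \<in> P n \<Longrightarrow> x - y \<in> P n"
  using P_add[of x n "- y"] by simp

lemma P_mult: "x \<in> P m \<Longrightarrow> y \<in> P n \<Longrightarrow> x * y \<in> P (m + n)"
  by (cases "x = 0"; cases "y = 0") (auto simp: P_iff val_mult)

lemma P_mono: "m \<le> n \<Longrightarrow> x \<in> P n \<Longrightarrow> x \<in> P m"
  by (auto simp: P_iff)

lemma gal_add [simp]: "cj (x + y) = cj x + cj y" and gal_mult [simp]: "cj (x * y) = cj x * cj y"
  and gal_base: "x \<in> baseF D \<Longrightarrow> cj x = x" and gal_inj: "inj cj"
  using unramified by (auto simp: unramified_quadratic_def bij_def)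

lemma gal_0 [simp]: "cj 0 = 0"
  by (metis gal_add add_0 add_cancel_right_right)

lemma gal_eq_0 [simp]: "cj x = 0 \<longleftrightarrow> x = 0"
  using gal_inj by (metis gal_0 injD)

lemma gal_1 [simp]: "cj 1 = 1"
proof -
  have "cj 1 * cj 1 = cj 1 * 1"
    unfolding gal_mult[symmetric] by simp
  moreover have "cj 1 \<noteq> 0"
    by simp
  ultimately show ?thesis
    by (metis mult_left_cancel)
qed

lemma gal_minus [simp]: "cj (- x) = - cj x"
  using gal_add[of x "- x"] by (simp add: eq_neg_iff_add_eq_0 add.commute)

lemma gal_diff [simp]: "cj (x - y) = cj x - cj y"
  using gal_add[of x "- y"] by simp

lemma gal_inverse [simp]: "cj (inverse x) = inverse (cj x)"
  using gal_mult[of x "inverse x"] by (cases "x = 0") (auto simp: inverse_eq_divide field_simps)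

lemma gal_divide [simp]: "cj (x / y) = cj x / cj y"
  by (simp add: divide_inverse)

lemma gal_unif [simp]: "cj w = w"
  by (simp add: gal_base unif_in_F)

lemma gal_power [simp]: "cj (x ^ n) = cj x ^ n"
  by (induction n) auto

lemma gal_power_int [simp]: "cj (x powi n) = cj x powi n"
  by (simp add: power_int_def)

lemma subfield_F: "is_subfield (baseF D)"
  using local_F by (simp add: nonarch_local_field_def)

text \<open>\<open>t\<close> is a root of a monic quadratic polynomial over \<open>F\<close> whose
  other root is \<open>b - t\<close>. Its conjugate is again a root, and differs from
  \<open>t\<close> because \<open>gal D\<close> is not the identity.\<close>

lemma gal_generator:
  obtains t b where "\<And>x. \<exists>a\<in>baseF D. \<exists>b\<in>baseF D. x = a + b * t" "b \<in> baseF D" "cj t = b - t" "cj t \<noteq> t"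
proof -
  obtain t where t: "\<And>x. \<exists>a\<in>baseF D. \<exists>b\<in>baseF D. x = a + b * t"
    using unramified by (auto simp: unramified_quadratic_def)
  obtain a b where ab: "a \<in> baseF D" "b \<in> baseF D" "t * t = a + b * t"
    using t by blast
  have "cj t * cj t = a + b * cj t"
    using ab by (metis gal_add gal_mult gal_base)
  then have "(cj t - t) * (cj t - (b - t)) = 0"
    using ab(3) by algebra
  moreover have "cj t \<noteq> t"
  proof
    assume "cj t = t"
    then have "cj x = x" for x
      using t[of x] by (auto simp: gal_base)
    then have "cj = id"
      by auto
    then show False
      using unramified by (auto simp: unramified_quadratic_def)
  qed
  ultimately show ?thesis
    using that[of t b] t ab by auto
qed

text \<open>The datum only makes \<open>gal D\<close> an automorphism over \<open>F\<close>; that it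
  is an involution follows from its effect on the generator.\<close>

lemma gal_gal [simp]: "cj (cj x) = x"
proof -
  obtain t b where t: "\<And>x. \<exists>a\<in>baseF D. \<exists>b\<in>baseF D. x = a + b * t" "b \<in> baseF D" "cj t = b - t"
    using gal_generator by metis
  obtain a c where "a \<in> baseF D" "c \<in> baseF D" "x = a + c * t"
    using t(1) by blast
  then show ?thesis
    using t by (simp add: gal_base)
qed

lemma fixed_imp_base: "cj x = x \<Longrightarrow> x \<in> baseF D"
proof -
  assume x: "cj x = x"
  obtain t b where t: "\<And>x. \<exists>a\<in>baseF D. \<exists>b\<in>baseF D. x = a + b * t" "cj t \<noteq> t"
    using gal_generator by metis
  obtain a c where ac: "a \<in> baseF D" "c \<in> baseF D" "x = a + c * t"
    using t(1) by blast
  then have "c * (cj t - t) = 0"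
    using x by (simp add: gal_base algebra_simps)
  then show ?thesis
    using t(2) ac by auto
qed

text \<open>
  An element \<open>y\<close> of norm \<open>1\<close> and positive valuation would be the limit of the iteration
  \<open>z \<mapsto> 1 / (tr y - z)\<close>, started at \<open>0\<close>, hence lie in the complete field \<open>F\<close>.
\<close>

lemma norm_one_val:
  assumes "y * cj y = 1"
  shows "\<not> 0 < v y"
proof
  assume pos: "0 < v y"
  have y0: "y \<noteq> 0"
    using assms by auto
  have cy: "cj y = inverse y"
    using assms y0 by (simp add: field_simps)
  define c where "c = y + cj y"
  have cF: "c \<in> baseF D"
    by (rule fixed_imp_base) (simp add: c_def add.commute)
  define z where "z n = ((\<lambda>z. inverse (c - z)) ^^ n) 0" for n
  have sub: "x \<in> baseF D \<Longrightarrow> y \<in> baseF D \<Longrightarrow> x - y \<in> baseF D" for x y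
    using subfield_F by (metis diff_conv_add_uminus is_subfield_def)
  have zF: "z n \<in> baseF D" for n
    by (induction n) (use subfield_F cF sub in \<open>auto simp: z_def is_subfield_def\<close>)
  have main: "z n \<in> P 1 \<and> z n - y \<in> P (int n)" for n
  proof (induction n)
    case 0
    then show ?case
      using pos by (auto simp: z_def P_iff)
  next
    case (Suc n)
    have yP: "y \<in> P 1"
      using pos by (auto simp: P_iff)
    have "c - z n = cj y + (y - z n)"
      by (simp add: c_def)
    have vc: "v (cj y) = - v y"
      using cy y0 by (simp add: val_inverse)
    have "y - z n \<in> P 1"
      using Suc yP by (auto intro: P_diff)
    have nz: "c - z n \<noteq> 0"
    proof
      assume "c - z n = 0"
      then have "cj y = - (y - z n)"
        unfolding c_def by algebra
      then have "cj y \<in> P 1"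
        using \<open>y - z n \<in> P 1\<close> by (metis P_minus)
      then show False
        using vc pos y0 by (auto simp: P_iff)
    qed
    have vle: "v (c - z n) \<le> - 1"
    proof (rule ccontr)
      assume "\<not> ?thesis"
      then have "c - z n \<in> P 0"
        by (auto simp: P_iff)
      moreover have "cj y = (c - z n) - (y - z n)"
        by (simp add: c_def)
      ultimately have "cj y \<in> P 0"
        using P_diff P_mono[of 0 1] \<open>y - z n \<in> P 1\<close> by (metis zero_le_one)
      then show False
        using vc pos y0 by (auto simp: P_iff)
    qed
    have inv: "inverse (c - z n) \<in> P 1"
      using vle nz by (auto simp: P_iff val_inverse)
    have zS: "z (Suc n) = inverse (c - z n)"
      by (simp add: z_def)
    \<comment> \<open>\<open>y\<close> is a fixed point of the iteration, since
      \<open>c - y = cj y = inverse y\<close>; the error gets multiplied by an element of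
      \<open>P 2\<close>.\<close>
    have "inverse (c - z n) - y = (z n - y) * (inverse (c - z n) * y)"
    proof -
      have "1 - y * (c - z n) = (z n - y) * y"
        using assms by (simp add: c_def algebra_simps)
      then show ?thesis
        using nz by (simp add: field_simps)
    qed
    moreover have "(z n - y) * (inverse (c - z n) * y) \<in> P (int n + (1 + 1))"
      using Suc inv yP by (intro P_mult) auto
    ultimately show ?case
      using inv P_mono[of "int (Suc n)" "int n + (1 + 1)"] zS by auto
  qed
  have "\<exists>N. \<forall>i\<ge>N. \<forall>j\<ge>N. z i - z j \<in> P n" for n
  proof (intro exI allI impI)
    fix i j :: nat
    assume ij: "i \<ge> nat n" "j \<ge> nat n"
    have "(z i - y) - (z j - y) \<in> P n"
      using main[of i] main[of j] ij
      by (intro P_diff[of "z i - y" n "z j - y"]) (auto intro: P_mono[of n "int i"] P_mono[of n "int j"])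
    then show "z i - z j \<in> P n"
      by simp
  qed
  then obtain x where x: "x \<in> baseF D" "\<And>n. \<exists>N. \<forall>i\<ge>N. z i - x \<in> P n"
  proof -
    have "\<forall>X. (\<forall>i. X i \<in> baseF D) \<and> (\<forall>n. \<exists>N. \<forall>i\<ge>N. \<forall>j\<ge>N. X i - X j \<in> P n) \<longrightarrow>
        (\<exists>x\<in>baseF D. \<forall>n. \<exists>N. \<forall>i\<ge>N. X (i::nat) - x \<in> P n)"
      using local_F unfolding nonarch_local_field_def by (elim conjE)
    from this[rule_format, of z] zF \<open>\<And>n. \<exists>N. \<forall>i\<ge>N. \<forall>j\<ge>N. z i - z j \<in> P n\<close> show ?thesis
      using that by blast
  qed
  have "y - x \<in> P n" for n
  proof -
    obtain N where N: "\<And>i. i \<ge> N \<Longrightarrow> z i - x \<in> P n"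
      using x by blast
    let ?i = "max N (nat n)"
    have "(z ?i - x) - (z ?i - y) \<in> P n"
      using main[of ?i] N[of ?i]
      by (intro P_diff[of "z ?i - x" n "z ?i - y"]) (auto intro: P_mono[of n "int ?i"])
    then show ?thesis
      by simp
  qed
  from this[of "v (y - x) + 1"] have "y = x"
    by (auto simp: P_iff)
  then have "cj y = y"
    using x gal_base by simp
  then have "v (y * y) = 0"
    using assms by simp
  then show False
    using val_mult[of y y] y0 pos by simp
qed

text \<open>Both \<open>x / cj x\<close> and its inverse have norm 1, so by
  \<open>norm_one_val\<close> neither has positive valuation.\<close>

lemma val_gal [simp]: "v (cj x) = v x"
proof (cases "x = 0")
  case False
  have "\<not> 0 < v (x / cj x)" "\<not> 0 < v (cj x / x)"
    using False by (auto intro!: norm_one_val)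
  then show ?thesis
    using False by (simp add: val_divide)
qed simp

lemma P_gal [simp]: "cj x \<in> P n \<longleftrightarrow> x \<in> P n"
  by (simp add: P_iff)

text \<open>Taking norms doubles the valuation, and valuations are integers; so the odd bound
  \<open>2 * m - 1\<close> already forces \<open>2 * m\<close>.\<close>

lemma P_norm: "x * cj x \<in> P n \<Longrightarrow> 2 * m - 1 \<le> n \<Longrightarrow> x \<in> P m"
  by (cases "x = 0") (auto simp: P_iff val_mult)

subsection \<open>Finiteness of residue rings and completeness\<close>

lemma residues_1: "\<exists>R. finite R \<and> (\<forall>x\<in>P 0. \<exists>r\<in>R. x - r \<in> P 1)"
proof -
  let ?c = "\<lambda>x. {y. y - x \<in> P 1}"
  have "finite (?c ` P 0)"
    using local_E by (simp add: nonarch_local_field_def)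
  from finite_subset_image[OF this order_refl] obtain R
    where R: "R \<subseteq> P 0" "finite R" "?c ` P 0 = ?c ` R"
    by (elim exE conjE)
  have "\<exists>r\<in>R. x - r \<in> P 1" if "x \<in> P 0" for x
  proof -
    have "?c x \<in> ?c ` R"
      unfolding R(3)[symmetric] using that by (rule imageI)
    then obtain r where "r \<in> R" "?c x = ?c r"
      by (rule imageE)
    then show ?thesis
      by (auto simp: set_eq_iff dest: spec[of _ x])
  qed
  with R show ?thesis
    by blast
qed

text \<open>One more digit at each step: the remainder divided by \<open>w powi (m + int n)\<close>
  is integral, hence congruent modulo \<open>P 1\<close> to one of finitely many
  representatives.\<close>

lemma residues: "\<exists>R. finite R \<and> (\<forall>x\<in>P m. \<exists>r\<in>R. x - r \<in> P (m + int n))"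
proof (induction n)
  case 0
  show ?case
    by (intro exI[of _ "{0}"]) auto
next
  case (Suc n)
  then obtain R where R: "finite R" "\<And>x. x \<in> P m \<Longrightarrow> \<exists>r\<in>R. x - r \<in> P (m + int n)"
    by blast
  obtain R1 where R1: "finite R1" "\<And>x. x \<in> P 0 \<Longrightarrow> \<exists>r\<in>R1. x - r \<in> P 1"
    using residues_1 by blast
  define u where "u = w powi (m + int n)"
  have u: "u \<noteq> 0" "v u = m + int n"
    by (auto simp: u_def val_power_int)
  have "\<exists>r\<in>(\<lambda>(a, b). a + u * b) ` (R \<times> R1). x - r \<in> P (m + int (Suc n))" if x: "x \<in> P m" for x
  proof -
    obtain r where r: "r \<in> R" "x - r \<in> P (m + int n)"
      using R x by blast
    have "(x - r) / u \<in> P 0"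
      using r u by (cases "x = r") (auto simp: P_iff val_divide)
    then obtain r' where r': "r' \<in> R1" "(x - r) / u - r' \<in> P 1"
      using R1 by blast
    have "u * ((x - r) / u - r') \<in> P ((m + int n) + 1)"
      by (rule P_mult) (use u r' in \<open>auto simp: P_iff\<close>)
    moreover have "u * ((x - r) / u - r') = x - (r + u * r')"
    proof -
      have "u * ((x - r) / u) = x - r"
        using u by simp
      then show ?thesis
        by (simp add: right_diff_distrib[of u "(x - r) / u"])
    qed
    moreover have "(m + int n) + 1 = m + int (Suc n)"
      by simp
    ultimately have "x - (r + u * r') \<in> P (m + int (Suc n))"
      by metis
    moreover have "r + u * r' \<in> (\<lambda>(a, b). a + u * b) ` (R \<times> R1)"
      using r r' by (intro image_eqI[of _ _ "(r, r')"]) auto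
    ultimately show ?thesis
      by blast
  qed
  moreover have "finite ((\<lambda>(a, b). a + u * b) ` (R \<times> R1))"
    using R R1 by auto
  ultimately show ?case
    by blast
qed

lemma complete:
  assumes "\<And>n. \<exists>N. \<forall>i\<ge>N. \<forall>j\<ge>N. X i - X j \<in> P n"
  obtains x where "\<And>n. \<exists>N. \<forall>i\<ge>N. X (i::nat) - x \<in> P n"
proof -
  have "\<forall>X. (\<forall>i. X i \<in> UNIV) \<and> (\<forall>n. \<exists>N. \<forall>i\<ge>N. \<forall>j\<ge>N. X i - X j \<in> P n) \<longrightarrow>
      (\<exists>x\<in>UNIV. \<forall>n. \<exists>N. \<forall>i\<ge>N. X (i::nat) - x \<in> P n)"
    using local_E unfolding nonarch_local_field_def by (elim conjE)
  from this[rule_format, of X] assms show ?thesis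
    using that by blast
qed

end

section \<open>The unitary group and its Iwahori subgroups\<close>

lemma mat3_eq_iff:
  "(A :: 'a mat3) = B \<longleftrightarrow> A$1$1 = B$1$1 \<and> A$1$2 = B$1$2 \<and> A$1$3 = B$1$3 \<and>
     A$2$1 = B$2$1 \<and> A$2$2 = B$2$2 \<and> A$2$3 = B$2$3 \<and>
     A$3$1 = B$3$1 \<and> A$3$2 = B$3$2 \<and> A$3$3 = B$3$3"
  by (auto simp: vec_eq_iff forall_3)

lemma mat3_mult: "((A :: 'a::semiring_1 mat3) ** B) $ i $ j = A$i$1 * B$1$j + A$i$2 * B$2$j + A$i$3 * B$3$j"
  by (simp add: matrix_matrix_mult_def sum_3)

lemma mat_1_entries [simp]:
  "(mat 1 :: 'a::zero_neq_one mat3)$1$1 = 1" "(mat 1 :: 'a mat3)$1$2 = 0" "(mat 1 :: 'a mat3)$1$3 = 0"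
  "(mat 1 :: 'a mat3)$2$1 = 0" "(mat 1 :: 'a mat3)$2$2 = 1" "(mat 1 :: 'a mat3)$2$3 = 0"
  "(mat 1 :: 'a mat3)$3$1 = 0" "(mat 1 :: 'a mat3)$3$2 = 0" "(mat 1 :: 'a mat3)$3$3 = 1"
  by (auto simp: mat_def)

lemma matrix3_entries [simp]:
  "matrix3 a b c d e f g h i $1$1 = a" "matrix3 a b c d e f g h i $1$2 = b" "matrix3 a b c d e f g h i $1$3 = c"
  "matrix3 a b c d e f g h i $2$1 = d" "matrix3 a b c d e f g h i $2$2 = e" "matrix3 a b c d e f g h i $2$3 = f"
  "matrix3 a b c d e f g h i $3$1 = g" "matrix3 a b c d e f g h i $3$2 = h" "matrix3 a b c d e f g h i $3$3 = i"
  by (auto simp: matrix3_def)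

lemma matrix_diff_ldistrib: "(A :: 'a::ring_1 mat3) ** (B - C) = A ** B - A ** C"
  by (simp add: matrix_matrix_mult_def vec_eq_iff right_diff_distrib sum_subtractf)

lemma matrix_diff_rdistrib: "((B :: 'a::ring_1 mat3) - C) ** A = B ** A - C ** A"
  by (simp add: matrix_matrix_mult_def vec_eq_iff left_diff_distrib sum_subtractf)

text \<open>In the index type \<open>3\<close> the numeral 3 equals 0, so differences of indices are
  formed only after this transfer to the integers.\<close>

definition idx :: "3 \<Rightarrow> int" where
  "idx i = (if i = 1 then 1 else if i = 2 then 2 else 3)"

lemma idx_simps [simp]: "idx 1 = 1" "idx 2 = 2" "idx 3 = 3"
  by (auto simp: idx_def)

context unramified
begin

abbreviation G where "G \<equiv> carrier (U21 D)"

text \<open>The adjoint for the Hermitian form, i.e. the conjugate transpose multiplied by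
  \<open>beta\<close> on both sides. On the group it is the inverse, but it is additive and defined
  for all matrices, which suits congruences.\<close>

definition star :: "'e mat3 \<Rightarrow> 'e mat3" where
  "star g = matrix3 (cj (g$3$3)) (cj (g$2$3)) (cj (g$1$3))
                    (cj (g$3$2)) (cj (g$2$2)) (cj (g$1$2))
                    (cj (g$3$1)) (cj (g$2$1)) (cj (g$1$1))"

lemma star_mult: "star (g ** h) = star h ** star g"
  by (simp add: star_def mat3_eq_iff mat3_mult algebra_simps)

lemma star_star [simp]: "star (star g) = g"
  by (simp add: star_def mat3_eq_iff)

lemma star_one [simp]: "star (mat 1) = mat 1"
  by (simp add: star_def mat3_eq_iff)

lemma star_diff: "star (g - h) = star g - star h"
  by (simp add: star_def mat3_eq_iff)

text \<open>Conjugating the defining relation entrywise and multiplying by the involution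
  \<open>beta\<close> from the left gives this form.\<close>

lemma G_iff: "g \<in> G \<longleftrightarrow> star g ** g = mat 1"
proof -
  have "transpose g ** beta ** (\<chi> i j. cj (g $ i $ j)) = beta \<longleftrightarrow> star g ** g = mat 1" (is "?l \<longleftrightarrow> ?r")
  proof -
    have bb: "beta ** beta = (mat 1 :: 'e mat3)"
      by (simp add: beta_def mat3_eq_iff mat3_mult)
    have e: "star g ** g = beta ** (\<chi> i j. cj ((transpose g ** beta ** (\<chi> i j. cj (g $ i $ j))) $ i $ j))"
      by (simp add: beta_def star_def transpose_def mat3_eq_iff mat3_mult)
    have b: "(\<chi> i j. cj (beta $ i $ j)) = beta"
      by (simp add: beta_def mat3_eq_iff)
    show ?thesis
    proof
      assume ?l
      then show ?r
        unfolding e by (simp add: b bb)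
    next
      assume r: ?r
      define X where "X = transpose g ** beta ** (\<chi> i j. cj (g $ i $ j))"
      have "beta ** (\<chi> i j. cj (X $ i $ j)) = mat 1"
        using r e by (simp add: X_def)
      then have "beta ** (beta ** (\<chi> i j. cj (X $ i $ j))) = beta"
        by simp
      then have "(\<chi> i j. cj (X $ i $ j)) = beta"
        by (simp add: matrix_mul_assoc bb)
      from arg_cong[OF this, of "\<lambda>A. cj (A $ i $ j)" for i j]
      have "X $ i $ j = cj (beta $ i $ j)" for i j
        by simp
      then have "X $ i $ j = beta $ i $ j" for i j
        using arg_cong[OF b, of "\<lambda>A. A $ i $ j"] by simp
      then show ?l
        by (simp add: X_def[symmetric] mat3_eq_iff)
    qed
  qed
  moreover have "star g ** g = mat 1 \<Longrightarrow> invertible g"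
    using invertible_left_inverse by blast
  ultimately show ?thesis
    by (auto simp: U21_def)
qed

lemma star_mult_left: "g \<in> G \<Longrightarrow> star g ** g = mat 1"
  by (simp add: G_iff)

lemma star_mult_right: "g \<in> G \<Longrightarrow> g ** star g = mat 1"
  using G_iff matrix_left_right_inverse by blast

lemma star_G [simp]: "star g \<in> G \<longleftrightarrow> g \<in> G"
  by (metis G_iff star_mult_right star_star)

lemma one_G [simp]: "mat 1 \<in> G"
  by (simp add: G_iff)

lemma mult_G [simp]: "g \<in> G \<Longrightarrow> h \<in> G \<Longrightarrow> g ** h \<in> G"
  by (metis G_iff matrix_mul_assoc matrix_mul_rid star_mult)

lemma U21_mult [simp]: "x \<otimes>\<^bsub>U21 D\<^esub> y = x ** y" and U21_one [simp]: "\<one>\<^bsub>U21 D\<^esub> = mat 1"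
  by (simp_all add: U21_def)

lemma group_U21: "group (U21 D)"
  by (rule groupI) (auto simp: matrix_mul_assoc intro!: bexI[of _ "star _"] star_mult_left)

lemma inv_U21 [simp]: "g \<in> G \<Longrightarrow> inv\<^bsub>U21 D\<^esub> g = star g"
  using group.inv_equality[OF group_U21, of "star g" g] by (simp add: star_mult_left)

lemma matrix_inv_G: "g \<in> G \<Longrightarrow> matrix_inv g = star g"
  unfolding matrix_inv_def
  by (rule some_equality) (use star_mult_left star_mult_right in \<open>metis matrix_mul_assoc matrix_mul_lid matrix_mul_rid\<close>)+

lemma cancel_left [simp]: "g \<in> G \<Longrightarrow> star g ** (g ** h) = h" "g \<in> G \<Longrightarrow> g ** (star g ** h) = h"
  by (simp_all add: matrix_mul_assoc star_mult_left star_mult_right)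

lemma col1_isotropic: "g \<in> G \<Longrightarrow> g$1$1 * cj (g$3$1) + g$3$1 * cj (g$1$1) + g$2$1 * cj (g$2$1) = 0"
  using arg_cong[OF star_mult_left[of g], of "\<lambda>x. x$3$1"] by (simp add: mat3_mult star_def algebra_simps)

lemma col3_isotropic: "g \<in> G \<Longrightarrow> g$1$3 * cj (g$3$3) + g$3$3 * cj (g$1$3) + g$2$3 * cj (g$2$3) = 0"
  using arg_cong[OF star_mult_left[of g], of "\<lambda>x. x$1$3"] by (simp add: mat3_mult star_def algebra_simps)

lemma row1_isotropic: "g \<in> G \<Longrightarrow> g$1$1 * cj (g$1$3) + g$1$3 * cj (g$1$1) + g$1$2 * cj (g$1$2) = 0"
  using arg_cong[OF star_mult_right[of g], of "\<lambda>x. x$1$3"] by (simp add: mat3_mult star_def algebra_simps)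

lemma row3_isotropic: "g \<in> G \<Longrightarrow> g$3$1 * cj (g$3$3) + g$3$3 * cj (g$3$1) + g$3$2 * cj (g$3$2) = 0"
  using arg_cong[OF star_mult_right[of g], of "\<lambda>x. x$3$1"] by (simp add: mat3_mult star_def algebra_simps)

text \<open>An isotropic vector \<open>(x, z, y)\<close> has \<open>tr (x * cj y) = - norm z\<close>.\<close>

lemma isotropic_middle:
  assumes "x * cj y + y * cj x + z * cj z = 0" "x \<in> P m" "y \<in> P n" "2 * k - 1 \<le> m + n"
  shows "z \<in> P k"
proof (rule P_norm)
  have "z * cj z = - (x * cj y + y * cj x)"
    using assms(1) by algebra
  moreover have "x * cj y \<in> P (m + n)" "y * cj x \<in> P (n + m)"
    using assms by (auto intro!: P_mult)
  ultimately show "z * cj z \<in> P (m + n)"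
    using P_add[of "x * cj y" "m + n" "y * cj x"] by (simp only: P_minus add.commute)
qed (use assms in auto)

subsection \<open>Congruence filtrations\<close>

definition Q :: "int \<Rightarrow> int \<Rightarrow> 'e set" where
  "Q a n = {x. x = 0 \<or> n \<le> a * v x}"

text \<open>
  The matrices whose \<open>(i, j)\<close> entry \<open>x\<close> satisfies \<open>m \<le> a * v x + b * (j - i)\<close>; the intervening \<open>Q\<close> absorbs
  the junk value of \<open>v\<close> at \<open>0\<close>.  The product of the shapes for \<open>m\<close> and \<open>n\<close> lies in the shape for \<open>m + n\<close>.
  Below, \<open>K\<close> and its pro-\<open>p\<close> radical come from \<open>a = 2\<close>, \<open>b = c\<close> and \<open>m = 0, 1\<close>, and the two Iwahori
  subgroups from \<open>a = 3\<close>, \<open>b = 1 + c\<close> and \<open>m = 0, 1\<close>.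
\<close>

definition Sh :: "int \<Rightarrow> int \<Rightarrow> int \<Rightarrow> 'e mat3 set" where
  "Sh a b m = {x. \<forall>i j. x$i$j \<in> Q a (m - b * (idx j - idx i))}"

lemma Q_add: "0 \<le> a \<Longrightarrow> x \<in> Q a n \<Longrightarrow> y \<in> Q a n \<Longrightarrow> x + y \<in> Q a n"
proof (cases "x = 0 \<or> y = 0 \<or> x + y = 0")
  case False
  assume a: "0 \<le> a" "x \<in> Q a n" "y \<in> Q a n"
  have "a * min (v x) (v y) \<le> a * v (x + y)"
    using val_add[of x y] False a by (intro mult_left_mono) auto
  then show ?thesis
    using a False by (auto simp: Q_def min_def split: if_splits)
qed (auto simp: Q_def)

lemma Q_mult: "x \<in> Q a m \<Longrightarrow> y \<in> Q a n \<Longrightarrow> x * y \<in> Q a (m + n)"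
  by (cases "x = 0"; cases "y = 0") (auto simp: Q_def val_mult algebra_simps)

lemma Sh_iff:
  "x \<in> Sh a b m \<longleftrightarrow> x$1$1 \<in> Q a m \<and> x$1$2 \<in> Q a (m - b) \<and> x$1$3 \<in> Q a (m - 2 * b) \<and>
     x$2$1 \<in> Q a (m + b) \<and> x$2$2 \<in> Q a m \<and> x$2$3 \<in> Q a (m - b) \<and>
     x$3$1 \<in> Q a (m + 2 * b) \<and> x$3$2 \<in> Q a (m + b) \<and> x$3$3 \<in> Q a m"
  by (simp add: Sh_def forall_3 algebra_simps)

lemma Sh_add: "0 \<le> a \<Longrightarrow> x \<in> Sh a b m \<Longrightarrow> y \<in> Sh a b m \<Longrightarrow> x + y \<in> Sh a b m"
  by (simp add: Sh_def Q_add)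

lemma Sh_minus: "- x \<in> Sh a b m \<longleftrightarrow> x \<in> Sh a b m"
  by (simp add: Sh_def Q_def)

lemma Sh_diff: "0 \<le> a \<Longrightarrow> x \<in> Sh a b m \<Longrightarrow> y \<in> Sh a b m \<Longrightarrow> x - y \<in> Sh a b m"
  using Sh_add[of a x b m "- y"] by (simp add: Sh_minus)

lemma Sh_mult:
  assumes "0 \<le> a" "x \<in> Sh a b m" "y \<in> Sh a b n"
  shows "x ** y \<in> Sh a b (m + n)"
proof -
  have "x$i$k * y$k$j \<in> Q a (m + n - b * (idx j - idx i))" for i j k
    using Q_mult[of "x$i$k" a "m - b * (idx k - idx i)" "y$k$j" "n - b * (idx j - idx k)"] assms
    by (simp add: Sh_def algebra_simps)
  then show ?thesis
    using assms(1) by (auto simp: Sh_def mat3_mult intro!: Q_add)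
qed

lemma Sh_mono: "m \<le> n \<Longrightarrow> x \<in> Sh a b n \<Longrightarrow> x \<in> Sh a b m"
  by (fastforce simp: Sh_def Q_def)

lemma Sh_star: "x \<in> Sh a b m \<Longrightarrow> star x \<in> Sh a b m"
  by (simp add: Sh_iff star_def Q_def)

lemma Sh_0: "0 \<in> Sh a b m"
  by (simp add: Sh_def Q_def)

lemma Sh_one: "mat 1 \<in> Sh a b 0"
  by (simp add: Sh_iff Q_def)

definition Gs :: "int \<Rightarrow> int \<Rightarrow> int \<Rightarrow> 'e mat3 set" where
  "Gs a b m = {g \<in> G. g - mat 1 \<in> Sh a b m}"

lemma Gs_G: "g \<in> Gs a b m \<Longrightarrow> g \<in> G"
  by (simp add: Gs_def)

lemma Gs_one: "mat 1 \<in> Gs a b m"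
  by (simp add: Gs_def Sh_0)

lemma Gs_mono: "m \<le> n \<Longrightarrow> Gs a b n \<subseteq> Gs a b m"
  by (auto simp: Gs_def intro: Sh_mono)

lemma Gs_Sh: "0 \<le> a \<Longrightarrow> 0 \<le> m \<Longrightarrow> g \<in> Gs a b m \<Longrightarrow> g \<in> Sh a b 0"
  using Sh_add[of a "g - mat 1" b 0 "mat 1"] by (simp add: Gs_def Sh_one Sh_mono[of 0 m])

lemma Gs_mult:
  assumes "0 \<le> a" "0 \<le> m" "g \<in> Gs a b m" "h \<in> Gs a b m"
  shows "g ** h \<in> Gs a b m"
proof -
  have "(g - mat 1) ** h \<in> Sh a b (m + 0)"
    using assms Gs_Sh by (intro Sh_mult) (auto simp: Gs_def)
  then have "(g - mat 1) ** h + (h - mat 1) \<in> Sh a b m"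
    using assms by (intro Sh_add) (auto simp: Gs_def)
  then show ?thesis
    using assms by (simp add: Gs_def matrix_diff_rdistrib)
qed

lemma Gs_star: "g \<in> Gs a b m \<Longrightarrow> star g \<in> Gs a b m"
  using Sh_star[of "g - mat 1" a b m] by (simp add: Gs_def star_diff)

lemma Gs_normal:
  assumes "0 \<le> a" "k \<in> G" "k \<in> Sh a b 0" "g \<in> Gs a b m"
  shows "k ** g ** star k \<in> Gs a b m"
proof -
  have "k ** (g - mat 1) ** star k \<in> Sh a b (0 + m + 0)"
    using assms by (intro Sh_mult Sh_star) (auto simp: Gs_def)
  then show ?thesis
    using assms by (simp add: Gs_def matrix_diff_rdistrib matrix_diff_ldistrib star_mult_right)
qed

end

text \<open>\<open>K\<close> stabilizes the lattice spanned by \<open>e\<^sub>1\<close>, \<open>e\<^sub>2\<close> and \<open>w\<^sup>c e\<^sub>3\<close>, for the following \<open>c\<close>.\<close>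

primrec lattice_exponent :: "maxcpt \<Rightarrow> int" where
  "lattice_exponent K0 = 0"
| "lattice_exponent K1 = 1"

locale unitary_compact = unramified D for D :: "'e::field unram_datum" +
  fixes \<kappa> :: maxcpt
begin

abbreviation K where "K \<equiv> max_compact D \<kappa>"
abbreviation I where "I \<equiv> iwahori D \<kappa>"
abbreviation I1 where "I1 \<equiv> pro_p_iwahori D \<kappa>"
abbreviation I1' where "I1' \<equiv> pro_p_iwahori' D \<kappa>"
abbreviation s where "s \<equiv> betaK D \<kappa>"

abbreviation c where "c \<equiv> lattice_exponent \<kappa>"

lemma c_cases: "c = 0 \<or> c = 1"
  by (cases \<kappa>) auto

lemma c_bounds: "0 \<le> c" "c \<le> 1"
  using c_cases by auto

text \<open>\<open>- ((- n) div a)\<close> is the ceiling of \<open>n / a\<close>, because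
  \<open>div\<close> rounds down.\<close>

lemma Q_P: "Q 2 n = P (- ((- n) div 2))" "Q 3 n = P (- ((- n) div 3))"
  by (auto simp: Q_def P_iff)

lemma K_iff_P: "g \<in> K \<longleftrightarrow> g \<in> G \<and> g$1$1 \<in> P 0 \<and> g$1$2 \<in> P 0 \<and> g$1$3 \<in> P (- c) \<and>
    g$2$1 \<in> P c \<and> g$2$2 \<in> P 0 \<and> g$2$3 \<in> P 0 \<and> g$3$1 \<in> P c \<and> g$3$2 \<in> P c \<and> g$3$3 \<in> P 0"
proof (cases \<kappa>)
  case K0
  then show ?thesis
    by (auto simp: forall_3 matrix_inv_G star_def)
next
  case K1
  then show ?thesis
    by (auto simp: forall_3)
qed

text \<open>The factor 2 makes room for half-integers: the thresholds
  \<open>- c * (j - i) / 2\<close>, rounded up, are the exponents in \<open>K_iff_P\<close>. This is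
  the filtration at a vertex of the building; the factor 3 in \<open>I_iff\<close> belongs to a
  point inside an adjacent alcove.\<close>

lemma K_iff: "g \<in> K \<longleftrightarrow> g \<in> G \<and> g \<in> Sh 2 c 0"
  using c_cases by (auto simp: K_iff_P Sh_iff Q_P)

lemma K_G [simp]: "g \<in> K \<Longrightarrow> g \<in> G"
  by (simp add: K_iff)

lemma K_mult [simp]: "g \<in> K \<Longrightarrow> h \<in> K \<Longrightarrow> g ** h \<in> K"
  using Sh_mult[of 2 g c 0 h 0] by (simp add: K_iff)

lemma K_star [simp]: "star g \<in> K \<longleftrightarrow> g \<in> K"
  using Sh_star[of g 2 c 0] Sh_star[of "star g" 2 c 0] by (auto simp: K_iff)

lemma K_one [simp]: "mat 1 \<in> K"
  by (simp add: K_iff Sh_one)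

lemma cancel_right [simp]: "g \<in> G \<Longrightarrow> h ** g ** star g = h" "g \<in> G \<Longrightarrow> h ** star g ** g = h"
  by (simp_all add: matrix_mul_assoc[symmetric] star_mult_left star_mult_right)

lemma K_cancel_left: "k \<in> K \<Longrightarrow> g \<in> G \<Longrightarrow> k ** g \<in> K \<longleftrightarrow> g \<in> K"
  by (metis K_G K_mult K_star cancel_left(1))

lemma K_cancel_right: "k \<in> K \<Longrightarrow> g \<in> G \<Longrightarrow> g ** k \<in> K \<longleftrightarrow> g \<in> K"
  using K_mult[of "g ** k" "star k"] cancel_right(1)[of k g] by auto

lemma divide_unif_P: "x / w \<in> P 1 \<longleftrightarrow> x \<in> P 2" "w * x \<in> P 1 \<longleftrightarrow> x \<in> P 0"
  by (cases "x = 0"; auto simp: P_iff val_divide val_mult)+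

lemma I_iff_31: "g \<in> I \<longleftrightarrow> g \<in> K \<and> g$3$1 \<in> P (1 + c)"
proof (cases \<kappa>)
  case K0
  then have c0: "c = 0"
    by simp
  have "g$2$1 \<in> P 1 \<and> g$3$2 \<in> P 1" if g: "g \<in> K" "g$3$1 \<in> P 1"
  proof
    have p: "g$1$1 \<in> P 0" "g$3$3 \<in> P 0" "g \<in> G"
      using g(1) by (simp_all add: K_iff_P)
    show "g$2$1 \<in> P 1"
      by (rule isotropic_middle[OF col1_isotropic[OF p(3)] p(1) g(2)]) simp
    show "g$3$2 \<in> P 1"
      by (rule isotropic_middle[OF row3_isotropic[OF p(3)] g(2) p(2)]) simp
  qed
  then show ?thesis
    using K0 by (auto simp: iwahori_def Let_def simp del: max_compact.simps)
next
  case K1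
  then show ?thesis
    by (auto simp: iwahori_def Let_def divide_unif_P simp del: max_compact.simps)
qed

lemma I_K [simp]: "g \<in> I \<Longrightarrow> g \<in> K"
  by (simp add: I_iff_31)

lemma I_iff: "g \<in> I \<longleftrightarrow> g \<in> G \<and> g \<in> Sh 3 (1 + c) 0"
proof
  assume g: "g \<in> I"
  then have K: "g \<in> K" and g31: "g$3$1 \<in> P (1 + c)"
    by (simp_all add: I_iff_31)
  have p: "g$1$1 \<in> P 0" "g$3$3 \<in> P 0" "g \<in> G"
    using K by (simp_all add: K_iff_P)
  have "g$2$1 \<in> P 1"
    by (rule isotropic_middle[OF col1_isotropic[OF p(3)] p(1) g31]) (use c_bounds in simp)
  moreover have "g$3$2 \<in> P 1"
    by (rule isotropic_middle[OF row3_isotropic[OF p(3)] g31 p(2)]) (use c_bounds in simp)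
  ultimately show "g \<in> G \<and> g \<in> Sh 3 (1 + c) 0"
    using K g31 c_cases by (auto simp: K_iff_P Sh_iff Q_P)
next
  assume "g \<in> G \<and> g \<in> Sh 3 (1 + c) 0"
  then show "g \<in> I"
    using c_cases by (auto simp: I_iff_31 K_iff_P Sh_iff Q_P elim: P_mono[rotated])
qed

lemma reduction_diag [simp]: "reduction D \<kappa> g $ i $ i = g $ i $ i"
  using exhaust_3[of i] by (cases \<kappa>) auto

lemma I1_iff: "g \<in> I1 \<longleftrightarrow> g \<in> I \<and> g$1$1 - 1 \<in> P 1 \<and> g$2$2 - 1 \<in> P 1 \<and> g$3$3 - 1 \<in> P 1"
  by (auto simp: pro_p_iwahori_def forall_3)

lemma P_0_from_diff: "x - 1 \<in> P 1 \<Longrightarrow> x \<in> P 0"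
  using P_add[of "x - 1" 0 1] P_mono[of 0 1 "x - 1"] by simp

lemma I1_Gs: "I1 = Gs 3 (1 + c) 1"
proof -
  have "g \<in> I1 \<longleftrightarrow> g \<in> Gs 3 (1 + c) 1" for g
  proof (rule disjE[OF c_cases])
    assume "c = 0"
    then show ?thesis
      by (simp add: I1_iff I_iff Gs_def Sh_iff Q_P)
        (use P_0_from_diff[of "g$1$1"] P_0_from_diff[of "g$2$2"] P_0_from_diff[of "g$3$3"] in blast)
  next
    assume "c = 1"
    then show ?thesis
      by (simp add: I1_iff I_iff Gs_def Sh_iff Q_P)
        (use P_0_from_diff[of "g$1$1"] P_0_from_diff[of "g$2$2"] P_0_from_diff[of "g$3$3"] in blast)
  qed
  then show ?thesis
    by blast
qed

lemma I1_I [simp]: "g \<in> I1 \<Longrightarrow> g \<in> I"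
  by (simp add: I1_iff)

lemma I1_mult: "g \<in> I1 \<Longrightarrow> h \<in> I1 \<Longrightarrow> g ** h \<in> I1" and I1_star: "g \<in> I1 \<Longrightarrow> star g \<in> I1"
  and I1_one [simp]: "mat 1 \<in> I1"
  by (simp_all add: I1_Gs Gs_mult Gs_star Gs_one)

lemma I1_normal: "k \<in> I \<Longrightarrow> g \<in> I1 \<Longrightarrow> k ** g ** star k \<in> I1"
  by (simp add: I1_Gs Gs_normal I_iff)

lemma I_mult: "g \<in> I \<Longrightarrow> h \<in> I \<Longrightarrow> g ** h \<in> I"
  using Sh_mult[of 3 g "1 + c" 0 h 0] by (simp add: I_iff)

lemma I_star: "g \<in> I \<Longrightarrow> star g \<in> I"
  using Sh_star[of g 3 "1 + c" 0] by (simp add: I_iff)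

lemma s_matrix: "s = matrix3 0 0 (w powi (- c)) 0 1 0 (w powi c) 0 0"
proof (cases \<kappa>)
  case K0
  then show ?thesis
    by (simp add: beta_def)
next
  case K1
  have a: "alpha D \<in> G"
    by (simp add: G_iff alpha_def star_def mat3_eq_iff mat3_mult)
  have "star (alpha D) = matrix3 w 0 0 0 1 0 0 0 (inverse w)"
    by (simp add: alpha_def star_def mat3_eq_iff)
  then show ?thesis
    using K1 by (simp add: matrix_inv_G[OF a] beta_def mat3_eq_iff mat3_mult)
qed

lemma s_K [simp]: "s \<in> K"
  using c_cases by (auto simp: K_iff_P s_matrix G_iff star_def mat3_eq_iff mat3_mult P_iff val_inverse)

lemma s_s: "s ** s = mat 1"
  using c_cases by (auto simp: s_matrix mat3_eq_iff mat3_mult)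

lemma s_cancel [simp]: "s ** (s ** g) = g"
  by (simp add: matrix_mul_assoc s_s)

lemma star_s [simp]: "star s = s"
  by (simp add: s_matrix star_def mat3_eq_iff)

lemma s_conj:
  "(s ** g ** s)$1$1 = g$3$3" "(s ** g ** s)$1$2 = w powi (- c) * g$3$2" "(s ** g ** s)$1$3 = w powi (- 2 * c) * g$3$1"
  "(s ** g ** s)$2$1 = w powi c * g$2$3" "(s ** g ** s)$2$2 = g$2$2" "(s ** g ** s)$2$3 = w powi (- c) * g$2$1"
  "(s ** g ** s)$3$1 = w powi (2 * c) * g$1$3" "(s ** g ** s)$3$2 = w powi c * g$1$2" "(s ** g ** s)$3$3 = g$1$1"
  using c_cases by (auto simp: s_matrix mat3_mult power_int_minus power2_eq_square)

lemma P_powi_mult: "w powi n * x \<in> P m \<longleftrightarrow> x \<in> P (m - n)"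
  by (cases "x = 0") (auto simp: P_iff val_mult val_power_int)

lemma P_unif_mult: "w * x \<in> P m \<longleftrightarrow> x \<in> P (m - 1)" "inverse w * x \<in> P m \<longleftrightarrow> x \<in> P (m + 1)"
  using P_powi_mult[of 1 x m] P_powi_mult[of "-1" x m] by simp_all

lemma I1'_iff: "g \<in> I1' \<longleftrightarrow> g \<in> K \<and> g$1$2 \<in> P (1 - c) \<and> g$1$3 \<in> P (1 - c) \<and> g$2$3 \<in> P (1 - c) \<and>
    g$1$1 - 1 \<in> P 1 \<and> g$2$2 - 1 \<in> P 1 \<and> g$3$3 - 1 \<in> P 1"
proof -
  have k: "g \<in> K \<Longrightarrow> g$1$2 \<in> P 0 \<and> g$2$3 \<in> P 0"
    by (simp add: K_iff_P)
  show ?thesis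
  proof (cases \<kappa>)
    case K0
    then show ?thesis
      by (simp add: pro_p_iwahori'_def iwahori'_def Let_def forall_3 del: max_compact.simps)
  next
    case K1
    then show ?thesis
      using k by (simp add: pro_p_iwahori'_def iwahori'_def Let_def forall_3 divide_unif_P del: max_compact.simps) blast
  qed
qed

lemma s_conj_I1': "g \<in> I1 \<Longrightarrow> s ** g ** s \<in> I1'"
proof -
  assume g: "g \<in> I1"
  then have "g \<in> K" "g \<in> Gs 3 (1 + c) 1"
    by (simp_all add: I1_Gs[symmetric])
  then show ?thesis
    by (rule_tac disjE[OF c_cases]) (simp_all add: I1'_iff Gs_def Sh_iff Q_P s_conj P_powi_mult P_unif_mult)
qed

lemma s_conj_I1: "g \<in> I1' \<Longrightarrow> s ** g ** s \<in> I1"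
proof -
  have "1 + c - 2 * c = 1 - c"
    by simp
  then show "g \<in> I1' \<Longrightarrow> s ** g ** s \<in> I1"
    by (auto simp: I1'_iff I1_iff I_iff_31 s_conj P_powi_mult)
qed

end

subsection \<open>Decompositions\<close>

context unitary_compact
begin

definition nup :: "'e \<Rightarrow> 'e \<Rightarrow> 'e mat3" where
  "nup x y = matrix3 1 (- cj x) y
                     0 1 x
                     0 0 1"

definition nlo :: "'e \<Rightarrow> 'e \<Rightarrow> 'e mat3" where
  "nlo x y = matrix3 1 0 0
                     x 1 0
                     y (- cj x) 1"

text \<open>Isotropy of the vector \<open>(1, x, y)\<close>, or equally of \<open>(y, x, 1)\<close>;
  this is what puts \<open>nlo x y\<close> and \<open>nup x y\<close> into the group.\<close>

definition iso :: "'e \<Rightarrow> 'e \<Rightarrow> bool" where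
  "iso x y \<longleftrightarrow> y + cj y + x * cj x = 0"

definition al :: "int \<Rightarrow> 'e mat3" where
  "al n = matrix3 (w powi (- n)) 0 0
                  0 1 0
                  0 0 (w powi n)"

definition dg :: "'e \<Rightarrow> 'e \<Rightarrow> 'e mat3" where
  "dg a b = matrix3 a 0 0
                    0 b 0
                    0 0 (inverse (cj a))"

definition Tor :: "'e mat3 set" where
  "Tor = {dg a b | a b. a \<noteq> 0 \<and> v a = 0 \<and> b * cj b = 1}"

lemma nup_entries [simp]:
  "nup x y$1$1 = 1" "nup x y$1$2 = - cj x" "nup x y$1$3 = y" "nup x y$2$1 = 0" "nup x y$2$2 = 1"
  "nup x y$2$3 = x" "nup x y$3$1 = 0" "nup x y$3$2 = 0" "nup x y$3$3 = 1"
  by (auto simp: nup_def)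

lemma nlo_entries [simp]:
  "nlo x y$1$1 = 1" "nlo x y$1$2 = 0" "nlo x y$1$3 = 0" "nlo x y$2$1 = x" "nlo x y$2$2 = 1"
  "nlo x y$2$3 = 0" "nlo x y$3$1 = y" "nlo x y$3$2 = - cj x" "nlo x y$3$3 = 1"
  by (auto simp: nlo_def)

lemma al_entries [simp]:
  "al n$1$1 = w powi (- n)" "al n$1$2 = 0" "al n$1$3 = 0" "al n$2$1 = 0" "al n$2$2 = 1"
  "al n$2$3 = 0" "al n$3$1 = 0" "al n$3$2 = 0" "al n$3$3 = w powi n"
  by (auto simp: al_def)

lemma dg_entries [simp]:
  "dg a b$1$1 = a" "dg a b$1$2 = 0" "dg a b$1$3 = 0" "dg a b$2$1 = 0" "dg a b$2$2 = b"
  "dg a b$2$3 = 0" "dg a b$3$1 = 0" "dg a b$3$2 = 0" "dg a b$3$3 = inverse (cj a)"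
  by (auto simp: dg_def)

lemma nup_G: "iso x y \<Longrightarrow> nup x y \<in> G"
  by (simp add: G_iff iso_def mat3_eq_iff mat3_mult star_def algebra_simps)

lemma nlo_G: "iso x y \<Longrightarrow> nlo x y \<in> G"
  by (simp add: G_iff iso_def mat3_eq_iff mat3_mult star_def algebra_simps)

lemma al_G [simp]: "al n \<in> G"
  by (simp add: G_iff mat3_eq_iff mat3_mult star_def power_int_minus)

lemma al_add: "al m ** al n = al (m + n)"
  by (simp add: mat3_eq_iff mat3_mult power_int_add[symmetric])

lemma al_0 [simp]: "al 0 = mat 1"
  by (simp add: mat3_eq_iff)

lemma star_al [simp]: "star (al n) = al (- n)"
  by (simp add: mat3_eq_iff star_def)

lemma alpha_al: "alpha D = al 1"
  by (simp add: alpha_def mat3_eq_iff)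

lemma alpha_pow: "alpha D [^]\<^bsub>U21 D\<^esub> (n :: int) = al n"
proof -
  have nat: "alpha D [^]\<^bsub>U21 D\<^esub> (m :: nat) = al (int m)" for m
  proof (induction m)
    case (Suc m)
    then show ?case
      by (simp add: alpha_al al_add add.commute)
  qed simp
  show ?thesis
    unfolding int_pow_def2 by (auto simp: nat)
qed

lemma s_al_s: "s ** al n ** s = al (- n)"
  by (simp add: mat3_eq_iff s_conj)

lemma s_al: "s ** al n = al (- n) ** s"
  by (metis s_al_s matrix_mul_assoc matrix_mul_rid s_s)

lemma dg_G: "a \<noteq> 0 \<Longrightarrow> b * cj b = 1 \<Longrightarrow> dg a b \<in> G"
  by (simp add: G_iff mat3_eq_iff mat3_mult star_def mult.commute)

lemma TorI: "a \<noteq> 0 \<Longrightarrow> v a = 0 \<Longrightarrow> b * cj b = 1 \<Longrightarrow> dg a b \<in> Tor"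
  by (auto simp: Tor_def)

lemma Tor_I [simp]: "t \<in> Tor \<Longrightarrow> t \<in> I"
proof -
  assume "t \<in> Tor"
  then obtain a b where t: "t = dg a b" "a \<noteq> 0" "v a = 0" "b * cj b = 1"
    by (auto simp: Tor_def)
  moreover have "b \<in> P 0"
    by (rule P_norm[of b 0]) (use t in auto)
  ultimately show "t \<in> I"
    by (simp add: I_iff_31 K_iff_P dg_G P_iff val_inverse)
qed

lemma Tor_commute: "t \<in> Tor \<Longrightarrow> t' \<in> Tor \<Longrightarrow> t ** t' = t' ** t"
  by (auto simp: Tor_def mat3_eq_iff mat3_mult mult.commute)

lemma Tor_al: "t \<in> Tor \<Longrightarrow> t ** al n = al n ** t"
  by (auto simp: Tor_def mat3_eq_iff mat3_mult mult.commute)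

lemma Tor_s: "t \<in> Tor \<Longrightarrow> s ** t ** s \<in> Tor"
proof -
  assume "t \<in> Tor"
  then obtain a b where t: "t = dg a b" "a \<noteq> 0" "v a = 0" "b * cj b = 1"
    by (auto simp: Tor_def)
  have "s ** t ** s = dg (inverse (cj a)) b"
    by (simp add: t mat3_eq_iff s_conj)
  then show ?thesis
    using t by (auto simp: val_inverse intro!: TorI)
qed

lemma Tor_star: "t \<in> Tor \<Longrightarrow> star t \<in> Tor"
proof -
  assume "t \<in> Tor"
  then obtain a b where t: "t = dg a b" "a \<noteq> 0" "v a = 0" "b * cj b = 1"
    by (auto simp: Tor_def)
  have "star t = dg (inverse a) (cj b)"
    by (simp add: t mat3_eq_iff star_def)
  then show ?thesis
    using t by (auto simp: val_inverse mult.commute intro!: TorI)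
qed

lemma iso_middle: "iso x y \<Longrightarrow> y \<in> P n \<Longrightarrow> 2 * k - 1 \<le> n \<Longrightarrow> x \<in> P k"
  using isotropic_middle[of y 1 x n 0 k] by (simp add: iso_def)

lemma nup_I1: "iso x y \<Longrightarrow> y \<in> P (- c) \<Longrightarrow> nup x y \<in> I1"
  using iso_middle[of x y "- c" 0] c_bounds by (simp add: I1_iff I_iff_31 K_iff_P nup_G)

lemma nlo_K: "iso x y \<Longrightarrow> y \<in> P c \<Longrightarrow> nlo x y \<in> K"
  using iso_middle[of x y c c] c_bounds by (simp add: K_iff_P nlo_G)

lemma nlo_I1: "iso x y \<Longrightarrow> y \<in> P (1 + c) \<Longrightarrow> nlo x y \<in> I1"
  using nlo_K[of x y] P_mono[of c "1 + c" y] by (simp add: I1_iff I_iff_31)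

lemma iso_divide:
  assumes "x * cj z + z * cj x + y * cj y = 0" "z \<noteq> 0"
  shows "iso (y / z) (x / z)"
proof -
  have "x / z + cj x / cj z + (y * cj y) / (z * cj z) = (x * cj z + z * cj x + y * cj y) / (z * cj z)"
    using assms(2) by (simp add: add_divide_distrib)
  then show ?thesis
    using assms(1) by (simp add: iso_def)
qed

lemma nlo_clears_column:
  assumes "iso x y" "g$2$1 = x * g$1$1" "g$3$1 = y * g$1$1"
  shows "(star (nlo x y) ** g)$1$1 = g$1$1" "(star (nlo x y) ** g)$2$1 = 0" "(star (nlo x y) ** g)$3$1 = 0"
proof -
  have "(star (nlo x y) ** g)$3$1 = (y + cj y + x * cj x) * g$1$1"
    using assms by (simp add: mat3_mult star_def algebra_simps)
  then show "(star (nlo x y) ** g)$3$1 = 0"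
    using assms(1) by (simp add: iso_def)
qed (use assms in \<open>simp_all add: mat3_mult star_def\<close>)

lemma nup_clears_column:
  assumes "iso x y" "g$2$1 = x * g$3$1" "g$1$1 = y * g$3$1"
  shows "(star (nup x y) ** g)$3$1 = g$3$1" "(star (nup x y) ** g)$2$1 = 0" "(star (nup x y) ** g)$1$1 = 0"
proof -
  have "(star (nup x y) ** g)$1$1 = (y + cj y + x * cj x) * g$3$1"
    using assms by (simp add: mat3_mult star_def algebra_simps)
  then show "(star (nup x y) ** g)$1$1 = 0"
    using assms(1) by (simp add: iso_def)
qed (use assms in \<open>simp_all add: mat3_mult star_def\<close>)

lemma star_mult_entries:
  assumes "g \<in> G"
  shows "cj (g$1$1) * g$3$2 + cj (g$2$1) * g$2$2 + cj (g$3$1) * g$1$2 = 0"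
    "cj (g$1$1) * g$3$3 + cj (g$2$1) * g$2$3 + cj (g$3$1) * g$1$3 = 1"
    "cj (g$3$2) * g$1$2 + cj (g$2$2) * g$2$2 + cj (g$1$2) * g$3$2 = 1"
    "cj (g$3$3) * g$1$2 + cj (g$2$3) * g$2$2 + cj (g$1$3) * g$3$2 = 0"
    "cj (g$3$3) * g$1$3 + cj (g$2$3) * g$2$3 + cj (g$1$3) * g$3$3 = 0"
    "cj (g$3$3) * g$1$1 + cj (g$2$3) * g$2$1 + cj (g$1$3) * g$3$1 = 1"
  using star_mult_left[OF assms] by (simp_all add: mat3_eq_iff mat3_mult star_def add.commute add.left_commute)

text \<open>An isometry that preserves the isotropic line of the first basis vector also preserves
  its orthogonal complement, hence is upper triangular. Dividing by the diagonal part leaves a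
  unipotent matrix.\<close>

lemma upper_triangular:
  assumes g: "g \<in> G" "g$2$1 = 0" "g$3$1 = 0"
  obtains x y where "g$1$1 \<noteq> 0" "g$2$2 * cj (g$2$2) = 1" "iso x y" "g = dg (g$1$1) (g$2$2) ** nup x y"
proof -
  have a: "g$1$1 \<noteq> 0"
    using star_mult_entries(2)[OF g(1)] g by auto
  then have g32: "g$3$2 = 0"
    using star_mult_entries(1)[OF g(1)] g by auto
  have b: "g$2$2 * cj (g$2$2) = 1"
    using star_mult_entries(3)[OF g(1)] g32 by (simp add: mult.commute)
  define d where "d = dg (g$1$1) (g$2$2)"
  have d: "d \<in> G"
    using a b by (simp add: d_def dg_G)
  define u where "u = star d ** g"
  have u: "u \<in> G"
    using d g by (simp add: u_def)
  have ue: "u$1$1 = 1" "u$2$1 = 0" "u$3$1 = 0" "u$2$2 = 1" "u$3$2 = 0"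
    using g a b g32 by (simp_all add: u_def d_def mat3_mult star_def mult.commute)
  have "u$3$3 = 1"
    using star_mult_entries(2)[OF u] ue by simp
  with star_mult_entries(4,5)[OF u] ue
  have "u$1$2 = - cj (u$2$3)" "iso (u$2$3) (u$1$3)"
    by (simp_all add: eq_neg_iff_add_eq_0 iso_def algebra_simps)
  then have "u = nup (u$2$3) (u$1$3)"
    using ue \<open>u$3$3 = 1\<close> by (simp add: mat3_eq_iff)
  moreover have "g = d ** u"
    using d by (simp add: u_def)
  ultimately show ?thesis
    using that[of "u$2$3" "u$1$3"] a b \<open>iso (u$2$3) (u$1$3)\<close> d_def by simp
qed

lemma unit_iff: "x \<in> P n \<Longrightarrow> x \<notin> P (n + 1) \<Longrightarrow> x \<noteq> 0 \<and> v x = n"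
  by (auto simp: P_iff)

lemma I_units:
  assumes "g \<in> I"
  shows "g$1$1 \<noteq> 0" "v (g$1$1) = 0" "g$3$3 \<noteq> 0" "v (g$3$3) = 0"
proof -
  have g: "g \<in> K" "g \<in> G" "g$3$1 \<in> P (1 + c)"
    using assms by (auto simp: I_iff_31)
  then have p: "g$1$1 \<in> P 0" "g$3$3 \<in> P 0" "g$1$3 \<in> P (- c)" "g$2$3 \<in> P 0"
    by (auto simp: K_iff_P)
  have g21: "g$2$1 \<in> P 1"
    using isotropic_middle[OF col1_isotropic[OF g(2)] p(1) g(3)] c_bounds by simp
  have "cj (g$2$3) * g$2$1 \<in> P (0 + 1)" "cj (g$1$3) * g$3$1 \<in> P (- c + (1 + c))"
    by (rule P_mult; use p g g21 in simp)+
  then have "cj (g$2$3) * g$2$1 + cj (g$1$3) * g$3$1 \<in> P 1"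
    by (simp add: P_add)
  moreover have "1 - cj (g$3$3) * g$1$1 = cj (g$2$3) * g$2$1 + cj (g$1$3) * g$3$1"
    using star_mult_entries(6)[OF g(2)] by algebra
  ultimately have "1 - cj (g$3$3) * g$1$1 \<in> P 1"
    by simp
  then have *: "cj (g$3$3) * g$1$1 \<notin> P 1"
    using P_add[of "1 - cj (g$3$3) * g$1$1" 1 "cj (g$3$3) * g$1$1"] by auto
  have "g$1$1 \<notin> P 1"
    using * P_mult[of "cj (g$3$3)" 0 "g$1$1" 1] p by auto
  moreover have "g$3$3 \<notin> P 1"
    using * P_mult[of "cj (g$3$3)" 1 "g$1$1" 0] p by auto
  ultimately show "g$1$1 \<noteq> 0" "v (g$1$1) = 0" "g$3$3 \<noteq> 0" "v (g$3$3) = 0"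
    using unit_iff[of "g$1$1" 0] unit_iff[of "g$3$3" 0] p by auto
qed

text \<open>Since the entry (1,1) is a unit, a lower unipotent element of \<open>I1\<close> clears
  the first column. What remains is a torus element times an upper unipotent one, and normality of
  \<open>I1\<close> in \<open>I\<close> brings the torus element to the front.\<close>

lemma I_decomposition:
  assumes "g \<in> I"
  obtains t u where "t \<in> Tor" "u \<in> I1" "g = t ** u"
proof -
  have g: "g \<in> G" "g$3$1 \<in> P (1 + c)"
    using assms by (auto simp: I_iff_31)
  note unit = I_units[OF assms]
  define x y where "x = g$2$1 / g$1$1" and "y = g$3$1 / g$1$1"
  have iso: "iso x y"
    using iso_divide[of "g$3$1" "g$1$1" "g$2$1"] col1_isotropic[OF g(1)] unit by (simp add: x_def y_def add.commute)
  have "y \<in> P (1 + c)"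
    using g unit by (cases "g$3$1 = 0") (auto simp: y_def P_iff val_divide)
  then have n: "nlo x y \<in> I1" "nlo x y \<in> G"
    using iso nlo_I1 nlo_G by auto
  define h where "h = star (nlo x y) ** g"
  have "g$2$1 = x * g$1$1" "g$3$1 = y * g$1$1"
    using unit by (auto simp: x_def y_def)
  note h0 = nlo_clears_column[OF iso this, folded h_def]
  have hI: "h \<in> I"
    unfolding h_def using assms n by (intro I_mult I_star) auto
  then have "h \<in> G"
    by simp
  then obtain x' y' where h: "h$1$1 \<noteq> 0" "h$2$2 * cj (h$2$2) = 1" "iso x' y'"
      "h = dg (h$1$1) (h$2$2) ** nup x' y'"
    by (rule upper_triangular[OF _ h0(2,3)])
  define t where "t = dg (h$1$1) (h$2$2)"
  have t: "t \<in> Tor"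
    using h unit h0(1) by (auto simp: t_def intro!: TorI)
  have nup: "nup x' y' = star t ** h"
    using t by (subst h(4)) (simp add: t_def)
  have "nup x' y' \<in> I"
    unfolding nup using t hI by (intro I_mult I_star) auto
  then have n': "nup x' y' \<in> I1"
    by (simp add: I1_iff)
  have "g = nlo x y ** (t ** nup x' y')"
    using n by (simp add: t_def h(4)[symmetric]) (simp add: h_def)
  also have "\<dots> = t ** (star t ** nlo x y ** star (star t) ** nup x' y')"
    using t by (simp add: matrix_mul_assoc star_mult_right)
  finally show ?thesis
    using that[OF t] I1_mult[OF I1_normal[of "star t" "nlo x y"] n'] n t Tor_star by auto
qed

text \<open>Outside of \<open>I\<close> the entry (3,1) has valuation exactly \<open>c\<close>.
  Dividing the first column by it therefore produces an upper unipotent element of \<open>I1\<close>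
  that clears the two entries above.\<close>

lemma Bruhat:
  assumes "k \<in> K" "k \<notin> I"
  obtains u i where "u \<in> I1" "i \<in> I" "k = u ** s ** i"
proof -
  have k: "k \<in> G" "k$1$1 \<in> P 0" "k$3$1 \<in> P c" "k$3$1 \<notin> P (1 + c)"
    using assms by (auto simp: I_iff_31 K_iff_P)
  then have unit: "k$3$1 \<noteq> 0" "v (k$3$1) = c"
    using unit_iff[of "k$3$1" c] by (auto simp: add.commute)
  define x y where "x = k$2$1 / k$3$1" and "y = k$1$1 / k$3$1"
  have iso: "iso x y"
    using iso_divide[OF col1_isotropic[OF k(1)]] unit by (simp add: x_def y_def)
  have "y \<in> P (- c)"
    using k unit by (cases "k$1$1 = 0") (auto simp: y_def P_iff val_divide)
  then have n: "nup x y \<in> I1" "nup x y \<in> G"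
    using iso nup_I1 nup_G by auto
  define h where "h = star (nup x y) ** k"
  have "k$2$1 = x * k$3$1" "k$1$1 = y * k$3$1"
    using unit by (auto simp: x_def y_def)
  note h0 = nup_clears_column[OF iso this, folded h_def]
  have hK: "h \<in> K"
    using n assms by (simp add: h_def)
  have "(s ** h)$3$1 = 0"
    using h0 by (simp add: s_matrix mat3_mult)
  then have "s ** h \<in> I"
    using hK by (simp add: I_iff_31)
  moreover have "k = nup x y ** s ** (s ** h)"
    using n by (simp add: h_def matrix_mul_assoc[symmetric])
  ultimately show ?thesis
    using that n by blast
qed

end

section \<open>Column sizes and the decomposition of \<open>G\<close> into the sets
  \<open>K \<alpha>^n I\<close>\<close>

context unitary_compact
begin

text \<open>\<open>C1 m g\<close> and \<open>C3 m g\<close> say that the first column of \<open>g\<close>, respectively \<open>w\<^sup>c\<close> times the third one,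
  lies in \<open>w\<^sup>m\<close> times the lattice stabilized by \<open>K\<close>.\<close>

definition C1 :: "int \<Rightarrow> 'e mat3 \<Rightarrow> bool" where
  "C1 m g \<longleftrightarrow> g$1$1 \<in> P m \<and> g$2$1 \<in> P m \<and> g$3$1 \<in> P (m + c)"

definition C3 :: "int \<Rightarrow> 'e mat3 \<Rightarrow> bool" where
  "C3 m g \<longleftrightarrow> g$1$3 \<in> P (m - c) \<and> g$2$3 \<in> P (m - c) \<and> g$3$3 \<in> P m"

lemma K_lattice:
  assumes "k \<in> K" "x \<in> P m" "y \<in> P m" "z \<in> P (m + c)"
  shows "k$1$1 * x + k$1$2 * y + k$1$3 * z \<in> P m" "k$2$1 * x + k$2$2 * y + k$2$3 * z \<in> P m"
    "k$3$1 * x + k$3$2 * y + k$3$3 * z \<in> P (m + c)"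
proof -
  have k: "k$1$1 \<in> P 0" "k$1$2 \<in> P 0" "k$1$3 \<in> P (- c)" "k$2$1 \<in> P c" "k$2$2 \<in> P 0" "k$2$3 \<in> P 0"
    "k$3$1 \<in> P c" "k$3$2 \<in> P c" "k$3$3 \<in> P 0"
    using assms(1) by (auto simp: K_iff_P)
  have "k$1$1 * x \<in> P (0 + m)" "k$1$2 * y \<in> P (0 + m)" "k$1$3 * z \<in> P (- c + (m + c))"
    by (intro P_mult k assms)+
  then show "k$1$1 * x + k$1$2 * y + k$1$3 * z \<in> P m"
    by (simp add: P_add)
  have "k$2$1 * x \<in> P (c + m)" "k$2$2 * y \<in> P (0 + m)" "k$2$3 * z \<in> P (0 + (m + c))"
    by (intro P_mult k assms)+
  then show "k$2$1 * x + k$2$2 * y + k$2$3 * z \<in> P m"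
    using c_bounds P_mono[of m "c + m"] P_mono[of m "m + c"] by (simp add: P_add)
  have "k$3$1 * x \<in> P (c + m)" "k$3$2 * y \<in> P (c + m)" "k$3$3 * z \<in> P (0 + (m + c))"
    by (intro P_mult k assms)+
  then show "k$3$1 * x + k$3$2 * y + k$3$3 * z \<in> P (m + c)"
    by (simp add: P_add add.commute)
qed

lemma C1_K: "k \<in> K \<Longrightarrow> C1 m g \<Longrightarrow> C1 m (k ** g)"
  using K_lattice[of k "g$1$1" m "g$2$1" "g$3$1"] by (simp add: C1_def mat3_mult)

lemma C3_K: "k \<in> K \<Longrightarrow> C3 m g \<Longrightarrow> C3 m (k ** g)"
  using K_lattice[of k "g$1$3" "m - c" "g$2$3" "g$3$3"] by (simp add: C3_def mat3_mult)

lemma C1_K_iff: "k \<in> K \<Longrightarrow> C1 m (k ** g) \<longleftrightarrow> C1 m g"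
  using C1_K[of k m g] C1_K[of "star k" m "k ** g"] by auto

lemma C3_K_iff: "k \<in> K \<Longrightarrow> C3 m (k ** g) \<longleftrightarrow> C3 m g"
  using C3_K[of k m g] C3_K[of "star k" m "k ** g"] by auto

lemma C3_mono: "m \<le> n \<Longrightarrow> C3 n g \<Longrightarrow> C3 m g"
  by (auto simp: C3_def P_iff)

lemma C1_s: "C1 m (g ** s) \<longleftrightarrow> C3 m g"
  by (simp add: C1_def C3_def mat3_mult s_matrix P_powi_mult mult.commute[of _ "w powi c"])

lemma C3_s: "C3 m (g ** s) \<longleftrightarrow> C1 m g"
  by (simp add: C1_def C3_def mat3_mult s_matrix P_powi_mult mult.commute[of _ "w powi (- c)"])

lemma powi_P [simp]: "w powi n \<in> P m \<longleftrightarrow> m \<le> n"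
  by (simp add: P_iff val_power_int)

text \<open>The left factor \<open>k\<close> is irrelevant, and the entry (1,1) of
  \<open>al n ** i\<close> is \<open>w powi (- n)\<close> times a unit. For \<open>C3_al_I\<close>
  the entry (3,3) plays this role.\<close>

lemma C1_al_I: "k \<in> K \<Longrightarrow> i \<in> I \<Longrightarrow> C1 m (k ** al n ** i) \<Longrightarrow> m \<le> - n"
  using I_units[of i] by (auto simp: matrix_mul_assoc[symmetric] C1_K_iff)
    (simp add: C1_def mat3_mult P_powi_mult, simp add: P_iff)

lemma C3_al_I: "k \<in> K \<Longrightarrow> i \<in> I \<Longrightarrow> C3 m (k ** al n ** i) \<Longrightarrow> m \<le> n"
  using I_units[of i] by (auto simp: matrix_mul_assoc[symmetric] C3_K_iff)
    (simp add: C3_def mat3_mult P_powi_mult, simp add: P_iff)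

lemma C1_al [simp]: "C1 m (al n) \<longleftrightarrow> m \<le> - n" and C3_al [simp]: "C3 m (al n) \<longleftrightarrow> m \<le> n"
  by (auto simp: C1_def C3_def)

text \<open>Compare the first and third entries of the column relative to the lattice. If the first
  one dominates, \<open>nlo\<close> clears the other two within \<open>K\<close>; otherwise
  \<open>nup\<close> clears the upper two and \<open>s\<close> moves the surviving entry to the
  top.\<close>

lemma Iwasawa_column:
  assumes "g \<in> G"
  obtains k where "k \<in> K" "(k ** g)$2$1 = 0" "(k ** g)$3$1 = 0"
proof (cases "g$1$1 \<noteq> 0 \<and> g$3$1 / g$1$1 \<in> P c")
  case True
  have iso: "iso (g$2$1 / g$1$1) (g$3$1 / g$1$1)"
    using iso_divide[of "g$3$1" "g$1$1" "g$2$1"] col1_isotropic[OF assms] True by (simp add: add.commute)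
  show ?thesis
    by (rule that[of "star (nlo (g$2$1 / g$1$1) (g$3$1 / g$1$1))"])
      (use True nlo_K[OF iso] nlo_clears_column[OF iso, of g] in auto)
next
  case False
  have nz: "g$3$1 \<noteq> 0"
  proof
    assume "g$3$1 = 0"
    with False have "g$1$1 = 0"
      by auto
    then have "g$2$1 = 0"
      using col1_isotropic[OF assms] by auto
    then show False
      using star_mult_entries(6)[OF assms] \<open>g$3$1 = 0\<close> \<open>g$1$1 = 0\<close> by simp
  qed
  have iso: "iso (g$2$1 / g$3$1) (g$1$1 / g$3$1)"
    using iso_divide[OF col1_isotropic[OF assms]] nz by simp
  have y: "g$1$1 / g$3$1 \<in> P (- c)"
    using False nz by (cases "g$1$1 = 0") (auto simp: P_iff val_divide)
  define h where "h = star (nup (g$2$1 / g$3$1) (g$1$1 / g$3$1)) ** g"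
  have h: "h$2$1 = 0" "h$1$1 = 0"
    using nup_clears_column[OF iso, of g] nz by (auto simp: h_def)
  show ?thesis
    by (rule that[of "s ** star (nup (g$2$1 / g$3$1) (g$1$1 / g$3$1))"])
      (use nup_I1[OF iso y] h in \<open>auto simp: h_def[symmetric] matrix_mul_assoc[symmetric]\<close>,
        auto simp: s_matrix mat3_mult)
qed

lemma Iwasawa:
  assumes "g \<in> G"
  obtains k n x y where "k \<in> K" "iso x y" "g = k ** al n ** nup x y"
proof -
  obtain k where k: "k \<in> K" "(k ** g)$2$1 = 0" "(k ** g)$3$1 = 0"
    using assms by (rule Iwasawa_column)
  have "k ** g \<in> G"
    using k assms by simp
  then obtain x y where xy: "(k ** g)$1$1 \<noteq> 0" "(k ** g)$2$2 * cj ((k ** g)$2$2) = 1" "iso x y"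
      "k ** g = dg ((k ** g)$1$1) ((k ** g)$2$2) ** nup x y"
    using k(2,3) by (rule upper_triangular)
  define a b n where "a = (k ** g)$1$1" and "b = (k ** g)$2$2" and "n = - v a"
  define t where "t = dg (a * w powi n) b"
  have t: "t \<in> Tor"
    unfolding t_def by (rule TorI) (use xy in \<open>auto simp: a_def[symmetric] b_def[symmetric] val_mult val_power_int n_def\<close>)
  have d: "dg a b = t ** al n"
    by (simp add: t_def mat3_eq_iff mat3_mult power_int_minus)
  have kg: "k ** g = t ** al n ** nup x y"
    using xy(4) d by (simp add: a_def b_def)
  have "g = star k ** (k ** g)"
    using k by simp
  also have "\<dots> = (star k ** t) ** al n ** nup x y"
    unfolding kg by (simp add: matrix_mul_assoc)
  finally show ?thesis
    using that[of "star k ** t" x y n] k t xy(3) by simp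
qed

lemma C3_nup: "k \<in> K \<Longrightarrow> C3 m (k ** al n ** nup x y) \<Longrightarrow> y \<in> P (m - c + n)"
  by (simp add: matrix_mul_assoc[symmetric] C3_K_iff) (simp add: C3_def mat3_mult P_powi_mult)

lemma C1_nup: "k \<in> K \<Longrightarrow> C1 m (k ** al n ** nup x y) \<longleftrightarrow> m \<le> - n"
  by (simp add: matrix_mul_assoc[symmetric] C1_K_iff) (simp add: C1_def mat3_mult)

text \<open>
  Apply the Iwasawa decomposition to \<open>g\<close> and to \<open>g ** s\<close>: at least one of the unipotent factors is
  integral, since otherwise each of the first and third columns of \<open>g\<close> would be the larger one.
\<close>

lemma G_decomposition:
  assumes "g \<in> G"
  obtains k n i where "k \<in> K" "i \<in> I" "g = k ** al n ** i"
proof -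
  obtain k n x y where 1: "k \<in> K" "iso x y" "g = k ** al n ** nup x y"
    using assms by (rule Iwasawa)
  have "g ** s \<in> G"
    using assms by simp
  then obtain k' m x' y' where 2: "k' \<in> K" "iso x' y'" "g ** s = k' ** al m ** nup x' y'"
    by (rule Iwasawa)
  \<comment> \<open>The bound for \<open>y'\<close> is \<open>1 - c\<close> because conjugation by
    \<open>s\<close> turns \<open>nup x' y'\<close> into a matrix with (3,1) entry
    \<open>w powi (2 * c) * y'\<close>, which has to lie in \<open>P (1 + c)\<close>.\<close>
  consider "y \<in> P (- c)" | "y' \<in> P (1 - c)" | "y \<notin> P (- c)" "y' \<notin> P (1 - c)"
    by blast
  then show ?thesis
  proof cases
    case 1
    then show ?thesis
      using that[of k "nup x y" n] \<open>k \<in> K\<close> \<open>iso x y\<close> \<open>g = _\<close> nup_I1 by auto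
  next
    case y': 2
    have "nup x' y' \<in> K"
      using 2(2) y' P_mono[of "- c" "1 - c" y'] nup_I1[of x' y'] by auto
    then have "s ** nup x' y' ** s \<in> I"
      using y' by (simp add: I_iff_31 s_conj P_powi_mult)
    moreover have "g = (k' ** s) ** al (- m) ** (s ** nup x' y' ** s)"
    proof -
      have "g = (g ** s) ** s"
        by (simp add: matrix_mul_assoc[symmetric] s_s)
      also have "\<dots> = k' ** (s ** (s ** al m)) ** nup x' y' ** s"
        unfolding 2(3) by simp
      also have "\<dots> = (k' ** s) ** al (- m) ** (s ** nup x' y' ** s)"
        unfolding s_al by (simp add: matrix_mul_assoc)
      finally show ?thesis .
    qed
    ultimately show ?thesis
      using that 2(1) by (metis K_mult s_K)
  next
    case 3
    have "\<not> C3 (- n) g"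
      using C3_nup[of k "- n" n x y] 1 3 by auto
    moreover have "C3 (- m) g"
      using C1_nup[of k' "- m" m x' y'] 2 by (simp add: C1_s[symmetric])
    ultimately have "\<not> - n \<le> - m"
      using C3_mono by blast
    then have "C1 (1 - m) g"
      using C1_nup[of k "1 - m" n x y] 1 by simp
    then have "C3 (1 - m) (k' ** al m ** nup x' y')"
      by (simp add: C3_s flip: 2(3))
    then show ?thesis
      using C3_nup[of k' "1 - m" m x' y'] 2 3 by simp
  qed
qed

subsection \<open>Neighbours\<close>

abbreviation KaK where "KaK \<equiv> double_coset D \<kappa> 1 K"

lemma KaK_iff: "g \<in> KaK \<longleftrightarrow> (\<exists>k\<in>K. \<exists>k'\<in>K. g = k ** al 1 ** k')"
  by (auto simp: double_coset_def alpha_pow)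

lemma KaK_G: "g \<in> KaK \<Longrightarrow> g \<in> G"
  by (auto simp: KaK_iff)

lemma KaK_star: "g \<in> KaK \<Longrightarrow> star g \<in> KaK"
proof -
  assume "g \<in> KaK"
  then obtain k k' where k: "k \<in> K" "k' \<in> K" "g = k ** al 1 ** k'"
    by (auto simp: KaK_iff)
  have "star g = star k' ** al (- 1) ** star k"
    by (simp add: k star_mult matrix_mul_assoc)
  also have "\<dots> = (star k' ** s) ** al 1 ** (s ** star k)"
    by (simp add: s_al_s[of 1, symmetric] matrix_mul_assoc)
  finally show ?thesis
    using k unfolding KaK_iff by (metis K_mult K_star s_K)
qed

lemma KaK_neighbour:
  assumes "g \<in> G" "y \<in> G" "g ** star y \<in> KaK"
  obtains k k' where "k \<in> K" "k' \<in> K" "y = k ** al 1 ** k' ** g"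
proof -
  have "star (g ** star y) \<in> KaK"
    using assms by (intro KaK_star)
  then obtain k k' where k: "k \<in> K" "k' \<in> K" "y ** star g = k ** al 1 ** k'"
    by (auto simp: KaK_iff star_mult)
  then have "y = k ** al 1 ** k' ** g"
    using assms by (metis cancel_right(2))
  with k that show ?thesis
    by blast
qed

text \<open>\<open>al 1\<close> divides the first coordinate by \<open>w\<close> and does not
  enlarge the others, and factors from \<open>K\<close> cost nothing; so one step costs at most one
  power of \<open>w\<close>.\<close>

lemma C1_neighbour:
  assumes "y \<in> G" "g \<in> G" "g ** star y \<in> KaK" "C1 m y"
  shows "C1 (m - 1) g"
proof -
  obtain k k' where k: "k \<in> K" "k' \<in> K" "g ** star y = k ** al 1 ** k'"
    using assms by (auto simp: KaK_iff)
  have g: "g = k ** (al 1 ** (k' ** y))"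
    using arg_cong[OF k(3), of "\<lambda>x. x ** y"] assms by (simp add: matrix_mul_assoc)
  have "C1 m (k' ** y)"
    using assms k by (simp add: C1_K_iff)
  then have "C1 (m - 1) (al 1 ** (k' ** y))"
    by (auto simp: C1_def mat3_mult[of "al 1"] P_unif_mult power_int_minus elim!: P_mono[rotated])
  then show ?thesis
    using k by (simp add: g C1_K)
qed

lemma C3_neighbour:
  assumes "y \<in> G" "g \<in> G" "g ** star y \<in> KaK" "C3 m y"
  shows "C3 (m - 1) g"
proof -
  obtain k k' where k: "k \<in> K" "k' \<in> K" "g ** star y = k ** al 1 ** k'"
    using assms by (auto simp: KaK_iff)
  have g: "g = k ** (al 1 ** (k' ** y))"
    using arg_cong[OF k(3), of "\<lambda>x. x ** y"] assms by (simp add: matrix_mul_assoc)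
  have "C3 m (k' ** y)"
    using assms k by (simp add: C3_K_iff)
  then have "C3 (m - 1) (al 1 ** (k' ** y))"
    by (auto simp: C3_def mat3_mult[of "al 1"] P_unif_mult power_int_minus algebra_simps elim!: P_mono[rotated])
  then show ?thesis
    using k by (simp add: g C3_K)
qed

text \<open>Conjugation by \<open>al 1\<close> multiplies the entry (1,3) by
  \<open>w powi (- 2)\<close> and the entries (1,2) and (2,3) by \<open>w powi (- 1)\<close>.
  Isotropy of the first row and of the third column derives the divisibility of the latter two from
  that of (1,3).\<close>

lemma al_K_al_inverse:
  assumes k: "k \<in> K" and k13: "k$1$3 \<in> P (2 - c)"
  shows "al 1 ** k ** al (- 1) \<in> K"
proof -
  have p: "k \<in> G" "k$1$1 \<in> P 0" "k$3$3 \<in> P 0" "k$2$1 \<in> P c" "k$3$1 \<in> P c" "k$3$2 \<in> P c" "k$2$2 \<in> P 0"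
    using k by (auto simp: K_iff_P)
  have "k$1$2 \<in> P 1"
    using isotropic_middle[OF row1_isotropic[OF p(1)] p(2) k13] c_bounds by simp
  moreover have "k$2$3 \<in> P 1"
    using isotropic_middle[OF col3_isotropic[OF p(1)] k13 p(3)] c_bounds by simp
  moreover have "w * k$2$1 \<in> P c" "w * k$3$2 \<in> P c" "w * (w * k$3$1) \<in> P c"
    using p P_mono[of "c - 1" c] P_mono[of "c - 2" c] by (auto simp: P_unif_mult)
  ultimately show ?thesis
    using p k13 c_bounds
    by (simp add: K_iff_P mat3_mult power_int_minus P_unif_mult mult.assoc mult.commute[of _ "inverse w"] mult.commute[of _ w])
qed

text \<open>Replacing \<open>k\<close> by \<open>k ** s\<close> exchanges the first and third
  columns up to powers of \<open>w\<close>, and \<open>s\<close> inverts \<open>al\<close>; this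
  reduces the claim to \<open>al_K_al_inverse\<close>.\<close>

lemma al_K_al:
  assumes k: "k \<in> K" and k11: "k$1$1 \<in> P 2"
  shows "al 1 ** k ** al 1 \<in> K"
proof -
  have "(k ** s)$1$3 = w powi (- c) * k$1$1"
    by (simp add: mat3_mult s_matrix)
  then have "(k ** s)$1$3 \<in> P (2 - c)"
    using k11 by (simp only: P_powi_mult) simp
  then have "al 1 ** (k ** s) ** al (- 1) \<in> K"
    using k by (intro al_K_al_inverse) simp_all
  moreover have "al 1 ** (k ** s) ** al (- 1) = (al 1 ** k ** al 1) ** s"
    using s_al[of "- 1"] s_al[of 1] by (simp add: matrix_mul_assoc[symmetric])
  ultimately show ?thesis
    using K_cancel_right[of s "al 1 ** k ** al 1"] k by simp
qed

text \<open>Uniqueness of the path: among the neighbours of the coset of \<open>al (- m)\<close>,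
  only one has a first column that is smaller by the full factor \<open>w\<close>.\<close>

lemma neighbour_up_C1:
  assumes y: "y \<in> G" "al (- m) ** star y \<in> KaK" "C1 (m + 1) y"
  obtains k where "k \<in> K" "y = k ** al (- m - 1)"
proof -
  obtain k k' where k: "k \<in> K" "k' \<in> K" "y = k ** al 1 ** k' ** al (- m)"
    using KaK_neighbour[OF al_G y(1,2)] by blast
  then have "C1 (m + 1) (al 1 ** (k' ** al (- m)))"
    using y by (simp add: matrix_mul_assoc[symmetric] C1_K_iff)
  then have "k'$1$1 \<in> P 2"
    by (simp add: C1_def mat3_mult[of "al 1"] mat3_mult[of k'] P_unif_mult power_int_minus P_powi_mult
        mult.commute[of _ "w powi m"])
  then have K: "al 1 ** k' ** al 1 \<in> K"
    using k by (intro al_K_al)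
  have "y = (k ** (al 1 ** k' ** al 1)) ** al (- m - 1)"
    using al_add[of 1 "- m - 1"] by (simp add: k matrix_mul_assoc[symmetric])
  moreover have "k ** (al 1 ** k' ** al 1) \<in> K"
    using k K by simp
  ultimately show ?thesis
    using that by blast
qed

text \<open>The analogue for third columns. Translates by \<open>u\<close> are included at
  \<open>m = - 1\<close>, because the support of \<open>f_1\<close> consists of many cosets, all of
  which have to be reached.\<close>

lemma neighbour_up_C3:
  assumes u: "u \<in> I1" "m = - 1 \<or> u = mat 1"
    and y: "y \<in> G" "(al m ** u) ** star y \<in> KaK" "C3 (m + 1) y"
  obtains k where "k \<in> K" "y = k ** al (m + 1) ** u"
proof -
  have uG: "u \<in> G" "u \<in> K"
    using u by simp_all
  obtain k k' where k: "k \<in> K" "k' \<in> K" "y = k ** al 1 ** k' ** (al m ** u)"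
    using KaK_neighbour[of "al m ** u" y] y uG by auto
  then have "C3 (m + 1) (al 1 ** (k' ** (al m ** u)))"
    using y by (simp add: matrix_mul_assoc[symmetric] C3_K_iff)
  then have "(k' ** (al m ** u))$1$3 \<in> P (m + 1 - c + 1)"
    by (simp add: C3_def mat3_mult[of "al 1"] P_unif_mult power_int_minus)
  moreover have "m + 1 - c + 1 = m + 2 - c"
    by simp
  moreover have "(k' ** (al m ** u))$1$3 =
      k'$1$1 * (w powi (- m) * u$1$3) + k'$1$2 * u$2$3 + k'$1$3 * (w powi m * u$3$3)"
    by (simp add: mat3_mult)
  ultimately have main: "k'$1$1 * (w powi (- m) * u$1$3) + k'$1$2 * u$2$3 + k'$1$3 * (w powi m * u$3$3) \<in> P (m + 2 - c)"
    by metis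
  have "k'$1$3 \<in> P (2 - c)"
  proof (cases "u = mat 1")
    case True
    then have "w powi m * k'$1$3 \<in> P (m + 2 - c)"
      using main by (simp add: mult.commute)
    moreover have "m + 2 - c - m = 2 - c"
      by simp
    ultimately show ?thesis
      by (simp only: P_powi_mult)
  next
    case False
    then have m: "m = - 1"
      using u by auto
    have up: "u$1$3 \<in> P (- c)" "u$2$3 \<in> P 0" "u$3$3 \<noteq> 0" "v (u$3$3) = 0"
      using u uG I_units[of u] by (auto simp: K_iff_P)
    have kp: "k' \<in> G" "k'$1$1 \<in> P 0" "k'$1$2 \<in> P 0" "k'$1$3 \<in> P (- c)"
      using k by (auto simp: K_iff_P)
    have e: "w * (k'$1$1 * (w * u$1$3)) + w * (k'$1$2 * u$2$3) + k'$1$3 * u$3$3 \<in> P (2 - c)"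
    proof -
      have "w * (k'$1$1 * (w * u$1$3) + k'$1$2 * u$2$3 + k'$1$3 * (inverse w * u$3$3)) \<in> P (2 - c)"
        using main m by (simp add: P_unif_mult(1) power_int_minus)
      moreover have "w * (k'$1$1 * (w * u$1$3) + k'$1$2 * u$2$3 + k'$1$3 * (inverse w * u$3$3)) =
          w * (k'$1$1 * (w * u$1$3)) + w * (k'$1$2 * u$2$3) + k'$1$3 * u$3$3"
        by (simp add: field_simps)
      ultimately show ?thesis
        by simp
    qed
    have a: "w * (k'$1$1 * (w * u$1$3)) \<in> P (2 - c)"
    proof -
      have "w * u$1$3 \<in> P (1 - c)"
        using up by (simp add: P_unif_mult)
      from P_mult[OF kp(2) this] show ?thesis
        by (simp add: P_unif_mult)
    qed
    \<comment> \<open>Used twice, as a bootstrap. At first \<open>k'$1$2\<close> is only known to be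
      integral, which yields \<open>k'$1$3 \<in> P (1 - c)\<close>; isotropy of the first row then
      improves \<open>k'$1$2\<close>, and the second use gives \<open>P (2 - c)\<close>.\<close>
    have fin: "k'$1$3 \<in> P n" if "w * (k'$1$2 * u$2$3) \<in> P n" "n \<le> 2 - c" for n
    proof -
      have "k'$1$3 * u$3$3 \<in> P n"
        using P_diff[OF P_diff[OF P_mono[OF that(2) e] P_mono[OF that(2) a]] that(1)] by simp
      then show ?thesis
        using up by (cases "k'$1$3 = 0") (auto simp: P_iff val_mult)
    qed
    have "k'$1$2 * u$2$3 \<in> P 0"
      using P_mult[OF kp(3) up(2)] by simp
    then have "k'$1$3 \<in> P (1 - c)"
      using c_bounds P_mono[of "- c" 0] by (intro fin) (auto simp: P_unif_mult)
    then have "k'$1$2 \<in> P (1 - c)"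
      using isotropic_middle[OF row1_isotropic[OF kp(1)] kp(2), of "1 - c" "1 - c"] c_bounds by simp
    then have "k'$1$2 * u$2$3 \<in> P (1 - c)"
      using P_mult[OF _ up(2)] by fastforce
    then show ?thesis
      by (intro fin) (auto simp: P_unif_mult)
  qed
  then have K: "al 1 ** k' ** al (- 1) \<in> K"
    using k by (intro al_K_al_inverse)
  have "y = (k ** (al 1 ** k' ** al (- 1))) ** al (m + 1) ** u"
  proof -
    have "al (- 1) ** (al (m + 1) ** u) = al m ** u"
      using al_add[of "- 1" "m + 1"] by (simp add: matrix_mul_assoc)
    then show ?thesis
      by (simp add: k matrix_mul_assoc[symmetric])
  qed
  moreover have "k ** (al 1 ** k' ** al (- 1)) \<in> K"
    using k K by simp
  ultimately show ?thesis
    using that by blast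
qed

lemma al_conj:
  "(al (- 1) ** k ** al 1)$1$1 = k$1$1" "(al (- 1) ** k ** al 1)$2$2 = k$2$2" "(al (- 1) ** k ** al 1)$3$3 = k$3$3"
  "(al (- 1) ** k ** al 1)$1$2 = w * k$1$2" "(al (- 1) ** k ** al 1)$2$3 = w * k$2$3"
  "(al (- 1) ** k ** al 1)$1$3 = w * (w * k$1$3)" "(al (- 1) ** k ** al 1)$3$1 = inverse w * (inverse w * k$3$1)"
  by (simp_all add: mat3_mult power_int_minus mult.commute mult.left_commute)

text \<open>Since conjugation by \<open>al (- 1)\<close> divides the entry (3,1) by the square of
  \<open>w\<close>, integrality of the result forces \<open>k\<close> into \<open>I\<close>. It
  commutes with the torus and multiplies the entries above the diagonal by positive powers of
  \<open>w\<close>, so it carries the factor from \<open>I1\<close> into \<open>I1'\<close>.\<close>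

lemma al_intertwining:
  assumes k: "k \<in> K" and k': "al (- 1) ** k ** al 1 \<in> K"
  obtains t u u' where "t \<in> Tor" "u \<in> I1" "u' \<in> I1'" "k = t ** u" "al (- 1) ** k ** al 1 = t ** u'"
proof -
  have "(al (- 1) ** k ** al 1)$3$1 \<in> P c"
    using k' by (simp add: K_iff_P)
  then have "k$3$1 \<in> P (c + 1 + 1)"
    by (simp only: al_conj P_unif_mult)
  then have "k$3$1 \<in> P (1 + c)"
    by (rule P_mono[rotated]) simp
  then have "k \<in> I"
    using k by (simp add: I_iff_31)
  then obtain t u where tu: "t \<in> Tor" "u \<in> I1" "k = t ** u"
    by (rule I_decomposition)
  define u' where "u' = al (- 1) ** u ** al 1"
  have e: "al (- 1) ** k ** al 1 = t ** u'"
    using Tor_al[OF tu(1), of "- 1"] by (simp add: tu u'_def matrix_mul_assoc)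
  then have "u' \<in> K"
    using K_cancel_left[of t u'] k' tu by (simp add: u'_def)
  moreover have "u \<in> K" "u \<in> I1"
    using tu by simp_all
  then have "u$1$2 \<in> P (- c)" "u$1$3 \<in> P (- c)" "u$2$3 \<in> P (- c)"
    using c_bounds P_mono[of "- c" 0] by (auto simp: K_iff_P)
  then have "u'$1$2 \<in> P (1 - c)" "u'$1$3 \<in> P (1 - c)" "u'$2$3 \<in> P (1 - c)"
    "u'$1$1 = u$1$1" "u'$2$2 = u$2$2" "u'$3$3 = u$3$3"
    using P_mono[of "- c - 1" "- c" "u$1$3"] by (simp_all add: u'_def al_conj P_unif_mult)
  ultimately have "u' \<in> I1'"
    using tu(2) by (simp add: I1'_iff I1_iff)
  with tu e that show ?thesis
    by blast
qed

end

section \<open>Topology\<close>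

context unramified
begin

lemma Sh_1_0_iff: "x \<in> Sh 1 0 n \<longleftrightarrow> (\<forall>i j. x$i$j \<in> P n)"
  by (simp add: Sh_def Q_def P_iff)

lemma openin_mat: "openin (mat_topology D) U \<longleftrightarrow> (\<forall>A\<in>U. \<exists>n. \<forall>B. B - A \<in> Sh 1 0 n \<longrightarrow> B \<in> U)"
  by (simp add: openin_mat_topology Sh_1_0_iff)

lemma openin_ball: "openin (mat_topology D) {B. B - A \<in> Sh 1 0 n}"
  unfolding openin_mat
proof
  fix B assume B: "B \<in> {B. B - A \<in> Sh 1 0 n}"
  have "C - A \<in> Sh 1 0 n" if "C - B \<in> Sh 1 0 n" for C
    using Sh_add[OF _ that, of "B - A"] B by simp
  then show "\<exists>n'. \<forall>C. C - B \<in> Sh 1 0 n' \<longrightarrow> C \<in> {B. B - A \<in> Sh 1 0 n}"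
    by blast
qed

lemma Sh_bounded: "\<exists>N. x \<in> Sh 1 0 N"
proof (intro exI)
  let ?A = "range (\<lambda>(i, j). v (x$i$j))"
  show "x \<in> Sh 1 0 (Min ?A)"
    unfolding Sh_1_0_iff P_iff
  proof (intro allI disjI2 Min_le)
    show "v (x$i$j) \<in> ?A" for i j
      by (rule image_eqI[of _ _ "(i, j)"]) auto
  qed simp
qed

lemma Sh_zero: "(\<And>n. 0 \<le> n \<Longrightarrow> x \<in> Sh 1 0 n) \<Longrightarrow> x = 0"
proof -
  assume x: "\<And>n. 0 \<le> n \<Longrightarrow> x \<in> Sh 1 0 n"
  have "x$i$j = 0" for i j
  proof -
    have "x$i$j \<in> P (max 0 (v (x$i$j) + 1))"
      using x[of "max 0 (v (x$i$j) + 1)"] unfolding Sh_1_0_iff by simp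
    then show ?thesis
      by (auto simp: P_iff)
  qed
  then show "x = 0"
    by (simp add: vec_eq_iff)
qed

lemma idx_bounds: "\<bar>idx j - idx i\<bar> \<le> 2"
  using exhaust_3[of i] exhaust_3[of j] by auto

lemma idx_mult_bound: "0 \<le> b \<Longrightarrow> \<bar>b * (idx j - idx i)\<bar> \<le> 2 * b"
proof -
  assume "0 \<le> b"
  then have "b * \<bar>idx j - idx i\<bar> \<le> b * 2"
    using idx_bounds by (rule_tac mult_left_mono) auto
  with \<open>0 \<le> b\<close> show ?thesis
    by (simp add: abs_mult)
qed

text \<open>Together with \<open>Sh_subset_1_0\<close>: every filtration \<open>Sh a b\<close> is
  cofinal with entrywise congruence \<open>Sh 1 0\<close>, as \<open>b * (j - i)\<close> is bounded
  by \<open>2 * b\<close>. The condition \<open>0 \<le> n\<close> allows passing from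
  \<open>v\<close> to \<open>a * v\<close>.\<close>

lemma Sh_1_0_subset:
  assumes "1 \<le> a" "0 \<le> b" "m + 2 * b \<le> n" "0 \<le> n" "x \<in> Sh 1 0 n"
  shows "x \<in> Sh a b m"
proof -
  have "x$i$j = 0 \<or> m - b * (idx j - idx i) \<le> a * v (x$i$j)" for i j
  proof (rule disj_imp[THEN iffD2], rule impI)
    assume "x$i$j \<noteq> 0"
    then have "n \<le> v (x$i$j)"
      using assms by (auto simp: Sh_1_0_iff P_iff)
    moreover have "1 * v (x$i$j) \<le> a * v (x$i$j)"
      using assms \<open>n \<le> v (x$i$j)\<close> by (intro mult_right_mono) auto
    ultimately show "m - b * (idx j - idx i) \<le> a * v (x$i$j)"
      using assms idx_mult_bound[of b j i] by linarith
  qed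
  then show ?thesis
    by (simp add: Sh_def Q_def)
qed

lemma Sh_subset_1_0:
  assumes "1 \<le> a" "0 \<le> b" "a * n + 2 * b \<le> m" "x \<in> Sh a b m"
  shows "x \<in> Sh 1 0 n"
proof -
  have "x$i$j = 0 \<or> n \<le> v (x$i$j)" for i j
  proof (rule disj_imp[THEN iffD2], rule impI)
    assume "x$i$j \<noteq> 0"
    then have "m - b * (idx j - idx i) \<le> a * v (x$i$j)"
      using assms by (auto simp: Sh_def Q_def)
    then have "a * n \<le> a * v (x$i$j)"
      using assms idx_mult_bound[of b j i] by linarith
    then show "n \<le> v (x$i$j)"
      using assms by simp
  qed
  then show ?thesis
    by (simp add: Sh_1_0_iff P_iff)
qed

lemma matrix_residues: "\<exists>R. finite R \<and> (\<forall>x\<in>Sh 1 0 m. \<exists>r\<in>R. x - r \<in> Sh 1 0 (m + int n))"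
proof -
  obtain R where R: "finite R" "\<forall>x\<in>P m. \<exists>r\<in>R. x - r \<in> P (m + int n)"
    using residues by blast
  then obtain f where f: "\<And>x. x \<in> P m \<Longrightarrow> f x \<in> R \<and> x - f x \<in> P (m + int n)"
    by metis
  define F where "F = (\<lambda>(a, b, c, d, e, g, h, i, j). matrix3 a b c d e g h i j) `
      (R \<times> R \<times> R \<times> R \<times> R \<times> R \<times> R \<times> R \<times> R)"
  have "\<exists>r\<in>F. x - r \<in> Sh 1 0 (m + int n)" if x: "x \<in> Sh 1 0 m" for x
  proof -
    have fx: "f (x$i$j) \<in> R" "x$i$j - f (x$i$j) \<in> P (m + int n)" for i j
      using x f by (auto simp: Sh_1_0_iff)
    define r where "r = matrix3 (f (x$1$1)) (f (x$1$2)) (f (x$1$3)) (f (x$2$1)) (f (x$2$2)) (f (x$2$3))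
        (f (x$3$1)) (f (x$3$2)) (f (x$3$3))"
    have "r \<in> F"
      unfolding F_def r_def
      by (rule image_eqI[of _ _ "(f (x$1$1), f (x$1$2), f (x$1$3), f (x$2$1), f (x$2$2), f (x$2$3),
          f (x$3$1), f (x$3$2), f (x$3$3))"]) (auto simp: fx)
    moreover have "x - r \<in> Sh 1 0 (m + int n)"
      using fx by (simp add: Sh_1_0_iff forall_3 r_def)
    ultimately show ?thesis
      by blast
  qed
  moreover have "finite F"
    using R by (simp add: F_def)
  ultimately show ?thesis
    by blast
qed

lemma matrix_complete:
  assumes "\<And>n. \<exists>N. \<forall>i\<ge>N. \<forall>j\<ge>N. X i - X j \<in> Sh 1 0 n"
  obtains x where "\<And>n. \<exists>N. \<forall>i\<ge>N. X (i::nat) - x \<in> Sh 1 0 n"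
proof -
  have "\<exists>l. \<forall>n. \<exists>N. \<forall>i\<ge>N. X i$a$b - l \<in> P n" for a b
  proof -
    have "\<exists>N. \<forall>i\<ge>N. \<forall>j\<ge>N. X i$a$b - X j$a$b \<in> P n" for n
      using assms[of n] by (auto simp: Sh_1_0_iff) metis
    then show ?thesis
      using complete[of "\<lambda>i. X i$a$b"] by metis
  qed
  then obtain l where l: "\<And>a b n. \<exists>N. \<forall>i\<ge>N. X i$a$b - l a b \<in> P n"
    by metis
  have "\<exists>N. \<forall>i\<ge>N. X i - (\<chi> a b. l a b) \<in> Sh 1 0 n" for n
  proof -
    obtain N where N: "\<And>a b i. i \<ge> N a b \<Longrightarrow> X i$a$b - l a b \<in> P n"
      using l[of _ _ n] by metis
    have "N a b \<le> Max (range (\<lambda>(a, b). N a b))" for a b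
      by (rule Max_ge) (auto intro: image_eqI[of _ _ "(a, b)"])
    then have "\<forall>i\<ge>Max (range (\<lambda>(a, b). N a b)). X i - (\<chi> a b. l a b) \<in> Sh 1 0 n"
      using N by (auto simp: Sh_1_0_iff intro: order_trans)
    then show ?thesis
      by blast
  qed
  then show ?thesis
    using that by blast
qed

text \<open>As for Heine-Borel: a ball without finite subcover contains a smaller such ball, by
  finiteness of the residue rings. Completeness yields a limit of the centres, \<open>closed\<close>
  places it in \<open>S\<close>, and a single open set around it covers a whole ball of the
  sequence.\<close>

lemma compactin_bounded_closed:
  assumes bounded: "S \<subseteq> Sh 1 0 m"
    and closed: "\<And>A. (\<And>n. \<exists>B\<in>S. B - A \<in> Sh 1 0 n) \<Longrightarrow> A \<in> S"
  shows "compactin (mat_topology D) S"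
  unfolding compactin_def
proof (intro conjI allI impI)
  have "openin (mat_topology D) UNIV"
    by (auto simp: openin_mat)
  then show "S \<subseteq> topspace (mat_topology D)"
    using openin_subset by blast
next
  fix \<U> assume \<U>: "Ball \<U> (openin (mat_topology D)) \<and> S \<subseteq> \<Union>\<U>"
  show "\<exists>\<F>. finite \<F> \<and> \<F> \<subseteq> \<U> \<and> S \<subseteq> \<Union>\<F>"
  proof (rule ccontr)
    assume not: "\<not> ?thesis"
    define bad where "bad n A \<longleftrightarrow> \<not> (\<exists>\<F>. finite \<F> \<and> \<F> \<subseteq> \<U> \<and> S \<inter> {B. B - A \<in> Sh 1 0 (m + int n)} \<subseteq> \<Union>\<F>)" for n A
    have bad_0: "bad 0 0"
      using not bounded by (auto simp: bad_def Int_absorb2 subset_iff)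
    have step: "\<exists>A'. bad (Suc n) A' \<and> A' - A \<in> Sh 1 0 (m + int n)" if "bad n A" for n A
    proof (rule ccontr)
      assume no: "\<not> ?thesis"
      obtain R where R: "finite R" "\<And>x. x \<in> Sh 1 0 (m + int n) \<Longrightarrow> \<exists>r\<in>R. x - r \<in> Sh 1 0 (m + int n + int 1)"
        using matrix_residues[of "m + int n" 1] by blast
      define R' where "R' = {r \<in> R. r \<in> Sh 1 0 (m + int n)}"
      have "\<exists>\<F>. finite \<F> \<and> \<F> \<subseteq> \<U> \<and> S \<inter> {B. B - (A + r) \<in> Sh 1 0 (m + int (Suc n))} \<subseteq> \<Union>\<F>" if "r \<in> R'" for r
        using no that by (auto simp: bad_def R'_def dest!: spec[of _ "A + r"])
      then obtain F where F: "\<And>r. r \<in> R' \<Longrightarrow> finite (F r) \<and> F r \<subseteq> \<U> \<and> S \<inter> {B. B - (A + r) \<in> Sh 1 0 (m + int (Suc n))} \<subseteq> \<Union>(F r)"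
        by metis
      have "S \<inter> {B. B - A \<in> Sh 1 0 (m + int n)} \<subseteq> \<Union>(\<Union>r\<in>R'. F r)"
      proof
        fix B assume B: "B \<in> S \<inter> {B. B - A \<in> Sh 1 0 (m + int n)}"
        then obtain r where r: "r \<in> R" "B - A - r \<in> Sh 1 0 (m + int n + int 1)"
          using R by blast
        have "(B - A) - (B - A - r) \<in> Sh 1 0 (m + int n)"
          using B r Sh_mono[of "m + int n" "m + int n + int 1"] by (rule_tac Sh_diff) auto
        then have "r \<in> R'"
          using r by (simp add: R'_def)
        moreover have "B - (A + r) \<in> Sh 1 0 (m + int (Suc n))"
          using r by (simp add: diff_diff_eq ac_simps)
        ultimately show "B \<in> \<Union>(\<Union>r\<in>R'. F r)"
          using F[of r] B by blast
      qed
      moreover have "finite (\<Union>r\<in>R'. F r)" "(\<Union>r\<in>R'. F r) \<subseteq> \<U>"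
        using F R by (auto simp: R'_def)
      ultimately show False
        using \<open>bad n A\<close> unfolding bad_def by blast
    qed
    obtain X where X: "\<And>n. bad n (X n)" "\<And>n. X (Suc n) - X n \<in> Sh 1 0 (m + int n)"
      using dependent_nat_choice[of bad "\<lambda>n A A'. A' - A \<in> Sh 1 0 (m + int n)"] bad_0 step by blast
    have XX: "X (n + k) - X n \<in> Sh 1 0 (m + int n)" for n k
    proof (induction k)
      case (Suc k)
      have "(X (Suc (n + k)) - X (n + k)) + (X (n + k) - X n) \<in> Sh 1 0 (m + int n)"
        using Suc X(2)[of "n + k"] Sh_mono[of "m + int n" "m + int (n + k)"] by (rule_tac Sh_add) auto
      then show ?case
        by simp
    qed (simp add: Sh_0)
    have X': "X i - X n \<in> Sh 1 0 (m + int n)" if "i \<ge> n" for i n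
      using XX[of n "i - n"] that by simp
    define q where "q n = nat (n - m)" for n
    have q: "n \<le> m + int (q n)" for n
      by (simp add: q_def)
    have "\<exists>N. \<forall>i\<ge>N. \<forall>j\<ge>N. X i - X j \<in> Sh 1 0 n" for n
    proof (intro exI allI impI)
      fix i j assume ij: "q n \<le> i" "q n \<le> j"
      have "(X i - X (q n)) - (X j - X (q n)) \<in> Sh 1 0 (m + int (q n))"
        using X' ij by (rule_tac Sh_diff) auto
      then have "X i - X j \<in> Sh 1 0 (m + int (q n))"
        by simp
      then show "X i - X j \<in> Sh 1 0 n"
        by (rule Sh_mono[OF q])
    qed
    then obtain A where A: "\<And>n. \<exists>N. \<forall>i\<ge>N. X i - A \<in> Sh 1 0 n"
      using matrix_complete[of X] by blast
    have XA: "X n - A \<in> Sh 1 0 (m + int n)" for n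
    proof -
      obtain N where N: "\<And>i. i \<ge> N \<Longrightarrow> X i - A \<in> Sh 1 0 (m + int n)"
        using A by blast
      have "(X (max N n) - A) - (X (max N n) - X n) \<in> Sh 1 0 (m + int n)"
        using N X' by (rule_tac Sh_diff) auto
      then show ?thesis
        by simp
    qed
    have "\<exists>B\<in>S. B - A \<in> Sh 1 0 n" for n
    proof -
      have "\<not> S \<inter> {B. B - X (q n) \<in> Sh 1 0 (m + int (q n))} \<subseteq> \<Union>{}"
        using X(1)[of "q n"] unfolding bad_def by blast
      then obtain B where B: "B \<in> S" "B - X (q n) \<in> Sh 1 0 (m + int (q n))"
        by auto
      have "(B - X (q n)) + (X (q n) - A) \<in> Sh 1 0 (m + int (q n))"
        using B XA by (rule_tac Sh_add) auto
      then have "B - A \<in> Sh 1 0 (m + int (q n))"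
        by simp
      then have "B - A \<in> Sh 1 0 n"
        by (rule Sh_mono[OF q])
      with B show ?thesis
        by blast
    qed
    then have "A \<in> S"
      by (rule closed)
    then obtain U where U: "U \<in> \<U>" "A \<in> U"
      using \<U> by blast
    then obtain n where n: "\<And>B. B - A \<in> Sh 1 0 n \<Longrightarrow> B \<in> U"
      using \<U> unfolding openin_mat by metis
    have "S \<inter> {B. B - X (q n) \<in> Sh 1 0 (m + int (q n))} \<subseteq> \<Union>{U}"
    proof
      fix B assume B: "B \<in> S \<inter> {B. B - X (q n) \<in> Sh 1 0 (m + int (q n))}"
      have "(B - X (q n)) + (X (q n) - A) \<in> Sh 1 0 (m + int (q n))"
        using B XA by (rule_tac Sh_add) auto
      then have "B - A \<in> Sh 1 0 (m + int (q n))"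
        by simp
      then have "B - A \<in> Sh 1 0 n"
        by (rule Sh_mono[OF q])
      then show "B \<in> \<Union>{U}"
        using n by simp
    qed
    then show False
      using X(1)[of "q n"] U unfolding bad_def by (metis empty_subsetI finite.simps insert_subset)
  qed
qed

end

section \<open>Compact cosets, open sets and finite index\<close>

context unitary_compact
begin

abbreviation X where "X \<equiv> subtopology (mat_topology D) G"

lemma K_bounded: "k \<in> K \<Longrightarrow> k \<in> Sh 1 0 (- 1)"
  using c_bounds by (intro Sh_subset_1_0[of 2 c "- 1" 0]) (auto simp: K_iff)

lemma K_closed:
  assumes "\<And>n. \<exists>k\<in>K. k - x \<in> Sh 1 0 n"
  shows "x \<in> K"
proof -
  have x: "x \<in> Sh 2 c 0"
  proof -
    obtain k where k: "k \<in> K" "k - x \<in> Sh 1 0 2"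
      using assms by blast
    then have "k - (k - x) \<in> Sh 2 c 0"
      using c_bounds Sh_1_0_subset[of 2 c 0 2 "k - x"] by (intro Sh_diff[of 2 k c 0 "k - x"]) (auto simp: K_iff)
    then show ?thesis
      by simp
  qed
  have x1: "x \<in> Sh 1 0 (- 1)"
    using x c_bounds by (intro Sh_subset_1_0[of 2 c "- 1" 0]) auto
  have "star x ** x - mat 1 \<in> Sh 1 0 n" for n
  proof -
    obtain k where k: "k \<in> K" "k - x \<in> Sh 1 0 (n + 1)"
      using assms by blast
    have "star x ** (k - x) \<in> Sh 1 0 (- 1 + (n + 1))" "star (k - x) ** k \<in> Sh 1 0 (n + 1 + - 1)"
      using k K_bounded x1 by (intro Sh_mult Sh_star; simp)+
    then have "star x ** (k - x) + star (k - x) ** k \<in> Sh 1 0 n"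
      by (rule_tac Sh_add) simp_all
    then have "- (star x ** (k - x) + star (k - x) ** k) \<in> Sh 1 0 n"
      by (simp only: Sh_minus)
    moreover have "- (star x ** (k - x) + star (k - x) ** k) = star x ** x - star k ** k"
      by (simp add: matrix_diff_ldistrib matrix_diff_rdistrib star_diff)
    ultimately show ?thesis
      using k by (simp add: star_mult_left)
  qed
  then have "star x ** x - mat 1 = 0"
    by (intro Sh_zero)
  then show ?thesis
    using x by (simp add: K_iff G_iff)
qed

lemma compactin_K_coset:
  assumes "g \<in> G"
  shows "compactin X ((\<lambda>k. k ** g) ` K)"
proof -
  obtain N where N: "g \<in> Sh 1 0 N"
    using Sh_bounded by blast
  have "compactin (mat_topology D) ((\<lambda>k. k ** g) ` K)"
  proof (rule compactin_bounded_closed)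
    show "(\<lambda>k. k ** g) ` K \<subseteq> Sh 1 0 (- 1 + N)"
      using Sh_mult[OF _ K_bounded N] by (intro image_subsetI) simp
  next
    fix A assume A: "\<And>n. \<exists>B\<in>(\<lambda>k. k ** g) ` K. B - A \<in> Sh 1 0 n"
    have "\<exists>k\<in>K. k - A ** star g \<in> Sh 1 0 n" for n
    proof -
      obtain k where k: "k \<in> K" "k ** g - A \<in> Sh 1 0 (n - N)"
        using A[of "n - N"] by blast
      have "(k ** g - A) ** star g \<in> Sh 1 0 (n - N + N)"
        using k N by (intro Sh_mult Sh_star) auto
      with k assms show ?thesis
        by (auto simp: matrix_diff_rdistrib)
    qed
    then have "A ** star g \<in> K"
      by (rule K_closed)
    then show "A \<in> (\<lambda>k. k ** g) ` K"
      using assms by (intro image_eqI[of _ _ "A ** star g"]) auto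
  qed
  then show ?thesis
    using assms by (auto simp: compactin_subtopology)
qed

text \<open>A matrix \<open>B\<close> of the group close to \<open>h\<close> equals
  \<open>(B ** star h) ** h\<close>, and the first factor lies in the congruence subgroup; how close
  \<open>B\<close> must be depends on the size of \<open>h\<close>.\<close>

lemma openin_stable:
  assumes "A \<subseteq> G" and stable: "\<And>l h. l \<in> Gs 2 c m \<Longrightarrow> h \<in> A \<Longrightarrow> l ** h \<in> A"
  shows "openin X A"
proof -
  have "\<exists>n. \<forall>B\<in>G. B - h \<in> Sh 1 0 n \<longrightarrow> B \<in> A" if h: "h \<in> A" for h
  proof -
    have hG: "h \<in> G"
      using h assms(1) by blast
    obtain N where N: "h \<in> Sh 1 0 N"
      using Sh_bounded by blast
    define n where "n = max 0 (m + 2 * c)"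
    have "B \<in> A" if B: "B \<in> G" "B - h \<in> Sh 1 0 (n - N)" for B
    proof -
      have "(B - h) ** star h \<in> Sh 1 0 (n - N + N)"
        using B N by (intro Sh_mult Sh_star) auto
      then have "B ** star h - mat 1 \<in> Sh 1 0 n"
        using hG by (simp add: matrix_diff_rdistrib star_mult_right)
      then have "B ** star h - mat 1 \<in> Sh 2 c m"
        using c_bounds by (intro Sh_1_0_subset[of 2 c m n]) (auto simp: n_def)
      then have "B ** star h \<in> Gs 2 c m"
        using B hG by (simp add: Gs_def)
      from stable[OF this h] show "B \<in> A"
        using hG by simp
    qed
    then show ?thesis
      by blast
  qed
  then obtain n where n: "\<And>h B. h \<in> A \<Longrightarrow> B \<in> G \<Longrightarrow> B - h \<in> Sh 1 0 (n h) \<Longrightarrow> B \<in> A"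
    by metis
  have "openin (mat_topology D) (\<Union>h\<in>A. {B. B - h \<in> Sh 1 0 (n h)})"
    by (intro openin_Union) (auto intro: openin_ball)
  moreover have "A = (\<Union>h\<in>A. {B. B - h \<in> Sh 1 0 (n h)}) \<inter> G"
    using n assms(1) by (auto simp: Sh_0)
  ultimately show ?thesis
    unfolding openin_subtopology by blast
qed

text \<open>Only finitely many entrywise residue classes meet \<open>H\<close>, and one
  representative inside \<open>H\<close> is chosen from each; \<open>H\<close> need not be a
  group.\<close>

lemma Gs_finite_index:
  assumes "H \<subseteq> K"
  obtains F where "finite F" "F \<subseteq> H" "\<And>k. k \<in> H \<Longrightarrow> \<exists>f\<in>F. k ** star f \<in> Gs 2 c m"
proof -
  define n where "n = nat (m + 2 * c + 1)"
  obtain R where R: "finite R" "\<And>x. x \<in> Sh 1 0 (- 1) \<Longrightarrow> \<exists>r\<in>R. x - r \<in> Sh 1 0 (- 1 + int (Suc n))"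
    using matrix_residues[of "- 1" "Suc n"] by blast
  define q where "q r k \<longleftrightarrow> k \<in> H \<and> k - r \<in> Sh 1 0 (int n)" for r k
  define F where "F = (\<lambda>r. SOME k. q r k) ` {r \<in> R. \<exists>k. q r k}"
  have q: "q r (SOME k. q r k)" if "q r k" for r k
    using that by (rule someI)
  have "finite F"
    using R by (simp add: F_def)
  moreover have "F \<subseteq> H"
    using q by (auto simp: F_def) (auto simp: q_def)
  moreover have "\<exists>f\<in>F. k ** star f \<in> Gs 2 c m" if k: "k \<in> H" for k
  proof -
    obtain r where r: "r \<in> R" "k - r \<in> Sh 1 0 (int n)"
      using R(2)[of k] K_bounded[of k] k assms by auto
    then have "q r k"
      using k by (simp add: q_def)
    define f where "f = (SOME k. q r k)"
    have "q r f"
      using q[OF \<open>q r k\<close>] by (simp add: f_def)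
    then have f: "f \<in> H" "f - r \<in> Sh 1 0 (int n)"
      by (simp_all add: q_def)
    have "f \<in> F"
      unfolding F_def f_def using r \<open>q r k\<close> by blast
    have "(k - r) - (f - r) \<in> Sh 1 0 (int n)"
      using r f by (rule_tac Sh_diff) auto
    then have "k - f \<in> Sh 2 c m"
      using c_bounds by (intro Sh_1_0_subset[of 2 c m "int n"]) (auto simp: n_def)
    then have "(k - f) ** star f \<in> Sh 2 c (m + 0)"
      using f assms by (intro Sh_mult Sh_star) (auto simp: K_iff)
    then have "k ** star f \<in> Gs 2 c m"
      using f k assms by (auto simp: Gs_def matrix_diff_rdistrib star_mult_right subset_iff)
    with \<open>f \<in> F\<close> show ?thesis
      by blast
  qed
  ultimately show ?thesis
    using that by blast
qed

end

section \<open>Fixed vectors\<close>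

lemma linear_simps:
  assumes "Vector_Spaces.linear s1 s2 f"
  shows "f (x + y) = f x + f y" "f (s1 a x) = s2 a (f x)" "f 0 = 0" "f (x - y) = f x - f y" "f (- x) = - f x"
    "f (sum g A) = (\<Sum>a\<in>A. f (g a))"
proof -
  interpret module_hom s1 s2 f
    using assms by (simp add: Vector_Spaces.linear_def)
  show "f (x + y) = f x + f y" "f (s1 a x) = s2 a (f x)" "f 0 = 0" "f (x - y) = f x - f y" "f (- x) = - f x"
    "f (sum g A) = (\<Sum>a\<in>A. f (g a))"
    by (rule add scale zero diff neg sum)+
qed

definition poly_apply :: "('c::field \<Rightarrow> 'b \<Rightarrow> 'b::ab_group_add) \<Rightarrow> 'c poly \<Rightarrow> ('b \<Rightarrow> 'b) \<Rightarrow> 'b \<Rightarrow> 'b" where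
  "poly_apply sc q u x = fold_coeffs (\<lambda>a y. sc a x + u y) q 0"

context
  fixes sc :: "'c::field \<Rightarrow> 'b::ab_group_add \<Rightarrow> 'b" and u :: "'b \<Rightarrow> 'b"
  assumes vs: "vector_space sc" and u: "Vector_Spaces.linear sc sc u"
begin

interpretation vector_space sc
  by (rule vs)

lemma poly_apply_0: "poly_apply sc 0 u x = 0"
  by (simp add: poly_apply_def)

lemma poly_apply_pCons: "poly_apply sc (pCons a q) u x = sc a x + u (poly_apply sc q u x)"
  by (cases "q = 0 \<and> a = 0"; cases "q = 0")
    (auto simp: poly_apply_def linear_simps[OF u])

lemma poly_apply_add: "poly_apply sc (q + r) u x = poly_apply sc q u x + poly_apply sc r u x"
  by (induction q r rule: poly_induct2)
    (simp_all add: poly_apply_0 poly_apply_pCons linear_simps[OF u] scale_left_distrib)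

lemma poly_apply_smult: "poly_apply sc (smult c q) u x = sc c (poly_apply sc q u x)"
  by (induction q) (simp_all add: poly_apply_0 poly_apply_pCons linear_simps[OF u] scale_right_distrib)

lemma poly_apply_monom: "poly_apply sc (monom 1 n) u x = (u ^^ n) x"
  by (induction n) (simp_all add: poly_apply_0 poly_apply_pCons monom_0 monom_Suc linear_simps(3)[OF u])

lemma poly_apply_subspace:
  assumes "subspace W" "u ` W \<subseteq> W" "x \<in> W"
  shows "poly_apply sc q u x \<in> W"
  by (induction q) (use assms in \<open>auto simp: poly_apply_0 poly_apply_pCons subspace_0 subspace_add subspace_scale\<close>)

end

text \<open>The polynomial \<open>X^n - 1\<close> annihilates \<open>x\<close>. An annihilating
  polynomial of least degree has a root \<open>a\<close>, and its cofactor applied to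
  \<open>x\<close> is an eigenvector; no finite dimension is assumed.\<close>

lemma eigenvector:
  fixes sc :: "'c::alg_closed_field \<Rightarrow> 'b::ab_group_add \<Rightarrow> 'b"
  assumes vs: "vector_space sc" and u: "Vector_Spaces.linear sc sc u"
    and W: "module.subspace sc W" "u ` W \<subseteq> W" "x \<in> W" "x \<noteq> 0" and n: "n > 0" "(u ^^ n) x = x"
  obtains y a where "y \<in> W" "y \<noteq> 0" "u y = sc a y"
proof -
  interpret vector_space sc
    by (rule vs)
  note pa = poly_apply_0[OF vs u] poly_apply_pCons[OF vs u] poly_apply_add[OF vs u] poly_apply_smult[OF vs u] poly_apply_monom[OF vs u]
  define S where "S q \<longleftrightarrow> q \<noteq> 0 \<and> poly_apply sc q u x = 0" for q
  have "poly_apply sc (monom 1 n + [:- 1:]) u x = 0"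
    using n by (simp add: pa linear_simps(3)[OF u])
  moreover have "monom 1 n + [:- 1:] \<noteq> (0 :: 'c poly)"
  proof
    assume "monom 1 n + [:- 1:] = (0 :: 'c poly)"
    from arg_cong[OF this, of "\<lambda>p. coeff p n"] show False
      using n by (cases n) auto
  qed
  ultimately have "S (monom 1 n + [:- 1:])"
    by (simp add: S_def)
  then obtain q where q: "S q" "\<And>r. S r \<Longrightarrow> degree q \<le> degree r"
    using arg_min_natI[of S _ degree] arg_min_nat_le[of S _ degree] by metis
  have "degree q > 0"
  proof (rule ccontr)
    assume "\<not> ?thesis"
    then obtain a where a: "q = [:a:]"
      by (metis degree_eq_zeroE neq0_conv)
    then show False
      using q(1) W by (simp add: S_def pa linear_simps(3)[OF u])
  qed
  then obtain a where "poly q a = 0"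
    using alg_closed_imp_poly_has_root by blast
  then obtain r where r: "q = [:- a, 1:] * r"
    by (auto simp: poly_eq_0_iff_dvd)
  have "r \<noteq> 0"
    using q(1) r by (auto simp: S_def)
  then have "degree r < degree q"
    unfolding r by (subst degree_mult_eq) auto
  then have nz: "poly_apply sc r u x \<noteq> 0"
    using q(2)[of r] \<open>r \<noteq> 0\<close> by (auto simp: S_def)
  have "q = smult (- a) r + pCons 0 r"
    by (simp add: r)
  with q(1) have "poly_apply sc (smult (- a) r + pCons 0 r) u x = 0"
    by (metis S_def)
  then have "u (poly_apply sc r u x) = sc a (poly_apply sc r u x)"
    by (simp only: pa scale_zero_left add_0 scale_minus_left) simp
  with nz show ?thesis
    using that poly_apply_subspace[OF vs u W(1-3)] by blast
qed

text \<open>An eigenspace of one operator in \<open>W\<close> is stable under the operators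
  commuting with it there, so the induction can continue inside this eigenspace.\<close>

lemma common_eigenvector:
  fixes sc :: "'c::alg_closed_field \<Rightarrow> 'b::ab_group_add \<Rightarrow> 'b"
  assumes vs: "vector_space sc" and "finite F"
    and "\<And>u. u \<in> F \<Longrightarrow> Vector_Spaces.linear sc sc u"
    and "module.subspace sc W" "x \<in> W" "x \<noteq> 0"
    and "\<And>u x. u \<in> F \<Longrightarrow> x \<in> W \<Longrightarrow> u x \<in> W"
    and "\<And>u u' x. u \<in> F \<Longrightarrow> u' \<in> F \<Longrightarrow> x \<in> W \<Longrightarrow> u (u' x) = u' (u x)"
    and "\<And>u. u \<in> F \<Longrightarrow> \<exists>n>0. \<forall>x\<in>W. (u ^^ n) x = x"
  shows "\<exists>y\<in>W. y \<noteq> 0 \<and> (\<forall>u\<in>F. \<exists>a. u y = sc a y)"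
  using assms(2-)
proof (induction F arbitrary: W x rule: finite_induct)
  case (insert u F)
  interpret vector_space sc
    by (rule vs)
  have lin: "Vector_Spaces.linear sc sc u"
    using insert.prems(1) by simp
  obtain n where n: "n > 0" "\<forall>x\<in>W. (u ^^ n) x = x"
    using insert.prems(7)[of u] by auto
  have "u ` W \<subseteq> W"
    using insert.prems(5)[of u] by auto
  moreover have "(u ^^ n) x = x"
    using n insert.prems(3) by simp
  ultimately obtain y a where y: "y \<in> W" "y \<noteq> 0" "u y = sc a y"
    using eigenvector[OF vs lin insert.prems(2) _ insert.prems(3,4) n(1)] by metis
  define W' where "W' = {x \<in> W. u x = sc a x}"
  have W': "subspace W'"
    using insert.prems(2) unfolding W'_def subspace_def
    by (auto simp: linear_simps[OF lin] scale_right_distrib scale_left_commute)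
  have "\<exists>y\<in>W'. y \<noteq> 0 \<and> (\<forall>u\<in>F. \<exists>a. u y = sc a y)"
  proof (rule insert.IH[of W' y])
    show "u' x \<in> W'" if "u' \<in> F" "x \<in> W'" for u' x
    proof -
      have "u (u' x) = u' (u x)" "u' x \<in> W"
        using that insert.prems(6)[of u u' x] insert.prems(5)[of u' x] by (auto simp: W'_def)
      then show ?thesis
        using that insert.prems(1)[of u'] by (auto simp: W'_def linear_simps)
    qed
    show "Vector_Spaces.linear sc sc u'" if "u' \<in> F" for u'
      using that insert.prems(1) by simp
    show "u1 (u2 x) = u2 (u1 x)" if "u1 \<in> F" "u2 \<in> F" "x \<in> W'" for u1 u2 x
      using that insert.prems(6)[of u1 u2 x] by (simp add: W'_def)
    show "\<exists>n>0. \<forall>x\<in>W'. (u' ^^ n) x = x" if "u' \<in> F" for u'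
      using that insert.prems(7)[of u'] by (auto simp: W'_def)
  qed (use W' y in \<open>auto simp: W'_def\<close>)
  then show ?case
    by (auto simp: W'_def)
qed auto

section \<open>Fixed vectors of the pro-\<open>p\<close> group \<open>I1\<close>\<close>

context unitary_compact
begin

lemma Gs_subset: "\<exists>M\<ge>1. Gs 2 c M \<subseteq> Gs 3 (1 + c) N"
proof -
  define n where "n = max 0 (N + 2 * (1 + c))"
  have "Sh 2 c (2 * n + 2 * c + 1) \<subseteq> Sh 3 (1 + c) N"
    using c_bounds Sh_subset_1_0[of 2 c n "2 * n + 2 * c + 1"] Sh_1_0_subset[of 3 "1 + c" N n]
    by (auto simp: n_def)
  then have "Gs 2 c (2 * n + 2 * c + 1) \<subseteq> Gs 3 (1 + c) N"
    by (auto simp: Gs_def)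
  then show ?thesis
    using c_bounds by (intro exI[of _ "2 * n + 2 * c + 1"]) (auto simp: n_def)
qed

text \<open>With \<open>x = g - mat 1\<close> and \<open>y = h - mat 1\<close>, the difference of
  the two products is \<open>x ** y - y ** x\<close>, of level \<open>2 * m\<close>, which is at
  least \<open>m + 1\<close>.\<close>

lemma Gs_commutator:
  assumes "1 \<le> m" "g \<in> Gs 3 b m" "h \<in> Gs 3 b m"
  obtains z where "z \<in> Gs 3 b (m + 1)" "g ** h = z ** (h ** g)"
proof -
  define x y where "x = g - mat 1" and "y = h - mat 1"
  have G: "g \<in> G" "h \<in> G" and xy: "x \<in> Sh 3 b m" "y \<in> Sh 3 b m"
    using assms by (auto simp: Gs_def x_def y_def)
  have e: "g ** h - h ** g = x ** y - y ** x"
    by (simp add: x_def y_def matrix_diff_ldistrib matrix_diff_rdistrib)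
  have "x ** y \<in> Sh 3 b (m + m)" "y ** x \<in> Sh 3 b (m + m)"
    using xy by (intro Sh_mult; simp)+
  then have "x ** y - y ** x \<in> Sh 3 b (m + m)"
    by (simp add: Sh_diff)
  moreover have "star (h ** g) \<in> Sh 3 b 0"
    using assms by (intro Sh_star Gs_Sh[of 3 m] Gs_mult) auto
  ultimately have "(g ** h - h ** g) ** star (h ** g) \<in> Sh 3 b (m + m + 0)"
    unfolding e by (intro Sh_mult) auto
  then have "(g ** h) ** star (h ** g) - mat 1 \<in> Sh 3 b (m + 1)"
    using G assms(1) Sh_mono[of "m + 1" "m + m"]
    by (simp add: matrix_diff_rdistrib star_mult_right)
  then have "(g ** h) ** star (h ** g) \<in> Gs 3 b (m + 1)"
    using G by (simp add: Gs_def)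
  then show ?thesis
    using G by (intro that[of "(g ** h) ** star (h ** g)"]) simp_all
qed

definition mpow :: "'e mat3 \<Rightarrow> nat \<Rightarrow> 'e mat3" where
  "mpow g n = ((**) g ^^ n) (mat 1)"

lemma mpow_Suc: "mpow g (Suc n) = g ** mpow g n" and mpow_0: "mpow g 0 = mat 1"
  by (simp_all add: mpow_def)

text \<open>\<open>(1 + x)\<^sup>p\<close> is congruent to \<open>1 + p x\<close> modulo the square of the ideal of \<open>x\<close>.\<close>

lemma Gs_mpow:
  assumes "1 \<le> m" "g \<in> Gs 3 b m" "of_nat p \<in> P 1"
  shows "mpow g p \<in> Gs 3 b (m + 1)"
proof -
  define smul where "smul = (\<lambda>k (x :: 'e mat3). \<chi> i j. of_nat k * x$i$j)"
  define x where "x = g - mat 1"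
  have x: "x \<in> Sh 3 b m"
    using assms by (simp add: Gs_def x_def)
  have pow: "mpow g k \<in> Gs 3 b m" for k
    using assms by (induction k) (auto simp: mpow_Suc mpow_0 Gs_mult Gs_one)
  have main: "mpow g k - mat 1 - smul k x \<in> Sh 3 b (m + 1)" for k
  proof (induction k)
    case 0
    have "mpow g 0 - mat 1 - smul 0 x = 0"
      by (simp add: mpow_0 smul_def vec_eq_iff)
    then show ?case
      by (simp add: Sh_0)
  next
    case (Suc k)
    have "x ** (mpow g k - mat 1) \<in> Sh 3 b (m + m)"
      using x pow[of k] by (intro Sh_mult) (auto simp: Gs_def)
    then have "x ** (mpow g k - mat 1) \<in> Sh 3 b (m + 1)"
      by (rule Sh_mono[rotated]) (use assms in simp)
    then have "(mpow g k - mat 1 - smul k x) + x ** (mpow g k - mat 1) \<in> Sh 3 b (m + 1)"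
      using Suc by (intro Sh_add) auto
    moreover have "mpow g (Suc k) - mat 1 - smul (Suc k) x =
        (mpow g k - mat 1 - smul k x) + x ** (mpow g k - mat 1)"
    proof -
      have "smul (Suc k) x = smul k x + x"
        by (simp add: smul_def vec_eq_iff algebra_simps)
      then show ?thesis
        by (simp add: mpow_Suc x_def matrix_diff_rdistrib matrix_diff_ldistrib)
    qed
    ultimately show ?case
      by metis
  qed
  have "smul p x \<in> Sh 3 b (m + 1)"
  proof -
    have "of_nat p \<in> Q 3 1"
      using assms(3) by (auto simp: Q_def P_iff)
    then have "of_nat p * x$i$j \<in> Q 3 (1 + (m - b * (idx j - idx i)))" for i j
      using x by (intro Q_mult) (auto simp: Sh_def)
    then show ?thesis
      by (simp add: Sh_def smul_def algebra_simps)
  qed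
  then have "(mpow g p - mat 1 - smul p x) + smul p x \<in> Sh 3 b (m + 1)"
    using main by (intro Sh_add) auto
  then show ?thesis
    using pow[of p] by (simp add: Gs_def)
qed

lemma root_of_unity_char:
  fixes a :: "'c::field"
  assumes "prime p" "CHAR('c) = p" "a ^ p = 1"
  shows "a = 1"
proof -
  have "(1 + (a - 1)) ^ p = 1 ^ p + (a - 1) ^ p"
    using assms by (intro freshmans_dream) auto
  then have "(a - 1) ^ p = 0"
    using assms by simp
  then show ?thesis
    by simp
qed

text \<open>Descend along the filtration of \<open>I1\<close>, whose successive quotients are abelian of exponent \<open>p\<close>.\<close>

lemma I1_fixed_vector:
  fixes sc :: "'c::alg_closed_field \<Rightarrow> 'b::ab_group_add \<Rightarrow> 'b" and \<tau> :: "'e mat3 \<Rightarrow> 'b \<Rightarrow> 'b"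
  assumes vs: "vector_space sc" and p: "prime p" "CHAR('c) = p" "of_nat p \<in> P 1"
    and lin: "\<And>g. g \<in> I1 \<Longrightarrow> Vector_Spaces.linear sc sc (\<tau> g)"
    and one: "\<And>x. \<tau> (mat 1) x = x"
    and mult: "\<And>g h x. g \<in> I1 \<Longrightarrow> h \<in> I1 \<Longrightarrow> \<tau> (g ** h) x = \<tau> g (\<tau> h x)"
    and triv: "\<And>g x. g \<in> Gs 3 (1 + c) N \<Longrightarrow> \<tau> g x = x"
    and W: "module.subspace sc W" "w0 \<in> W" "w0 \<noteq> 0" "\<And>g x. g \<in> I1 \<Longrightarrow> x \<in> W \<Longrightarrow> \<tau> g x \<in> W"
  shows "\<exists>x\<in>W. x \<noteq> 0 \<and> (\<forall>g\<in>I1. \<tau> g x = x)"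
proof -
  interpret vector_space sc
    by (rule vs)
  let ?H = "\<lambda>m. Gs 3 (1 + c) m"
  have sub: "?H m \<subseteq> I1" if "1 \<le> m" for m
    unfolding I1_Gs using that by (rule Gs_mono)
  have "1 \<le> m \<longrightarrow> (\<exists>x\<in>W. x \<noteq> 0 \<and> (\<forall>g\<in>?H m. \<tau> g x = x))" if "m \<le> max 1 N" for m
    using that
  proof (induction rule: int_le_induct)
    case base
    have "?H (max 1 N) \<subseteq> ?H N"
      by (rule Gs_mono) simp
    then show ?case
      using W triv by blast
  next
    case (step i)
    show ?case
    proof
      assume m: "1 \<le> i - 1"
      define m where "m = i - 1"
      have m1: "1 \<le> m" "i = m + 1"
        using m by (auto simp: m_def)
      define W' where "W' = {x \<in> W. \<forall>g\<in>?H (m + 1). \<tau> g x = x}"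
      obtain x0 where x0: "x0 \<in> W'" "x0 \<noteq> 0"
        using step m1 by (auto simp: W'_def)
      have sm: "?H m \<subseteq> I1" "?H (m + 1) \<subseteq> I1"
        using sub m1 by auto
      have W': "subspace W'"
        using W(1) sm(2) unfolding W'_def subspace_def by (auto simp: linear_simps[OF lin])
      obtain M where M: "Gs 2 c M \<subseteq> ?H N"
        using Gs_subset by blast
      have "?H m \<subseteq> K"
        using sm by auto
      then obtain F where F: "finite F" "F \<subseteq> ?H m" "\<And>k. k \<in> ?H m \<Longrightarrow> \<exists>f\<in>F. k ** star f \<in> Gs 2 c M"
        using Gs_finite_index[of "?H m" M] by metis
      have "\<tau> ` ?H m \<subseteq> \<tau> ` F"
      proof
        fix t assume "t \<in> \<tau> ` ?H m"
        then obtain k where k: "k \<in> ?H m" "t = \<tau> k"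
          by blast
        then obtain f where f: "f \<in> F" "k ** star f \<in> Gs 2 c M"
          using F by blast
        have fk: "f \<in> I1" "k \<in> I1"
          using F f k sm by auto
        then have "\<tau> ((k ** star f) ** f) x = \<tau> (k ** star f) (\<tau> f x)" for x
          by (intro mult I1_mult I1_star)
        then have "\<tau> k x = \<tau> f x" for x
          using triv[of "k ** star f"] f M fk by auto
        then show "t \<in> \<tau> ` F"
          using f k by auto
      qed
      then have fin: "finite (\<tau> ` ?H m)"
        using F(1) finite_subset by blast
      have stab: "\<tau> g x \<in> W'" if g: "g \<in> ?H m" and x: "x \<in> W'" for g x
      proof -
        have gI: "g \<in> I1" "g \<in> G"
          using g sm by auto
        have "\<tau> z (\<tau> g x) = \<tau> g x" if z: "z \<in> ?H (m + 1)" for z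
        proof -
          have "star g ** z ** star (star g) \<in> ?H (m + 1)"
            using g z m1 gI by (intro Gs_normal Sh_star Gs_Sh[of 3 m]) auto
          then have z': "star g ** z ** g \<in> ?H (m + 1)"
            by simp
          have "\<tau> z (\<tau> g x) = \<tau> (z ** g) x"
            using z gI sm by (simp add: mult subset_iff)
          also have "z ** g = g ** (star g ** z ** g)"
            using gI by (simp add: matrix_mul_assoc star_mult_right)
          also have "\<tau> (g ** (star g ** z ** g)) x = \<tau> g (\<tau> (star g ** z ** g) x)"
            using z' gI sm by (intro mult) auto
          also have "\<dots> = \<tau> g x"
            using z' x by (simp add: W'_def)
          finally show ?thesis .
        qed
        then show ?thesis
          using x gI W by (simp add: W'_def)
      qed
      have powm: "(\<tau> g ^^ k) x = \<tau> (mpow g k) x \<and> mpow g k \<in> ?H m" if g: "g \<in> ?H m" for g k x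
        using g sm m1
        by (induction k) (auto simp: mpow_Suc mpow_0 one Gs_one Gs_mult mult subset_iff)
      have pow: "(\<tau> g ^^ p) x = x" if g: "g \<in> ?H m" and x: "x \<in> W'" for g x
        using powm[OF g, of p x] Gs_mpow[OF m1(1) g p(3)] x by (auto simp: W'_def)
      have comm: "\<tau> g (\<tau> h x) = \<tau> h (\<tau> g x)" if gh: "g \<in> ?H m" "h \<in> ?H m" and x: "x \<in> W'" for g h x
      proof -
        obtain z where z: "z \<in> ?H (m + 1)" "g ** h = z ** (h ** g)"
          using Gs_commutator[OF m1(1) gh] by blast
        have I: "g \<in> I1" "h \<in> I1" "z \<in> I1" "h ** g \<in> I1"
          using gh z sm by (auto intro!: I1_mult)
        have "\<tau> g (\<tau> h x) = \<tau> (g ** h) x"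
          using I by (simp add: mult)
        also have "\<dots> = \<tau> z (\<tau> h (\<tau> g x))"
          unfolding z(2) using I by (simp add: mult)
        also have "\<dots> = \<tau> h (\<tau> g x)"
          using z(1) stab[OF gh(2) stab[OF gh(1) x]] by (simp add: W'_def)
        finally show ?thesis .
      qed
      have "p > 0"
        using p(1) prime_gt_0_nat by blast
      have "\<exists>y\<in>W'. y \<noteq> 0 \<and> (\<forall>u\<in>\<tau> ` ?H m. \<exists>a. u y = sc a y)"
      proof (rule common_eigenvector[OF vs fin _ W' x0])
        show "Vector_Spaces.linear sc sc u" if "u \<in> \<tau> ` ?H m" for u
          using that lin sm by auto
        show "u x \<in> W'" if "u \<in> \<tau> ` ?H m" "x \<in> W'" for u x
          using that stab by auto
        show "u (u' x) = u' (u x)" if "u \<in> \<tau> ` ?H m" "u' \<in> \<tau> ` ?H m" "x \<in> W'" for u u' x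
          using that comm by auto
        show "\<exists>n>0. \<forall>x\<in>W'. (u ^^ n) x = x" if "u \<in> \<tau> ` ?H m" for u
          using that pow \<open>p > 0\<close> by auto
      qed
      then obtain y where y: "y \<in> W'" "y \<noteq> 0" "\<And>g. g \<in> ?H m \<Longrightarrow> \<exists>a. \<tau> g y = sc a y"
        by auto
      \<comment> \<open>The eigenvalue is a \<open>p\<close>-th root of unity, hence 1 in
        characteristic \<open>p\<close>.\<close>
      have "\<tau> g y = y" if g: "g \<in> ?H m" for g
      proof -
        obtain a where a: "\<tau> g y = sc a y"
          using y g by blast
        have "(\<tau> g ^^ k) y = sc (a ^ k) y" for k
          using g sm by (induction k) (auto simp: linear_simps[OF lin] a mult.commute)
        then have "sc (a ^ p) y = sc 1 y"
          using pow[OF g y(1)] by simp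
        then have "a ^ p = 1"
          using y(2) by (simp only: scale_cancel_right) simp
        then have "a = 1"
          by (rule root_of_unity_char[OF p(1,2)])
        then show ?thesis
          using a by simp
      qed
      then show "\<exists>x\<in>W. x \<noteq> 0 \<and> (\<forall>g\<in>?H (i - 1). \<tau> g x = x)"
        using y by (auto simp: W'_def m_def)
    qed
  qed
  from this[of 1] show ?thesis
    by (simp add: I1_Gs)
qed

end

section \<open>Weights\<close>

locale weight_rep = unitary_compact D \<kappa> + vector_space sc
  for D :: "'e::field unram_datum" and \<kappa> :: maxcpt
    and sc :: "'c::alg_closed_field \<Rightarrow> 'v::ab_group_add \<Rightarrow> 'v" +
  fixes p :: nat and \<sigma> :: "'e mat3 \<Rightarrow> 'v \<Rightarrow> 'v"
  assumes residue: "residue_char D p" and char_p: "CHAR('c) = p" and weight: "weight D \<kappa> sc \<sigma>"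
begin

lemma prime_p: "prime p" and p_P: "of_nat p \<in> P 1"
  using residue by (auto simp: residue_char_def)

lemma lin: "k \<in> K \<Longrightarrow> Vector_Spaces.linear sc sc (\<sigma> k)"
  and \<sigma>_one [simp]: "\<sigma> (mat 1) x = x"
  and \<sigma>_mult: "k \<in> K \<Longrightarrow> h \<in> K \<Longrightarrow> \<sigma> (k ** h) x = \<sigma> k (\<sigma> h x)"
  using weight by (auto simp: weight_def smooth_rep_def Defs.representation_def)

lemma \<sigma>_star [simp]: "k \<in> K \<Longrightarrow> \<sigma> (star k) (\<sigma> k x) = x" "k \<in> K \<Longrightarrow> \<sigma> k (\<sigma> (star k) x) = x"
  by (simp_all add: \<sigma>_mult[symmetric] star_mult_left star_mult_right)

lemma \<sigma>_s [simp]: "\<sigma> s (\<sigma> s x) = x"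
  by (simp add: \<sigma>_mult[symmetric] s_s)

lemma irreducible: "subspace W \<Longrightarrow> (\<And>k x. k \<in> K \<Longrightarrow> x \<in> W \<Longrightarrow> \<sigma> k x \<in> W) \<Longrightarrow> x \<in> W \<Longrightarrow> x \<noteq> 0 \<Longrightarrow> W = UNIV"
  using weight unfolding weight_def irreducible_rep_def by blast

lemma nontrivial: "\<exists>x::'v. x \<noteq> 0"
  using weight unfolding weight_def irreducible_rep_def by blast

lemma Gs_K: "0 \<le> m \<Longrightarrow> g \<in> Gs 2 c m \<Longrightarrow> g \<in> K"
  using Gs_Sh[of 2 m g c] by (simp add: K_iff Gs_G)

text \<open>By normality in \<open>K\<close> the vectors fixed by this congruence subgroup form a
  \<open>K\<close>-stable subspace, so by irreducibility one nonzero fixed vector suffices.\<close>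

lemma fixed_by_normal:
  assumes "0 \<le> m" "x \<noteq> 0" "\<And>g. g \<in> Gs 2 c m \<Longrightarrow> \<sigma> g x = x"
  shows "g \<in> Gs 2 c m \<Longrightarrow> \<sigma> g y = y"
proof -
  define W where "W = {x. \<forall>g\<in>Gs 2 c m. \<sigma> g x = x}"
  have "W = UNIV"
  proof (rule irreducible)
    show "subspace W"
      using Gs_K[OF assms(1)] unfolding W_def subspace_def by (auto simp: linear_simps[OF lin])
    show "\<sigma> k y \<in> W" if k: "k \<in> K" and y: "y \<in> W" for k y
      unfolding W_def
    proof safe
      fix g assume g: "g \<in> Gs 2 c m"
      have g': "star k ** g ** k \<in> Gs 2 c m"
        using Gs_normal[of 2 "star k" c g m] k g by (simp add: K_iff Sh_star)
      have "\<sigma> g (\<sigma> k y) = \<sigma> (g ** k) y"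
        using k Gs_K[OF assms(1) g] by (simp add: \<sigma>_mult)
      also have "g ** k = k ** (star k ** g ** k)"
        using k by (simp add: matrix_mul_assoc star_mult_right)
      also have "\<sigma> (k ** (star k ** g ** k)) y = \<sigma> k (\<sigma> (star k ** g ** k) y)"
        using k Gs_K[OF assms(1) g'] by (intro \<sigma>_mult)
      also have "\<dots> = \<sigma> k y"
        using y g' by (simp add: W_def)
      finally show "\<sigma> g (\<sigma> k y) = \<sigma> k y" .
    qed
  qed (use assms in \<open>auto simp: W_def\<close>)
  then show "g \<in> Gs 2 c m \<Longrightarrow> \<sigma> g y = y"
    by (auto simp: W_def)
qed

text \<open>Smoothness only gives a level for each vector separately; \<open>fixed_by_normal\<close>
  makes the level of one nonzero vector work for all.\<close>

lemma smooth_level: "\<exists>M\<ge>1. \<forall>g\<in>Gs 2 c M. \<forall>x. \<sigma> g x = x"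
proof -
  obtain x :: 'v where x: "x \<noteq> 0"
    using nontrivial by blast
  have "openin (subtopology (mat_topology D) K) {g \<in> K. \<sigma> g x = x}"
    using weight by (auto simp: weight_def smooth_rep_def)
  then obtain T where T: "openin (mat_topology D) T" "{g \<in> K. \<sigma> g x = x} = T \<inter> K"
    unfolding openin_subtopology by blast
  then have "mat 1 \<in> T"
    using K_one \<sigma>_one by blast
  then obtain n where n: "\<And>B. B - mat 1 \<in> Sh 1 0 n \<Longrightarrow> B \<in> T"
    using T(1) unfolding openin_mat by blast
  define M where "M = max 1 (2 * n + 2 * c)"
  have "\<sigma> g x = x" if g: "g \<in> Gs 2 c M" for g
  proof -
    have "g - mat 1 \<in> Sh 1 0 n"
      using g c_bounds by (intro Sh_subset_1_0[of 2 c n M]) (auto simp: Gs_def M_def)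
    then have "g \<in> T \<inter> K"
      using n Gs_K[of M g] g by (auto simp: M_def)
    then show ?thesis
      using T(2) by blast
  qed
  then have "\<forall>g\<in>Gs 2 c M. \<forall>y. \<sigma> g y = y"
    using fixed_by_normal[of M x] x by (auto simp: M_def)
  then show ?thesis
    by (intro exI[of _ M]) (auto simp: M_def)
qed

lemma \<sigma>_finite_reps:
  assumes "H \<subseteq> K"
  obtains F where "finite F" "F \<subseteq> H" "\<And>k. k \<in> H \<Longrightarrow> \<exists>f\<in>F. k ** star f \<in> Gs 2 c m"
    "\<sigma> ` H = \<sigma> ` F"
proof -
  obtain M where M: "1 \<le> M" "\<And>g x. g \<in> Gs 2 c M \<Longrightarrow> \<sigma> g x = x"
    using smooth_level by blast
  obtain F where F: "finite F" "F \<subseteq> H" "\<And>k. k \<in> H \<Longrightarrow> \<exists>f\<in>F. k ** star f \<in> Gs 2 c (max m M)"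
    using Gs_finite_index[OF assms] by metis
  have "\<sigma> k \<in> \<sigma> ` F" if k: "k \<in> H" for k
  proof -
    obtain f where f: "f \<in> F" "k ** star f \<in> Gs 2 c (max m M)"
      using F k by blast
    then have "\<sigma> (k ** star f) (\<sigma> f x) = \<sigma> f x" for x
      using M Gs_mono[of M "max m M" 2 c] by auto
    moreover have "\<sigma> (k ** star f) (\<sigma> f x) = \<sigma> k x" for x
      using f F k assms by (subst \<sigma>_mult) (auto simp: subset_iff)
    ultimately have "\<sigma> k = \<sigma> f"
      by auto
    then show ?thesis
      using f by simp
  qed
  then have "\<sigma> ` H = \<sigma> ` F"
    using F(2) by auto
  moreover have "\<exists>f\<in>F. k ** star f \<in> Gs 2 c m" if "k \<in> H" for k
    using F(3)[OF that] Gs_mono[of m "max m M" 2 c] by auto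
  ultimately show ?thesis
    using that F by blast
qed

lemma finite_\<sigma>: "H \<subseteq> K \<Longrightarrow> finite (\<sigma> ` H)"
  using \<sigma>_finite_reps[of H] by (metis finite_imageI)

lemma I1_K: "I1 \<subseteq> K"
  by auto

lemma I1_level: "\<exists>N. \<forall>g\<in>Gs 3 (1 + c) N. \<forall>x. \<sigma> g x = x"
proof -
  obtain M where M: "1 \<le> M" "\<And>g x. g \<in> Gs 2 c M \<Longrightarrow> \<sigma> g x = x"
    using smooth_level by blast
  define n where "n = max 0 (M + 2 * c)"
  have "Sh 3 (1 + c) (3 * n + 2 * (1 + c)) \<subseteq> Sh 2 c M"
    using c_bounds Sh_subset_1_0[of 3 "1 + c" n "3 * n + 2 * (1 + c)"] Sh_1_0_subset[of 2 c M n]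
    by (auto simp: n_def)
  then have "Gs 3 (1 + c) (3 * n + 2 * (1 + c)) \<subseteq> Gs 2 c M"
    by (auto simp: Gs_def)
  then show ?thesis
    using M by blast
qed

lemma fixed_vector:
  assumes "subspace W" "w0 \<in> W" "w0 \<noteq> 0" "\<And>g x. g \<in> I1 \<Longrightarrow> x \<in> W \<Longrightarrow> \<sigma> g x \<in> W"
  shows "\<exists>x\<in>W. x \<noteq> 0 \<and> (\<forall>g\<in>I1. \<sigma> g x = x)"
proof -
  obtain N where N: "\<forall>g\<in>Gs 3 (1 + c) N. \<forall>x. \<sigma> g x = x"
    using I1_level by blast
  show ?thesis
    by (rule I1_fixed_vector[OF vector_space_axioms prime_p char_p p_P, of \<sigma> N])
      (use N assms in \<open>auto simp: lin \<sigma>_mult\<close>)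
qed

definition VI :: "'v set" where
  "VI = {x. \<forall>g\<in>I1. \<sigma> g x = x}"

lemma VI_D: "x \<in> VI \<Longrightarrow> g \<in> I1 \<Longrightarrow> \<sigma> g x = x"
  by (simp add: VI_def)

lemma subspace_VI: "subspace VI"
  using I1_K unfolding VI_def subspace_def by (auto simp: linear_simps[OF lin])

lemma VI_I: "x \<in> VI \<Longrightarrow> i \<in> I \<Longrightarrow> \<sigma> i x \<in> VI"
  unfolding VI_def
proof safe
  fix g assume x: "\<forall>g\<in>I1. \<sigma> g x = x" and i: "i \<in> I" and g: "g \<in> I1"
  have g': "star i ** g ** i \<in> I1"
    using I1_normal[OF I_star[OF i] g] by simp
  have "\<sigma> g (\<sigma> i x) = \<sigma> (i ** (star i ** g ** i)) x"
    using i g by (simp add: \<sigma>_mult[symmetric] matrix_mul_assoc star_mult_right)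
  also have "\<dots> = \<sigma> i (\<sigma> (star i ** g ** i) x)"
    using i g' by (intro \<sigma>_mult) auto
  finally show "\<sigma> g (\<sigma> i x) = \<sigma> i x"
    using x g' by simp
qed

text \<open>The radical \<open>I1 \<inter> s I1 s\<close> of \<open>K\<close> acts trivially, because it is normal in \<open>K\<close> and pro-\<open>p\<close>.\<close>

lemma Gs_1_I1: "Gs 2 c 1 \<subseteq> I1"
proof -
  have "Sh 2 c 1 \<subseteq> Sh 3 (1 + c) 1"
  proof
    show "x \<in> Sh 3 (1 + c) 1" if "x \<in> Sh 2 c 1" for x
      using that by (rule_tac disjE[OF c_cases]) (auto simp: Sh_iff Q_P elim: P_mono[rotated])
  qed
  then show ?thesis
    unfolding I1_Gs by (auto simp: Gs_def)
qed

lemma radical_trivial: "g \<in> Gs 2 c 1 \<Longrightarrow> \<sigma> g x = x"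
proof -
  obtain w0 :: 'v where "w0 \<noteq> 0"
    using nontrivial by blast
  then obtain y where "y \<noteq> 0" "\<forall>g\<in>I1. \<sigma> g y = y"
    using fixed_vector[of UNIV w0] by auto
  then show "g \<in> Gs 2 c 1 \<Longrightarrow> \<sigma> g x = x"
    using fixed_by_normal[of 1 y g x] Gs_1_I1 by auto
qed

text \<open>Modulo the radical such a \<open>g\<close> is upper unipotent and, by the second
  condition, also lower triangular; hence it lies in the radical.\<close>

lemma I1_s_conj_I:
  assumes "g \<in> I1" "s ** g ** s \<in> I"
  shows "\<sigma> g x = x"
proof -
  have "s ** g ** s \<in> Sh 3 (1 + c) 0" "g \<in> Gs 3 (1 + c) 1"
    using assms by (simp_all add: I_iff I1_Gs[symmetric])
  moreover have "w\<^sup>2 * y \<in> P m \<longleftrightarrow> y \<in> P (m - 2)" for y m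
    using P_powi_mult[of 2 y m] by simp
  ultimately have "g - mat 1 \<in> Sh 2 c 1"
    by (rule_tac disjE[OF c_cases])
      (simp_all add: Gs_def Sh_iff Q_P s_conj P_powi_mult P_unif_mult)
  then show ?thesis
    using assms by (intro radical_trivial) (simp add: Gs_def)
qed

lemma Tor_eigenvector:
  assumes W: "subspace W" "W \<subseteq> VI" "x \<in> W" "x \<noteq> 0" and T: "\<And>t x. t \<in> Tor \<Longrightarrow> x \<in> W \<Longrightarrow> \<sigma> t x \<in> W"
  obtains y where "y \<in> W" "y \<noteq> 0" "\<And>t. t \<in> Tor \<Longrightarrow> \<exists>a. \<sigma> t y = sc a y"
proof -
  have fin: "finite (\<sigma> ` Tor)"
    by (rule finite_\<sigma>) auto
  have "\<exists>y\<in>W. y \<noteq> 0 \<and> (\<forall>u\<in>\<sigma> ` Tor. \<exists>a. u y = sc a y)"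
  proof (rule common_eigenvector[OF vector_space_axioms fin _ W(1,3,4)])
    show "Vector_Spaces.linear sc sc u" if "u \<in> \<sigma> ` Tor" for u
      using that lin by auto
    show "u x \<in> W" if "u \<in> \<sigma> ` Tor" "x \<in> W" for u x
      using that T by auto
    show "u (u' x) = u' (u x)" if "u \<in> \<sigma> ` Tor" "u' \<in> \<sigma> ` Tor" "x \<in> W" for u u' x
      using that Tor_commute by (auto simp: \<sigma>_mult[symmetric])
    show "\<exists>n>0. \<forall>x\<in>W. (u ^^ n) x = x" if uT: "u \<in> \<sigma> ` Tor" for u
    proof -
      obtain t where t: "t \<in> Tor" "u = \<sigma> t"
        using uT by blast
      have pow: "\<sigma> t ^^ n = \<sigma> (mpow t n) \<and> mpow t n \<in> K" for n
        using t by (induction n) (auto simp: mpow_0 mpow_Suc \<sigma>_mult fun_eq_iff)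
      have "range (\<lambda>n. u ^^ n) \<subseteq> \<sigma> ` K"
        using pow t by auto
      then have "finite (range (\<lambda>n::nat. u ^^ n))"
        using finite_\<sigma>[of K] finite_subset by blast
      then have "\<not> inj (\<lambda>n::nat. u ^^ n)"
        using finite_imageD by blast
      then obtain m n :: nat where mn: "u ^^ m = u ^^ n" "m < n"
        unfolding inj_def by (metis linorder_neqE_nat)
      have inj: "inj (u ^^ m)"
        using pow[of m] t by (metis \<sigma>_star(1) inj_on_inverseI)
      have "(u ^^ (n - m)) x = x" for x
      proof -
        have "(u ^^ m) ((u ^^ (n - m)) x) = (u ^^ (m + (n - m))) x"
          by (simp add: funpow_add)
        also have "\<dots> = (u ^^ m) x"
          using mn by simp
        finally show ?thesis
          using inj by (simp add: inj_eq)
      qed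
      then show ?thesis
        using mn(2) by (intro exI[of _ "n - m"]) auto
    qed
  qed
  then show ?thesis
    using that by auto
qed

text \<open>The invariants are not yet known to be a line, so a torus eigenvector among them has to
  be singled out.\<close>

definition eigen :: "'v \<Rightarrow> bool" where
  "eigen x \<longleftrightarrow> x \<in> VI \<and> x \<noteq> 0 \<and> (\<forall>t\<in>Tor. \<exists>a. \<sigma> t x = sc a x)"

lemma eigen_I: "eigen x \<Longrightarrow> i \<in> I \<Longrightarrow> \<exists>a. a \<noteq> 0 \<and> \<sigma> i x = sc a x"
proof -
  assume x: "eigen x" and i: "i \<in> I"
  obtain t u where tu: "t \<in> Tor" "u \<in> I1" "i = t ** u"
    using i by (rule I_decomposition)
  obtain a where a: "\<sigma> t x = sc a x"
    using x tu by (auto simp: eigen_def)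
  have "\<sigma> i x = sc a x"
    using x tu a by (simp add: \<sigma>_mult eigen_def VI_D)
  moreover have "a \<noteq> 0"
  proof
    assume "a = 0"
    then have "\<sigma> (star i) (\<sigma> i x) = 0"
      using calculation i by (simp add: linear_simps[OF lin])
    then show False
      using x i by (simp add: eigen_def)
  qed
  ultimately show ?thesis
    by blast
qed

text \<open>By the Bruhat decomposition, elements of \<open>K\<close> outside of \<open>I\<close>
  map an eigenvector \<open>x\<close> to a multiple of a member of this finite set.\<close>

definition orbit :: "'v \<Rightarrow> 'v set" where
  "orbit x = (\<lambda>u. \<sigma> u (\<sigma> s x)) ` I1"

lemma orbit_s: "\<sigma> s x \<in> orbit x"
  unfolding orbit_def by (rule image_eqI[of _ _ "mat 1"]) auto

lemma orbit_I1: "u \<in> I1 \<Longrightarrow> z \<in> orbit x \<Longrightarrow> \<sigma> u z \<in> orbit x"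
proof -
  assume u: "u \<in> I1" and "z \<in> orbit x"
  then obtain u' where u': "u' \<in> I1" "z = \<sigma> u' (\<sigma> s x)"
    by (auto simp: orbit_def)
  then have "\<sigma> u z = \<sigma> (u ** u') (\<sigma> s x)"
    using u by (simp add: \<sigma>_mult)
  then show ?thesis
    using u u' I1_mult by (auto simp: orbit_def)
qed

lemma orbit_eq_image: "orbit x = (\<lambda>f. f (\<sigma> s x)) ` (\<sigma> ` I1)"
  by (auto simp: orbit_def)

lemma finite_orbit: "finite (orbit x)"
  unfolding orbit_eq_image using finite_\<sigma>[OF I1_K] by blast

lemma orbit_K:
  assumes x: "eigen x" and k: "k \<in> K" "k \<notin> I"
  shows "\<exists>a. \<exists>z\<in>orbit x. \<sigma> k x = sc a z"
proof -
  obtain u i where ui: "u \<in> I1" "i \<in> I" "k = u ** s ** i"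
    using k by (rule Bruhat)
  obtain a where a: "\<sigma> i x = sc a x"
    using eigen_I[OF x ui(2)] by blast
  have "\<sigma> k x = \<sigma> u (\<sigma> s (\<sigma> i x))"
    using ui by (simp add: \<sigma>_mult)
  also have "\<dots> = sc a (\<sigma> u (\<sigma> s x))"
    using ui by (simp add: a linear_simps[OF lin])
  finally show ?thesis
    using ui(1) by (auto simp: orbit_def)
qed

lemma span_insert_orbit:
  assumes x: "eigen x"
  shows "span (insert x (orbit x)) = UNIV"
proof (rule irreducible)
  have Kx: "\<sigma> k x \<in> span (insert x (orbit x))" if k: "k \<in> K" for k
  proof (cases "k \<in> I")
    case True
    then obtain a where "\<sigma> k x = sc a x"
      using eigen_I[OF x] by blast
    then show ?thesis
      by (simp add: span_scale span_base)
  next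
    case False
    then obtain a z where "z \<in> orbit x" "\<sigma> k x = sc a z"
      using orbit_K[OF x k] by blast
    then show ?thesis
      by (simp add: span_scale span_base)
  qed
  show "\<sigma> k y \<in> span (insert x (orbit x))" if k: "k \<in> K" and y: "y \<in> span (insert x (orbit x))" for k y
    using y
  proof (induction rule: span_induct)
    case (step y)
    then consider "y = x" | "y \<in> orbit x"
      by auto
    then have "\<exists>k'\<in>K. y = \<sigma> k' x"
    proof cases
      case 1
      then show ?thesis
        by (intro bexI[of _ "mat 1"]) auto
    next
      case 2
      then obtain u where "u \<in> I1" "y = \<sigma> u (\<sigma> s x)"
        by (auto simp: orbit_def)
      then show ?thesis
        by (intro bexI[of _ "u ** s"]) (auto simp: \<sigma>_mult)
    qed
    then show ?case
      using Kx k by (auto simp: \<sigma>_mult[symmetric])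
  next
    case base
    show ?case
      using k unfolding subspace_def by (auto simp: linear_simps[OF lin] span_add span_scale span_zero)
  qed
  show "x \<in> span (insert x (orbit x))"
    by (simp add: span_base)
qed (use x in \<open>auto simp: eigen_def\<close>)

text \<open>If \<open>s ** u ** s\<close> were in \<open>I\<close>, then \<open>u\<close> would act
  trivially and \<open>z\<close> would be \<open>\<sigma> s x\<close>; so the Bruhat case
  \<open>orbit_K\<close> applies.\<close>

lemma s_orbit:
  assumes x: "eigen x" and z: "z \<in> orbit x" "z \<noteq> \<sigma> s x"
  shows "\<exists>a. \<exists>z'\<in>orbit x. \<sigma> s z = sc a z'"
proof -
  obtain u where u: "u \<in> I1" "z = \<sigma> u (\<sigma> s x)"
    using z by (auto simp: orbit_def)
  have "s ** u ** s \<notin> I"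
    using I1_s_conj_I[OF u(1)] u z by auto
  then show ?thesis
    using orbit_K[OF x, of "s ** u ** s"] u by (auto simp: \<sigma>_mult)
qed

text \<open>The exchange argument: a dependency within the orbit can be moved by \<open>I1\<close> to the vector \<open>s x\<close>, and
  then by \<open>s\<close> to \<open>x\<close>.\<close>

lemma independent_orbit:
  assumes x: "eigen x" and nx: "x \<notin> span (orbit x)"
  shows "independent (orbit x)"
  unfolding dependent_def
proof safe
  fix z assume z: "z \<in> orbit x" "z \<in> span (orbit x - {z})"
  obtain u where u: "u \<in> I1" "z = \<sigma> u (\<sigma> s x)"
    using z by (auto simp: orbit_def)
  have uK: "u \<in> K" "star u \<in> I1"
    using u I1_star by auto
  have "\<sigma> s (\<sigma> (star u) y) \<in> span (orbit x)" if "y \<in> span (orbit x - {z})" for y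
    using that
  proof (induction rule: span_induct)
    case (step y)
    have "\<sigma> (star u) y \<noteq> \<sigma> s x"
      using step u uK by (metis Diff_iff \<sigma>_star(2) singletonI)
    moreover have "\<sigma> (star u) y \<in> orbit x"
      using step uK orbit_I1 by auto
    ultimately show ?case
      using s_orbit[OF x] by (metis span_base span_scale)
  next
    case base
    show ?case
      using uK unfolding subspace_def by (auto simp: linear_simps[OF lin] span_add span_scale span_zero)
  qed
  from this[OF z(2)] have "x \<in> span (orbit x)"
    using u uK by simp
  with nx show False
    by simp
qed

text \<open>If \<open>g\<close> fixes \<open>\<sigma> s x\<close>, then \<open>s ** g ** s\<close>
  fixes \<open>x\<close>. Outside of \<open>I\<close> this would make \<open>x\<close> a multiple of
  an orbit member; inside of \<open>I\<close> it forces \<open>g\<close> to act trivially.\<close>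

lemma inj_orbit:
  assumes x: "eigen x" and nx: "x \<notin> span (orbit x)"
  shows "inj_on (\<lambda>f. f (\<sigma> s x)) (\<sigma> ` I1)"
proof (rule inj_onI, safe)
  fix u u' assume u: "u \<in> I1" "u' \<in> I1" and eq: "\<sigma> u (\<sigma> s x) = \<sigma> u' (\<sigma> s x)"
  define g where "g = star u' ** u"
  have g: "g \<in> I1"
    using u by (simp add: g_def I1_mult I1_star)
  have gs: "\<sigma> g (\<sigma> s x) = \<sigma> s x"
    using u eq by (simp add: g_def \<sigma>_mult)
  have "s ** g ** s \<in> I"
  proof (rule ccontr)
    assume "s ** g ** s \<notin> I"
    then obtain a z where "z \<in> orbit x" "\<sigma> (s ** g ** s) x = sc a z"
      using orbit_K[OF x, of "s ** g ** s"] g by auto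
    then have "x \<in> span (orbit x)"
      using gs g span_scale[OF span_base, of z "orbit x" a] by (simp add: \<sigma>_mult)
    with nx show False
      by simp
  qed
  then have "\<sigma> g y = y" for y
    using I1_s_conj_I[OF g] by simp
  moreover have "\<sigma> u y = \<sigma> u' (\<sigma> g y)" for y
    using u by (simp add: g_def \<sigma>_mult)
  ultimately show "\<sigma> u = \<sigma> u'"
    by auto
qed

end

section \<open>Sums over the finite image of \<open>I1\<close>, and the spanning property of the
  orbit\<close>

context weight_rep
begin

text \<open>A finite group of operators: \<open>I1\<close> itself is infinite, so sums over
  \<open>I1\<close> modulo the subgroup acting trivially are taken here.\<close>

definition Qs :: "('v \<Rightarrow> 'v) set" where
  "Qs = \<sigma> ` I1"

lemma finite_Qs: "finite Qs"
  unfolding Qs_def by (rule finite_\<sigma>[OF I1_K])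

lemma sum_Qs_comp: "u \<in> I1 \<Longrightarrow> (\<Sum>f\<in>Qs. f (\<sigma> u x)) = (\<Sum>f\<in>Qs. f x)"
proof -
  assume u: "u \<in> I1"
  have inj: "inj_on (\<lambda>f. f \<circ> \<sigma> u) Qs"
  proof (rule inj_onI)
    fix f f' assume eq: "f \<circ> \<sigma> u = f' \<circ> \<sigma> u"
    have "f y = f' y" for y
      using fun_cong[OF eq, of "\<sigma> (star u) y"] u by simp
    then show "f = f'"
      by auto
  qed
  have "(\<lambda>f. f \<circ> \<sigma> u) ` Qs \<subseteq> Qs"
  proof safe
    fix f assume "f \<in> Qs"
    then obtain g where g: "g \<in> I1" "f = \<sigma> g"
      by (auto simp: Qs_def)
    then have "f \<circ> \<sigma> u = \<sigma> (g ** u)"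
      using u by (auto simp: \<sigma>_mult)
    then show "f \<circ> \<sigma> u \<in> Qs"
      using g u I1_mult by (auto simp: Qs_def)
  qed
  then have "(\<lambda>f. f \<circ> \<sigma> u) ` Qs = Qs"
    using inj finite_Qs by (intro endo_inj_surj)
  then have "(\<Sum>f\<in>Qs. f x) = (\<Sum>f\<in>(\<lambda>f. f \<circ> \<sigma> u) ` Qs. f x)"
    by simp
  also have "\<dots> = (\<Sum>f\<in>Qs. f (\<sigma> u x))"
    by (simp add: sum.reindex[OF inj])
  finally show ?thesis
    by simp
qed

lemma \<sigma>_sum_Qs: "u \<in> I1 \<Longrightarrow> \<sigma> u (\<Sum>f\<in>Qs. f x) = (\<Sum>f\<in>Qs. f x)"
proof -
  assume u: "u \<in> I1"
  have inj: "inj_on (\<lambda>f. \<sigma> u \<circ> f) Qs"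
  proof (rule inj_onI)
    fix f f' assume eq: "\<sigma> u \<circ> f = \<sigma> u \<circ> f'"
    have "f y = f' y" for y
      using fun_cong[OF eq, of y] u by (metis I1_I I_K \<sigma>_star(1) comp_apply)
    then show "f = f'"
      by auto
  qed
  have "(\<lambda>f. \<sigma> u \<circ> f) ` Qs \<subseteq> Qs"
  proof safe
    fix f assume "f \<in> Qs"
    then obtain g where g: "g \<in> I1" "f = \<sigma> g"
      by (auto simp: Qs_def)
    then have "\<sigma> u \<circ> f = \<sigma> (u ** g)"
      using u by (auto simp: \<sigma>_mult)
    then show "\<sigma> u \<circ> f \<in> Qs"
      using g u I1_mult by (auto simp: Qs_def)
  qed
  then have "(\<lambda>f. \<sigma> u \<circ> f) ` Qs = Qs"
    using inj finite_Qs by (intro endo_inj_surj)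
  then have "(\<Sum>f\<in>Qs. f x) = (\<Sum>f\<in>(\<lambda>f. \<sigma> u \<circ> f) ` Qs. f x)"
    by simp
  also have "\<dots> = \<sigma> u (\<Sum>f\<in>Qs. f x)"
    using u by (simp add: sum.reindex[OF inj] linear_simps[OF lin])
  finally show ?thesis
    by simp
qed

text \<open>The witness is a central unipotent element, whose only entry above the diagonal is a trace-zero
  element of valuation \<open>- c\<close>.\<close>

lemma exists_big_cell: "\<exists>u\<in>I1. s ** u ** s \<notin> I"
proof -
  obtain t b where t: "cj t \<noteq> t" "cj t = b - t"
    using gal_generator by metis
  define y0 where "y0 = t - cj t"
  have y0: "y0 \<noteq> 0" "cj y0 = - y0"
    using t(1) by (simp_all add: y0_def)
  define y where "y = y0 * w powi (- c - v y0)"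
  have y: "y \<noteq> 0" "v y = - c" "y + cj y = 0"
    using y0 by (auto simp: y_def val_mult val_power_int)
  have iso: "iso 0 y"
    using y by (simp add: iso_def)
  have "nup 0 y \<in> I1"
    using y by (intro nup_I1 iso) (simp add: P_iff)
  moreover have "s ** nup 0 y ** s \<notin> I"
    using y by (simp add: I_iff_31 s_conj P_powi_mult) (simp add: P_iff)
  ultimately show ?thesis
    by blast
qed

text \<open>An element \<open>u\<close> of the big cell then makes \<open>s ** u ** s\<close> fix
  \<open>x\<close>, while the Bruhat decomposition sends \<open>x\<close> to a multiple of an orbit
  member.\<close>

lemma I1_trivial_imp:
  assumes x: "eigen x" and triv: "\<And>u y. u \<in> I1 \<Longrightarrow> \<sigma> u y = y"
  shows "x \<in> span (orbit x)"
proof -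
  obtain u where u: "u \<in> I1" "s ** u ** s \<notin> I"
    using exists_big_cell by blast
  obtain a z where "z \<in> orbit x" "\<sigma> (s ** u ** s) x = sc a z"
    using orbit_K[OF x _ u(2)] u(1) by auto
  moreover have "\<sigma> (s ** u ** s) x = x"
    using u(1) by (simp add: \<sigma>_mult triv)
  ultimately show ?thesis
    using span_scale[OF span_base] by metis
qed

text \<open>Otherwise summation over \<open>Qs\<close> is injective: a nonzero kernel would contain
  an \<open>I1\<close>-fixed vector, on which it is multiplication by \<open>card Qs\<close>. As
  \<open>\<sigma> u y - y\<close> always lies in the kernel, \<open>I1\<close> would then act
  trivially.\<close>

lemma card_Qs_zero:
  assumes x: "eigen x" and nx: "x \<notin> span (orbit x)"
  shows "(of_nat (card Qs) :: 'c) = 0"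
proof (rule ccontr)
  assume q: "(of_nat (card Qs) :: 'c) \<noteq> 0"
  define e where "e y = (\<Sum>f\<in>Qs. f y)" for y
  have linQ: "f \<in> Qs \<Longrightarrow> Vector_Spaces.linear sc sc f" for f
    using lin by (auto simp: Qs_def)
  have e_add: "e (y + z) = e y + e z" and e_scale: "e (sc a y) = sc a (e y)" and e_0: "e 0 = 0"
    and e_diff: "e (y - z) = e y - e z" for y z a
    by (simp_all add: e_def sum.distrib sum_subtractf linear_simps[OF linQ] scale_sum_right)
  have fixed: "e y = sc (of_nat (card Qs)) y" if "\<And>g. g \<in> I1 \<Longrightarrow> \<sigma> g y = y" for y
  proof -
    have "e y = (\<Sum>f\<in>Qs. y)"
      unfolding e_def by (rule sum.cong) (use that in \<open>auto simp: Qs_def\<close>)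
    then show ?thesis
      by (simp add: sum_constant_scale)
  qed
  have ker: "y = 0" if "e y = 0" for y
  proof (rule ccontr)
    assume "y \<noteq> 0"
    have "\<exists>z\<in>{z. e z = 0}. z \<noteq> 0 \<and> (\<forall>g\<in>I1. \<sigma> g z = z)"
    proof (rule fixed_vector)
      show "subspace {z. e z = 0}"
        by (simp add: subspace_def e_add e_scale e_0)
      show "\<sigma> g z \<in> {z. e z = 0}" if "g \<in> I1" "z \<in> {z. e z = 0}" for g z
        using that sum_Qs_comp[of g z] by (simp add: e_def)
    qed (use \<open>e y = 0\<close> \<open>y \<noteq> 0\<close> in auto)
    then obtain z where "e z = 0" "z \<noteq> 0" "\<And>g. g \<in> I1 \<Longrightarrow> \<sigma> g z = z"
      by blast
    with fixed[of z] q show False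
      by simp
  qed
  have "\<sigma> u y = y" if u: "u \<in> I1" for u y
  proof -
    have "e (\<sigma> u y - y) = 0"
      using sum_Qs_comp[OF u, of y] by (simp add: e_diff) (simp add: e_def)
    then show ?thesis
      using ker[of "\<sigma> u y - y"] by simp
  qed
  with I1_trivial_imp[OF x] nx show False
    by blast
qed

lemma sum_orbit:
  assumes x: "eigen x" and nx: "x \<notin> span (orbit x)"
  shows "(\<Sum>f\<in>Qs. f (\<sigma> s x)) \<noteq> 0"
proof
  assume 0: "(\<Sum>f\<in>Qs. f (\<sigma> s x)) = 0"
  have "(\<Sum>z\<in>orbit x. sc 1 z) = 0"
    using 0 sum.reindex[OF inj_orbit[OF x nx], of "\<lambda>z. z"] by (simp add: orbit_eq_image Qs_def o_def)
  then have "(1 :: 'c) = 0"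
    using independentD[OF independent_orbit[OF x nx] finite_orbit order_refl, of "\<lambda>_. 1"] orbit_s[of x] by blast
  then show False
    by simp
qed

text \<open>The torus normalizes \<open>I1\<close>, so conjugation permutes the summation range
  \<open>Qs\<close>, and \<open>\<sigma> s x\<close> is a torus eigenvector because \<open>s\<close>
  normalizes the torus.\<close>

lemma orbit_sum_eigen:
  assumes x: "eigen x" and nx: "x \<notin> span (orbit x)"
  shows "eigen (\<Sum>f\<in>Qs. f (\<sigma> s x))"
  unfolding eigen_def
proof safe
  let ?y = "\<Sum>f\<in>Qs. f (\<sigma> s x)"
  show "?y \<in> VI"
    using \<sigma>_sum_Qs by (simp add: VI_def)
  show "?y = 0 \<Longrightarrow> False"
    using sum_orbit[OF x nx] by simp
  fix t assume t: "t \<in> Tor"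
  then obtain a where a: "\<sigma> (s ** t ** s) x = sc a x"
    using x Tor_s[OF t] by (auto simp: eigen_def)
  have ts: "\<sigma> t (\<sigma> s x) = sc a (\<sigma> s x)"
  proof -
    have "\<sigma> s (\<sigma> (s ** t ** s) x) = \<sigma> t (\<sigma> s x)"
      using t by (simp add: \<sigma>_mult)
    then show ?thesis
      by (simp add: a linear_simps[OF lin])
  qed
  define conj where "conj f = \<sigma> t \<circ> f \<circ> \<sigma> (star t)" for f
  have inj: "inj_on conj Qs"
  proof (rule inj_onI)
    fix f f' assume eq: "conj f = conj f'"
    have "f y = f' y" for y
    proof -
      have "\<sigma> (star t) (conj f (\<sigma> t y)) = \<sigma> (star t) (conj f' (\<sigma> t y))"
        using eq by simp
      then show ?thesis
        using t by (simp add: conj_def)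
    qed
    then show "f = f'"
      by auto
  qed
  have "conj ` Qs \<subseteq> Qs"
  proof safe
    fix f assume "f \<in> Qs"
    then obtain g where g: "g \<in> I1" "f = \<sigma> g"
      by (auto simp: Qs_def)
    then have "conj f = \<sigma> (t ** g ** star t)"
      using t by (auto simp: conj_def \<sigma>_mult)
    then show "conj f \<in> Qs"
      using I1_normal[OF Tor_I[OF t] g(1)] by (simp add: Qs_def)
  qed
  then have "conj ` Qs = Qs"
    using inj finite_Qs by (intro endo_inj_surj)
  then have "(\<Sum>f\<in>Qs. f (\<sigma> t (\<sigma> s x))) = (\<Sum>f\<in>conj ` Qs. f (\<sigma> t (\<sigma> s x)))"
    by simp
  also have "\<dots> = (\<Sum>f\<in>Qs. conj f (\<sigma> t (\<sigma> s x)))"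
    by (simp add: sum.reindex[OF inj])
  also have "\<dots> = (\<Sum>f\<in>Qs. \<sigma> t (f (\<sigma> s x)))"
    using t by (simp add: conj_def)
  also have "\<dots> = \<sigma> t ?y"
    using t by (simp add: linear_simps[OF lin])
  finally have "\<sigma> t ?y = (\<Sum>f\<in>Qs. f (sc a (\<sigma> s x)))"
    by (simp add: ts)
  also have "\<dots> = (\<Sum>f\<in>Qs. sc a (f (\<sigma> s x)))"
    by (rule sum.cong) (use lin in \<open>auto simp: Qs_def linear_simps\<close>)
  also have "\<dots> = sc a ?y"
    by (simp add: scale_sum_right)
  finally show "\<exists>a. \<sigma> t ?y = sc a ?y"
    by blast
qed

text \<open>
  If not, the vector \<open>y\<close> obtained by summing the orbit of \<open>s x\<close> would again be an eigenvector with \<open>y\<close> outside of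
  the span of its orbit, by comparison of dimensions; but summing the orbit of \<open>s y\<close> gives a multiple of \<open>y\<close>.
\<close>

lemma eigen_in_span_orbit:
  assumes x: "eigen x"
  shows "x \<in> span (orbit x)"
proof (rule ccontr)
  assume nx: "x \<notin> span (orbit x)"
  define y where "y = (\<Sum>f\<in>Qs. f (\<sigma> s x))"
  have y: "eigen y"
    unfolding y_def by (rule orbit_sum_eigen[OF x nx])
  have "card (orbit x) = card Qs"
    unfolding orbit_eq_image Qs_def by (rule card_image[OF inj_orbit[OF x nx]])
  moreover have "x \<notin> orbit x"
    using nx span_base by blast
  ultimately have card_x: "card (insert x (orbit x)) = Suc (card Qs)"
    using finite_orbit by simp
  have card_y: "card (orbit y) \<le> card Qs"
    unfolding orbit_eq_image Qs_def[symmetric] by (rule card_image_le[OF finite_Qs])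
  have ind: "independent (insert x (orbit x))"
    by (rule independent_insertI[OF nx independent_orbit[OF x nx]])
  have ny: "y \<notin> span (orbit y)"
  proof
    assume "y \<in> span (orbit y)"
    then have "span (orbit y) = UNIV"
      using span_insert_orbit[OF y] span_redundant by metis
    then have "card (insert x (orbit x)) \<le> card (orbit y)"
      using independent_span_bound[OF finite_orbit[of y] ind] by simp
    then show False
      using card_x card_y by simp
  qed
  \<comment> \<open>Two cases by Bruhat: within \<open>I\<close> the sum is a multiple of
    \<open>card Qs\<close> times \<open>x\<close>, which vanishes; otherwise it is a multiple of the
    sum over the orbit, i.e. of \<open>y\<close>.\<close>
  have "\<exists>a. (\<Sum>g\<in>Qs. g (\<sigma> s (f (\<sigma> s x)))) = sc a y" if f: "f \<in> Qs" for f
  proof -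
    obtain u where u: "u \<in> I1" "f = \<sigma> u"
      using f by (auto simp: Qs_def)
    have k: "s ** u ** s \<in> K" "\<sigma> s (f (\<sigma> s x)) = \<sigma> (s ** u ** s) x"
      using u by (simp_all add: \<sigma>_mult)
    have scale: "(\<Sum>g\<in>Qs. g (sc a z)) = sc a (\<Sum>g\<in>Qs. g z)" for a z
      unfolding scale_sum_right by (rule sum.cong) (use lin in \<open>auto simp: Qs_def linear_simps\<close>)
    show ?thesis
    proof (cases "s ** u ** s \<in> I")
      case True
      then obtain a where a: "\<sigma> (s ** u ** s) x = sc a x"
        using eigen_I[OF x] by blast
      have "(\<Sum>g\<in>Qs. g x) = (\<Sum>g\<in>Qs. x)"
        by (rule sum.cong) (use x in \<open>auto simp: Qs_def eigen_def VI_D\<close>)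
      also have "\<dots> = 0"
        by (simp add: sum_constant_scale card_Qs_zero[OF x nx])
      finally show ?thesis
        by (intro exI[of _ 0]) (simp add: k a scale)
    next
      case False
      then obtain a z where z: "z \<in> orbit x" "\<sigma> (s ** u ** s) x = sc a z"
        using orbit_K[OF x k(1)] by blast
      then obtain u' where "u' \<in> I1" "z = \<sigma> u' (\<sigma> s x)"
        by (auto simp: orbit_def)
      then have "(\<Sum>g\<in>Qs. g z) = y"
        by (simp add: sum_Qs_comp y_def)
      then show ?thesis
        by (intro exI[of _ a]) (simp add: k z scale)
    qed
  qed
  then obtain a where a: "\<And>f. f \<in> Qs \<Longrightarrow> (\<Sum>g\<in>Qs. g (\<sigma> s (f (\<sigma> s x)))) = sc (a f) y"
    by metis
  have "(\<Sum>g\<in>Qs. g (\<sigma> s y)) = (\<Sum>g\<in>Qs. \<Sum>f\<in>Qs. g (\<sigma> s (f (\<sigma> s x))))"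
    by (rule sum.cong) (use lin in \<open>auto simp: Qs_def y_def linear_simps[OF lin]\<close>)
  also have "\<dots> = (\<Sum>f\<in>Qs. sc (a f) y)"
    by (subst sum.swap) (simp add: a)
  finally have main: "(\<Sum>g\<in>Qs. g (\<sigma> s y)) = sc (\<Sum>f\<in>Qs. a f) y"
    by (simp add: scale_sum_left)
  then have nz: "(\<Sum>f\<in>Qs. a f) \<noteq> 0"
    using sum_orbit[OF y ny] by auto
  have "(\<Sum>g\<in>Qs. g (\<sigma> s y)) \<in> span (orbit y)"
    by (intro span_sum span_base) (auto simp: orbit_def Qs_def)
  then have "sc (inverse (\<Sum>f\<in>Qs. a f)) (sc (\<Sum>f\<in>Qs. a f) y) \<in> span (orbit y)"
    unfolding main by (rule span_scale)
  then show False
    using nz ny by simp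
qed

lemma span_orbit: "eigen x \<Longrightarrow> span (orbit x) = UNIV"
  using span_insert_orbit[of x] eigen_in_span_orbit[of x] span_redundant by metis

subsection \<open>The projection to the invariants\<close>

abbreviation M where "M \<equiv> coinv_kernel sc I1 \<sigma>"
abbreviation M' where "M' \<equiv> coinv_kernel sc I1' \<sigma>"

lemma subspace_M: "subspace M" "subspace M'"
  by (simp_all add: coinv_kernel_def)

lemma M_base: "g \<in> I1 \<Longrightarrow> \<sigma> g x - x \<in> M" and M'_base: "g \<in> I1' \<Longrightarrow> \<sigma> g x - x \<in> M'"
  unfolding coinv_kernel_def by (blast intro: span_base)+

text \<open>\<open>I1\<close> fixes a nonzero linear functional, and \<open>M\<close> is contained in its kernel.\<close>

lemma M_proper: "M \<noteq> UNIV"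
proof -
  \<comment> \<open>The dual is not a type of its own: it is realized as the subspace
    \<open>L\<close> of linear functionals inside the space of all functions, with the
    contragredient action \<open>\<tau>\<close>.\<close>
  define sf where "sf = (\<lambda>(a::'c) (f :: 'v \<Rightarrow> 'c) x. a * f x)"
  have vs: "vector_space sf"
    by unfold_locales (auto simp: sf_def fun_eq_iff algebra_simps)
  interpret fs: vector_space sf
    by (rule vs)
  have vs': "vector_space ((*) :: 'c \<Rightarrow> 'c \<Rightarrow> 'c)"
    by unfold_locales (auto simp: algebra_simps)
  interpret vp: vector_space_pair sc "(*) :: 'c \<Rightarrow> 'c \<Rightarrow> 'c"
    by unfold_locales (auto simp: algebra_simps)
  define L where "L = {f :: 'v \<Rightarrow> 'c. Vector_Spaces.linear sc (*) f}"
  have L_iff: "f \<in> L \<longleftrightarrow> (\<forall>x y. f (x + y) = f x + f y) \<and> (\<forall>a x. f (sc a x) = a * f x)" for f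
    unfolding L_def mem_Collect_eq
    using vector_space_axioms vs' by (auto simp: Vector_Spaces.linear_iff)
  obtain x0 :: 'v where "x0 \<noteq> 0"
    using nontrivial by blast
  then have "independent {x0}"
    by simp
  then obtain f0 where f0: "Vector_Spaces.linear sc (*) f0" "\<forall>x\<in>{x0}. f0 x = (1 :: 'c)"
    using vp.linear_independent_extend[of "{x0}" "\<lambda>_. 1"] by auto
  define \<tau> where "\<tau> = (\<lambda>g (f :: 'v \<Rightarrow> 'c) x. f (\<sigma> (star g) x))"
  obtain N where N: "\<forall>g\<in>Gs 3 (1 + c) N. \<forall>x. \<sigma> g x = x"
    using I1_level by blast
  have "\<exists>f\<in>L. f \<noteq> 0 \<and> (\<forall>g\<in>I1. \<tau> g f = f)"
  proof (rule I1_fixed_vector[OF vs prime_p char_p p_P, of \<tau> N])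
    show "Vector_Spaces.linear sf sf (\<tau> g)" for g
      using vs by (auto simp: Vector_Spaces.linear_iff \<tau>_def sf_def fun_eq_iff)
    show "\<tau> (mat 1) f = f" for f
      by (simp add: \<tau>_def)
    show "\<tau> (g ** h) f = \<tau> g (\<tau> h f)" if "g \<in> I1" "h \<in> I1" for g h f
      using that by (auto simp: \<tau>_def star_mult \<sigma>_mult)
    show "\<tau> g f = f" if "g \<in> Gs 3 (1 + c) N" for g f
      using N Gs_star[OF that] by (auto simp: \<tau>_def)
    show "fs.subspace L"
      unfolding fs.subspace_def by (auto simp: L_iff sf_def algebra_simps)
    show "f0 \<in> L"
      using f0 by (simp add: L_def)
    show "f0 \<noteq> 0"
      using f0 by auto
    show "\<tau> g f \<in> L" if "g \<in> I1" "f \<in> L" for g f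
      using that by (auto simp: L_iff \<tau>_def linear_simps[OF lin])
  qed
  then obtain f where f: "f \<in> L" "f \<noteq> 0" "\<And>g. g \<in> I1 \<Longrightarrow> \<tau> g f = f"
    by blast
  have "f x = 0" if "x \<in> M" for x
    using that unfolding coinv_kernel_def
  proof (induction rule: span_induct)
    case base
    show ?case
      using linear_simps[OF f(1)[unfolded L_def mem_Collect_eq]] by (auto simp: subspace_def)
  next
    case (step x)
    then obtain g y where g: "g \<in> I1" "x = \<sigma> g y - y"
      by blast
    have "f (\<sigma> g y) = f y"
      using fun_cong[OF f(3)[OF g(1)], of "\<sigma> g y"] g(1) by (simp add: \<tau>_def)
    then show ?case
      using f(1) linear_simps(4)[of sc "(*)" f] g(2) by (simp add: L_def)
  qed
  moreover obtain x where "f x \<noteq> 0"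
    using f(2) by (auto simp: fun_eq_iff)
  ultimately show ?thesis
    by blast
qed

lemma M'_s: "x \<in> M \<Longrightarrow> \<sigma> s x \<in> M'" and M_s: "x \<in> M' \<Longrightarrow> \<sigma> s x \<in> M"
proof -
  show "\<sigma> s x \<in> M'" if "x \<in> M"
    using that unfolding coinv_kernel_def[of sc I1]
  proof (induction rule: span_induct)
    case base
    show ?case
      using subspace_M(2) by (auto simp: subspace_def linear_simps[OF lin[OF s_K]])
  next
    case (step x)
    then obtain g y where g: "g \<in> I1" "x = \<sigma> g y - y"
      by blast
    have "\<sigma> s x = \<sigma> (s ** g ** s) (\<sigma> s y) - \<sigma> s y"
      using g by (simp add: \<sigma>_mult linear_simps[OF lin[OF s_K]])
    then show ?case
      using M'_base[OF s_conj_I1'[OF g(1)]] by simp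
  qed
  show "\<sigma> s x \<in> M" if "x \<in> M'"
    using that unfolding coinv_kernel_def[of sc I1']
  proof (induction rule: span_induct)
    case base
    show ?case
      using subspace_M(1) by (auto simp: subspace_def linear_simps[OF lin[OF s_K]])
  next
    case (step x)
    then obtain g y where g: "g \<in> I1'" "x = \<sigma> g y - y"
      by blast
    have "g \<in> K"
      using g by (simp add: I1'_iff)
    then have "\<sigma> s x = \<sigma> (s ** g ** s) (\<sigma> s y) - \<sigma> s y"
      using g by (simp add: \<sigma>_mult linear_simps[OF lin[OF s_K]])
    then show ?case
      using M_base[OF s_conj_I1[OF g(1)]] by simp
  qed
qed

lemma M'_proper: "M' \<noteq> UNIV"
  using M_proper M_s \<sigma>_s by (metis UNIV_I UNIV_eq_I)

lemma I1'_K: "g \<in> I1' \<Longrightarrow> g \<in> K"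
  by (simp add: I1'_iff)

lemma I1'_Tor:
  assumes "t \<in> Tor" "g \<in> I1'"
  shows "t ** g ** star t \<in> I1'"
proof -
  have "(s ** t ** s) ** (s ** g ** s) ** star (s ** t ** s) \<in> I1"
    using assms Tor_s s_conj_I1 by (intro I1_normal) auto
  from s_conj_I1'[OF this] show ?thesis
    by (simp add: star_mult matrix_mul_assoc[symmetric] s_s)
qed

lemma M'_Tor:
  assumes "t \<in> Tor" "x \<in> M'"
  shows "\<sigma> t x \<in> M'"
  using assms(2,1) unfolding coinv_kernel_def
proof (induction rule: span_induct)
  case base
  then show ?case
    unfolding subspace_def by (auto simp: linear_simps[OF lin] span_zero span_add span_scale)
next
  case (step x)
  then obtain g y where g: "g \<in> I1'" "x = \<sigma> g y - y"
    by blast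
  have "\<sigma> t x = \<sigma> (t ** g ** star t) (\<sigma> t y) - \<sigma> t y"
    using g step I1'_K by (simp add: \<sigma>_mult linear_simps[OF lin])
  then show ?case
    using I1'_Tor[OF _ g(1)] step by (blast intro: span_base)
qed

text \<open>The orbit of \<open>\<sigma> s x\<close> spans everything, and its members agree with
  \<open>\<sigma> s x\<close> modulo \<open>M\<close>. This is applied to
  \<open>\<sigma> s y\<close> and carried back by \<open>s\<close>, which exchanges \<open>M\<close>
  and \<open>M'\<close>.\<close>

lemma decompose:
  assumes x: "eigen x"
  shows "\<exists>a. y - sc a x \<in> M'"
proof -
  have "\<exists>a. z - sc a (\<sigma> s x) \<in> M" if "z \<in> span (orbit x)" for z
    using that
  proof (induction rule: span_induct)
    case base
    show ?case
      unfolding subspace_def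
    proof (intro conjI allI ballI)
      show "0 \<in> {z. \<exists>a. z - sc a (\<sigma> s x) \<in> M}"
        using subspace_M(1) by (auto intro!: exI[of _ 0] simp: subspace_0)
    next
      fix z z' assume "z \<in> {z. \<exists>a. z - sc a (\<sigma> s x) \<in> M}" "z' \<in> {z. \<exists>a. z - sc a (\<sigma> s x) \<in> M}"
      then obtain a a' where "z - sc a (\<sigma> s x) \<in> M" "z' - sc a' (\<sigma> s x) \<in> M"
        by blast
      from subspace_add[OF subspace_M(1) this] show "z + z' \<in> {z. \<exists>a. z - sc a (\<sigma> s x) \<in> M}"
        by (intro CollectI exI[of _ "a + a'"]) (simp add: scale_left_distrib algebra_simps)
    next
      fix b z assume "z \<in> {z. \<exists>a. z - sc a (\<sigma> s x) \<in> M}"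
      then obtain a where "z - sc a (\<sigma> s x) \<in> M"
        by blast
      from subspace_scale[OF subspace_M(1) this, of b] show "sc b z \<in> {z. \<exists>a. z - sc a (\<sigma> s x) \<in> M}"
        by (intro CollectI exI[of _ "b * a"]) (simp add: scale_right_diff_distrib)
    qed
  next
    case (step z)
    then obtain u where "u \<in> I1" "z = \<sigma> u (\<sigma> s x)"
      by (auto simp: orbit_def)
    then show ?case
      using M_base[of u "\<sigma> s x"] by (intro exI[of _ 1]) simp
  qed
  then obtain a where a: "\<sigma> s y - sc a (\<sigma> s x) \<in> M"
    using span_orbit[OF x] by blast
  have "\<sigma> s (\<sigma> s y - sc a (\<sigma> s x)) \<in> M'"
    by (rule M'_s[OF a])
  then show ?thesis
    by (auto simp: linear_simps[OF lin[OF s_K]])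
qed

text \<open>Otherwise the torus-stable space \<open>VI \<inter> M'\<close> contains an eigenvector,
  and \<open>decompose\<close> would put every vector into \<open>M'\<close>.\<close>

lemma VI_M': "y \<in> VI \<Longrightarrow> y \<in> M' \<Longrightarrow> y = 0"
proof (rule ccontr)
  assume y: "y \<in> VI" "y \<in> M'" "y \<noteq> 0"
  have "subspace (VI \<inter> M')"
    using subspace_VI subspace_M(2) by (rule subspace_inter)
  moreover have "\<sigma> t x \<in> VI \<inter> M'" if "t \<in> Tor" "x \<in> VI \<inter> M'" for t x
    using that VI_I M'_Tor by auto
  ultimately obtain x where x: "x \<in> VI \<inter> M'" "x \<noteq> 0" "\<And>t. t \<in> Tor \<Longrightarrow> \<exists>a. \<sigma> t x = sc a x"
    using Tor_eigenvector[of "VI \<inter> M'" y] y by (metis IntI inf_le1)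
  then have "eigen x"
    by (simp add: eigen_def)
  have "z \<in> M'" for z
  proof -
    obtain a where a: "z - sc a x \<in> M'"
      using decompose[OF \<open>eigen x\<close>] by blast
    have "sc a x \<in> M'"
      using x subspace_M(2) by (auto intro: subspace_scale)
    from subspace_add[OF subspace_M(2) a this] show ?thesis
      by simp
  qed
  then show False
    using M'_proper by blast
qed

lemma exists_eigen: "\<exists>x. eigen x"
proof -
  obtain w0 :: 'v where "w0 \<noteq> 0"
    using nontrivial by blast
  then obtain y where y: "y \<noteq> 0" "y \<in> VI"
    using fixed_vector[of UNIV w0] by (auto simp: VI_def)
  have "\<sigma> t x \<in> VI" if "t \<in> Tor" "x \<in> VI" for t x
    using that VI_I by auto
  then obtain x where "x \<in> VI" "x \<noteq> 0" "\<And>t. t \<in> Tor \<Longrightarrow> \<exists>a. \<sigma> t x = sc a x"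
    using Tor_eigenvector[OF subspace_VI order_refl y(2,1)] by metis
  then show ?thesis
    by (auto simp: eigen_def)
qed

abbreviation j where "j \<equiv> j_proj D \<kappa> sc \<sigma>"

lemma VI_invariants: "invariants I1 \<sigma> = VI"
  by (simp add: invariants_def VI_def)

lemma j_eqI: "y \<in> VI \<Longrightarrow> x - y \<in> M' \<Longrightarrow> j x = y"
  unfolding j_proj_def VI_invariants
proof (rule the_equality)
  fix z assume y: "y \<in> VI" "x - y \<in> M'" and z: "z \<in> VI \<and> x - z \<in> M'"
  have "z - y \<in> VI"
    using y z subspace_VI by (auto intro: subspace_diff)
  moreover have "z - y \<in> M'"
    using subspace_diff[OF subspace_M(2), of "x - y" "x - z"] y z by simp
  ultimately show "z = y"
    using VI_M'[of "z - y"] by simp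
qed simp

lemma j_props: "j x \<in> VI" "x - j x \<in> M'"
proof -
  obtain y where y: "eigen y"
    using exists_eigen by blast
  then obtain a where a: "x - sc a y \<in> M'"
    using decompose by blast
  have "sc a y \<in> VI"
    using y subspace_VI by (auto simp: eigen_def intro: subspace_scale)
  with a show "j x \<in> VI" "x - j x \<in> M'"
    using j_eqI[of "sc a y" x] by auto
qed

lemma j_VI: "x \<in> VI \<Longrightarrow> j x = x"
  by (rule j_eqI) (auto simp: subspace_0[OF subspace_M(2)])

lemma j_linear: "Vector_Spaces.linear sc sc j"
proof -
  have "j (x + y) = j x + j y" for x y
    by (rule j_eqI)
      (use subspace_add[OF subspace_VI j_props(1) j_props(1), of x y]
        subspace_add[OF subspace_M(2) j_props(2) j_props(2), of x y] in \<open>auto simp: algebra_simps\<close>)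
  moreover have "j (sc a x) = sc a (j x)" for a x
    by (rule j_eqI)
      (use subspace_scale[OF subspace_VI j_props(1), of a x]
        subspace_scale[OF subspace_M(2) j_props(2), of a x] in \<open>auto simp: scale_right_diff_distrib\<close>)
  ultimately show ?thesis
    using vector_space_axioms by (simp add: Vector_Spaces.linear_iff)
qed

lemma j_I1': "g \<in> I1' \<Longrightarrow> j (\<sigma> g x) = j x"
proof (rule j_eqI)
  assume "g \<in> I1'"
  from subspace_add[OF subspace_M(2) M'_base[OF this, of x] j_props(2)[of x]]
  show "\<sigma> g x - j x \<in> M'"
    by simp
qed (rule j_props)

lemma I1_j: "g \<in> I1 \<Longrightarrow> \<sigma> g (j x) = j x"
  using j_props(1) by (rule VI_D)

lemma j_Tor: "t \<in> Tor \<Longrightarrow> j (\<sigma> t x) = \<sigma> t (j x)"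
proof (rule j_eqI)
  assume t: "t \<in> Tor"
  show "\<sigma> t (j x) \<in> VI"
    using t j_props(1) by (intro VI_I) auto
  show "\<sigma> t x - \<sigma> t (j x) \<in> M'"
    using M'_Tor[OF t j_props(2)[of x]] t by (simp add: linear_simps[OF lin])
qed

end

section \<open>The Hecke operator\<close>

lemma sum_nonzero_single:
  assumes "\<And>C. C \<in> R \<Longrightarrow> t C \<noteq> 0 \<Longrightarrow> C = C0" and "C0 \<in> R"
  shows "(\<Sum>C\<in>{C \<in> R. t C \<noteq> 0}. t C) = t C0"
proof -
  have "(\<Sum>C\<in>{C \<in> R. t C \<noteq> 0}. t C) = (\<Sum>C\<in>{C0}. t C)"
    by (rule sum.mono_neutral_left) (use assms in \<open>blast+\<close>)
  then show ?thesis
    by simp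
qed

context weight_rep
begin

text \<open>The two factorizations differ by an element to which \<open>al_intertwining\<close>
  applies. Its factor in \<open>I1\<close> fixes the image of \<open>j\<close>, the one in
  \<open>I1'\<close> is absorbed by \<open>j\<close>, and the torus commutes with
  \<open>j\<close>.\<close>

lemma Hecke_compatible:
  assumes k: "k1 \<in> K" "k1' \<in> K" "k2 \<in> K" "k2' \<in> K" and eq: "k1 ** al 1 ** k1' = k2 ** al 1 ** k2'"
  shows "\<sigma> k1 (j (\<sigma> k1' x)) = \<sigma> k2 (j (\<sigma> k2' x))"
proof -
  define k where "k = star k2 ** k1"
  have kK: "k \<in> K"
    using k by (simp add: k_def)
  have "k ** al 1 = star k2 ** (k1 ** al 1 ** k1') ** star k1'"
    using k by (simp add: k_def matrix_mul_assoc)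
  also have "\<dots> = al 1 ** (k2' ** star k1')"
    unfolding eq using k by (simp add: matrix_mul_assoc[symmetric])
  finally have "al (- 1) ** (k ** al 1) = al (- 1) ** (al 1 ** (k2' ** star k1'))"
    by simp
  then have e: "al (- 1) ** k ** al 1 = k2' ** star k1'"
    using al_add[of "- 1" 1] by (simp add: matrix_mul_assoc)
  then have "al (- 1) ** k ** al 1 \<in> K"
    using k by simp
  then obtain t u u' where t: "t \<in> Tor" "u \<in> I1" "u' \<in> I1'" "k = t ** u" "k2' ** star k1' = t ** u'"
    using al_intertwining[OF kK] e by metis
  define y where "y = \<sigma> k1' x"
  have "\<sigma> k2' x = \<sigma> ((k2' ** star k1') ** k1') x"
    using k by simp
  also have "\<dots> = \<sigma> t (\<sigma> u' y)"
    using k t I1'_K by (simp only: t(5)) (simp add: \<sigma>_mult y_def)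
  finally have 2: "j (\<sigma> k2' x) = \<sigma> t (j y)"
    using t by (simp add: j_Tor j_I1')
  have "\<sigma> k1 (j y) = \<sigma> (k2 ** k) (j y)"
    using k by (simp add: k_def)
  also have "\<dots> = \<sigma> k2 (\<sigma> t (j y))"
    using k kK t by (simp add: \<sigma>_mult I1_j)
  finally show ?thesis
    by (simp add: 2 y_def)
qed

abbreviation \<phi> where "\<phi> \<equiv> hecke_fun D \<kappa> sc \<sigma>"

text \<open>The explicit candidate for the description in \<open>hecke_fun\<close>; by
  \<open>Hecke_compatible\<close> the chosen factorization does not matter.\<close>

definition phi0 :: "'e mat3 \<Rightarrow> 'v \<Rightarrow> 'v" where
  "phi0 g = (if g \<in> KaK then (let q = SOME q. fst q \<in> K \<and> snd q \<in> K \<and> g = fst q ** al 1 ** snd q in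
      \<sigma> (fst q) \<circ> j \<circ> \<sigma> (snd q)) else (\<lambda>x. 0))"

lemma phi0_val: "k \<in> K \<Longrightarrow> k' \<in> K \<Longrightarrow> phi0 (k ** al 1 ** k') = \<sigma> k \<circ> j \<circ> \<sigma> k'"
proof -
  assume k: "k \<in> K" "k' \<in> K"
  define g where "g = k ** al 1 ** k'"
  define q where "q = (SOME q. fst q \<in> K \<and> snd q \<in> K \<and> g = fst q ** al 1 ** snd q)"
  have q: "fst q \<in> K \<and> snd q \<in> K \<and> g = fst q ** al 1 ** snd q"
    unfolding q_def by (rule someI[of _ "(k, k')"]) (use k in \<open>simp add: g_def\<close>)
  have "g \<in> KaK"
    using k by (auto simp: KaK_iff g_def)
  then have "phi0 g = \<sigma> (fst q) \<circ> j \<circ> \<sigma> (snd q)"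
    unfolding phi0_def q_def Let_def by simp
  also have "\<dots> = \<sigma> k \<circ> j \<circ> \<sigma> k'"
    using Hecke_compatible[of "fst q" "snd q" k k'] q k by (auto simp: g_def fun_eq_iff)
  finally show ?thesis
    by (simp add: g_def)
qed

lemma KaK_mult: "k \<in> K \<Longrightarrow> k' \<in> K \<Longrightarrow> g \<in> KaK \<Longrightarrow> k ** g ** k' \<in> KaK"
proof -
  assume k: "k \<in> K" "k' \<in> K" "g \<in> KaK"
  then obtain h h' where h: "h \<in> K" "h' \<in> K" "g = h ** al 1 ** h'"
    by (auto simp: KaK_iff)
  have "k ** g ** k' = (k ** h) ** al 1 ** (h' ** k')"
    by (simp add: h matrix_mul_assoc)
  then show ?thesis
    using k h unfolding KaK_iff by (metis K_mult)
qed

lemma KaK_mult_iff: "k \<in> K \<Longrightarrow> k' \<in> K \<Longrightarrow> g \<in> G \<Longrightarrow> k ** g ** k' \<in> KaK \<longleftrightarrow> g \<in> KaK"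
  using KaK_mult[of k k' g] KaK_mult[of "star k" "star k'" "k ** g ** k'"]
  by (auto simp: matrix_mul_assoc star_mult_left)

lemma hecke_fun_eq: "\<phi> = phi0"
  unfolding hecke_fun_def
proof (rule the_equality)
  show "(\<forall>g. g \<notin> KaK \<longrightarrow> phi0 g = (\<lambda>x. 0)) \<and>
    (\<forall>k\<in>K. \<forall>g\<in>G. \<forall>k'\<in>K. phi0 (k ** g ** k') = \<sigma> k \<circ> phi0 g \<circ> \<sigma> k') \<and> phi0 (alpha D) = j"
  proof (intro conjI allI ballI impI)
    fix k g k' assume k: "k \<in> K" "g \<in> G" "k' \<in> K"
    show "phi0 (k ** g ** k') = \<sigma> k \<circ> phi0 g \<circ> \<sigma> k'"
    proof (cases "g \<in> KaK")
      case True
      then obtain h h' where h: "h \<in> K" "h' \<in> K" "g = h ** al 1 ** h'"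
        by (auto simp: KaK_iff)
      have "k ** g ** k' = (k ** h) ** al 1 ** (h' ** k')"
        by (simp add: h matrix_mul_assoc)
      then have "phi0 (k ** g ** k') = \<sigma> (k ** h) \<circ> j \<circ> \<sigma> (h' ** k')"
        using k h by (simp only: phi0_val K_mult)
      then show ?thesis
        using k h by (simp add: h(3) phi0_val \<sigma>_mult fun_eq_iff)
    next
      case False
      then show ?thesis
        using k KaK_mult_iff[of k k' g] by (simp add: phi0_def fun_eq_iff linear_simps[OF lin])
    qed
  next
    show "phi0 (alpha D) = j"
      using phi0_val[of "mat 1" "mat 1"] by (simp add: alpha_al fun_eq_iff)
  qed (simp add: phi0_def)
next
  fix \<psi> assume \<psi>: "(\<forall>g. g \<notin> KaK \<longrightarrow> \<psi> g = (\<lambda>x. 0)) \<and>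
    (\<forall>k\<in>K. \<forall>g\<in>G. \<forall>k'\<in>K. \<psi> (k ** g ** k') = \<sigma> k \<circ> \<psi> g \<circ> \<sigma> k') \<and> \<psi> (alpha D) = j"
  show "\<psi> = phi0"
  proof
    fix g
    show "\<psi> g = phi0 g"
    proof (cases "g \<in> KaK")
      case True
      then obtain h h' where h: "h \<in> K" "h' \<in> K" "g = h ** al 1 ** h'"
        by (auto simp: KaK_iff)
      then show ?thesis
        using \<psi> by (simp add: phi0_val alpha_al)
    next
      case False
      then show ?thesis
        using \<psi> by (simp add: phi0_def)
    qed
  qed
qed

lemma phi_outside: "g \<notin> KaK \<Longrightarrow> \<phi> g x = 0"
  by (simp add: hecke_fun_eq phi0_def)

lemma phi_val: "k \<in> K \<Longrightarrow> k' \<in> K \<Longrightarrow> \<phi> (k ** al 1 ** k') x = \<sigma> k (j (\<sigma> k' x))"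
  by (simp add: hecke_fun_eq phi0_val)

lemma phi_al: "\<phi> (al 1) x = j x" "\<phi> (al (- 1)) x = \<sigma> s (j (\<sigma> s x))"
  using phi_val[of "mat 1" "mat 1" x] phi_val[of s s x] by (simp_all add: s_al_s)

lemma phi_equivariant:
  assumes "k \<in> K" "k' \<in> K" "g \<in> G"
  shows "\<phi> (k ** g ** k') x = \<sigma> k (\<phi> g (\<sigma> k' x))"
proof (cases "g \<in> KaK")
  case True
  then obtain h h' where h: "h \<in> K" "h' \<in> K" "g = h ** al 1 ** h'"
    by (auto simp: KaK_iff)
  have e: "k ** g ** k' = (k ** h) ** al 1 ** (h' ** k')"
    by (simp add: h matrix_mul_assoc)
  have "\<phi> (k ** g ** k') x = \<sigma> (k ** h) (j (\<sigma> (h' ** k') x))"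
    unfolding e using assms h by (intro phi_val) simp_all
  then show ?thesis
    using assms h phi_val[of h h' "\<sigma> k' x"] by (simp add: \<sigma>_mult h(3))
next
  case False
  then show ?thesis
    using assms KaK_mult_iff[of k k' g] by (simp add: phi_outside linear_simps[OF lin])
qed

lemma phi_zero [simp]: "\<phi> g 0 = 0"
proof (cases "g \<in> KaK")
  case True
  then show ?thesis
    by (auto simp: KaK_iff phi_val linear_simps[OF lin] linear_simps[OF j_linear])
qed (simp add: phi_outside)

subsection \<open>Functions supported on finitely many cosets\<close>

text \<open>\<open>g ** star y \<in> K\<close> expresses that \<open>g\<close> lies in the coset
  \<open>K y\<close>; cosets are handled in this form from here on.\<close>

definition supported_by :: "'e mat3 set \<Rightarrow> ('e mat3 \<Rightarrow> 'v) \<Rightarrow> bool" where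
  "supported_by S f \<longleftrightarrow> (\<forall>g\<in>G. f g \<noteq> 0 \<longrightarrow> (\<exists>y\<in>S. g ** star y \<in> K))"

text \<open>A concrete substitute for the compact induction, in which supports are finite data that
  the Hecke operator visibly preserves.\<close>

definition Fin :: "('e mat3 \<Rightarrow> 'v) set" where
  "Fin = {f. (\<forall>g. g \<notin> G \<longrightarrow> f g = 0) \<and> (\<forall>k\<in>K. \<forall>g\<in>G. f (k ** g) = \<sigma> k (f g)) \<and>
     (\<exists>S. finite S \<and> S \<subseteq> G \<and> supported_by S f)}"

lemma Fin_D:
  assumes "f \<in> Fin"
  shows "g \<notin> G \<Longrightarrow> f g = 0" "k \<in> K \<Longrightarrow> g \<in> G \<Longrightarrow> f (k ** g) = \<sigma> k (f g)"
  using assms by (auto simp: Fin_def)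

lemma Fin_coset: "f \<in> Fin \<Longrightarrow> g \<in> G \<Longrightarrow> y \<in> G \<Longrightarrow> g ** star y \<in> K \<Longrightarrow> f g = \<sigma> (g ** star y) (f y)"
  using Fin_D(2)[of f "g ** star y" y] by simp

lemma Fin_comp_ind: "f \<in> Fin \<Longrightarrow> f \<in> comp_ind D \<kappa> \<sigma>"
proof -
  assume f: "f \<in> Fin"
  obtain m where m: "1 \<le> m" "\<And>g x. g \<in> Gs 2 c m \<Longrightarrow> \<sigma> g x = x"
    using smooth_level by blast
  have mK: "g \<in> Gs 2 c m \<Longrightarrow> g \<in> K" for g
    using Gs_K[of m g] m by simp
  obtain S where S: "finite S" "S \<subseteq> G" "supported_by S f"
    using f by (auto simp: Fin_def)
  let ?A = "{g \<in> G. f g \<noteq> 0}"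
  have "\<exists>U. openin X U \<and> g \<in> U \<and> (\<forall>h\<in>U. f h = f g)" if g: "g \<in> G" for g
  proof (intro exI conjI)
    show "openin X {h \<in> G. h ** star g \<in> Gs 2 c m}"
    proof (rule openin_stable)
      show "l ** h \<in> {h \<in> G. h ** star g \<in> Gs 2 c m}"
        if "l \<in> Gs 2 c m" "h \<in> {h \<in> G. h ** star g \<in> Gs 2 c m}" for l h
        using that mK[of l] m Gs_mult[of 2 m l c "h ** star g"] by (simp add: matrix_mul_assoc)
    qed auto
    show "g \<in> {h \<in> G. h ** star g \<in> Gs 2 c m}"
      using g by (simp add: star_mult_right Gs_one)
    show "\<forall>h\<in>{h \<in> G. h ** star g \<in> Gs 2 c m}. f h = f g"
      using Fin_coset[OF f _ g] mK m by auto
  qed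
  moreover have "compactin X (X closure_of ?A)"
  proof -
    have "openin X (G - ?A)"
    proof (rule openin_stable)
      show "l ** h \<in> G - ?A" if "l \<in> Gs 2 c m" "h \<in> G - ?A" for l h
        using that mK[of l] Fin_D(2)[OF f, of l h] by (auto simp: linear_simps[OF lin])
    qed auto
    moreover have "topspace X = G"
    proof -
      have "openin (mat_topology D) UNIV"
        by (auto simp: openin_mat)
      then have "topspace (mat_topology D) = UNIV"
        using openin_subset by blast
      then show ?thesis
        by simp
    qed
    ultimately have closed: "closedin X ?A"
      by (auto simp: closedin_def)
    have "compactin X (\<Union>y\<in>S. (\<lambda>k. k ** y) ` K)"
      using S compactin_K_coset by (intro compactin_Union) auto
    moreover have "?A \<subseteq> (\<Union>y\<in>S. (\<lambda>k. k ** y) ` K)"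
    proof
      fix g assume "g \<in> ?A"
      then obtain y where "y \<in> S" "g ** star y \<in> K"
        using S(3) by (auto simp: supported_by_def)
      then show "g \<in> (\<Union>y\<in>S. (\<lambda>k. k ** y) ` K)"
        using S(2) by (intro UN_I[of y] image_eqI[of _ _ "g ** star y"]) (auto simp: subset_iff)
    qed
    ultimately have "compactin X ?A"
      using closed closed_compactin by blast
    then show ?thesis
      using closed by (simp add: closure_of_closedin)
  qed
  ultimately show ?thesis
    using f by (auto simp: comp_ind_def Let_def Fin_def)
qed

lemma Fin_zero: "(\<lambda>g. 0) \<in> Fin"
  by (auto simp: Fin_def supported_by_def linear_simps[OF lin] intro!: exI[of _ "{}"])

lemma Fin_add: "f \<in> Fin \<Longrightarrow> f' \<in> Fin \<Longrightarrow> (\<lambda>g. f g + f' g) \<in> Fin"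
proof -
  assume f: "f \<in> Fin" "f' \<in> Fin"
  obtain S S' where S: "finite S" "S \<subseteq> G" "supported_by S f" "finite S'" "S' \<subseteq> G" "supported_by S' f'"
    using f by (auto simp: Fin_def)
  have "supported_by (S \<union> S') (\<lambda>g. f g + f' g)"
    unfolding supported_by_def
  proof safe
    fix g assume g: "g \<in> G" "f g + f' g \<noteq> 0"
    then have "f g \<noteq> 0 \<or> f' g \<noteq> 0"
      by auto
    then show "\<exists>y\<in>S \<union> S'. g ** star y \<in> K"
      using S(3,6) g(1) by (auto simp: supported_by_def)
  qed
  then show ?thesis
    using f S by (auto simp: Fin_def linear_simps[OF lin] intro!: exI[of _ "S \<union> S'"])
qed

lemma Fin_scale: "f \<in> Fin \<Longrightarrow> (\<lambda>g. sc a (f g)) \<in> Fin"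
proof -
  assume f: "f \<in> Fin"
  obtain S where S: "finite S" "S \<subseteq> G" "supported_by S f"
    using f by (auto simp: Fin_def)
  have "supported_by S (\<lambda>g. sc a (f g))"
    using S(3) by (auto simp: supported_by_def)
  then show ?thesis
    using f S by (auto simp: Fin_def linear_simps[OF lin])
qed

lemma Fin_diff: "f \<in> Fin \<Longrightarrow> f' \<in> Fin \<Longrightarrow> (\<lambda>g. f g - f' g) \<in> Fin"
  using Fin_add[of f "\<lambda>g. sc (- 1) (f' g)"] Fin_scale[of f' "- 1"] by simp

lemma Fin_sum: "finite A \<Longrightarrow> (\<And>a. a \<in> A \<Longrightarrow> F a \<in> Fin) \<Longrightarrow> (\<lambda>g. \<Sum>a\<in>A. F a g) \<in> Fin"
  by (induction A rule: finite_induct) (auto intro: Fin_zero Fin_add)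

lemma Fin_restrict:
  assumes f: "f \<in> Fin" and B: "\<And>k g. k \<in> K \<Longrightarrow> g \<in> G \<Longrightarrow> k ** g \<in> B \<longleftrightarrow> g \<in> B"
  shows "(\<lambda>g. if g \<in> B then f g else 0) \<in> Fin"
proof -
  obtain S where S: "finite S" "S \<subseteq> G" "supported_by S f"
    using f by (auto simp: Fin_def)
  have "supported_by S (\<lambda>g. if g \<in> B then f g else 0)"
    using S(3) by (auto simp: supported_by_def)
  then show ?thesis
    using f S B by (auto simp: Fin_def linear_simps[OF lin])
qed

definition delta :: "'e mat3 \<Rightarrow> 'v \<Rightarrow> 'e mat3 \<Rightarrow> 'v" where
  "delta y x g = (if g \<in> G \<and> g ** star y \<in> K then \<sigma> (g ** star y) x else 0)"

lemma delta_Fin: "y \<in> G \<Longrightarrow> delta y x \<in> Fin"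
proof -
  assume y: "y \<in> G"
  have "supported_by {y} (delta y x)"
    by (auto simp: supported_by_def delta_def split: if_splits)
  moreover have "delta y x (k ** g) = \<sigma> k (delta y x g)" if "k \<in> K" "g \<in> G" for k g
  proof -
    have "k ** g ** star y \<in> K \<longleftrightarrow> g ** star y \<in> K"
      using that y K_cancel_left[of k "g ** star y"] by (simp add: matrix_mul_assoc)
    then show ?thesis
      using that by (auto simp: delta_def linear_simps[OF lin] \<sigma>_mult[symmetric] matrix_mul_assoc)
  qed
  ultimately show ?thesis
    using y by (auto simp: Fin_def delta_def intro!: exI[of _ "{y}"])
qed

lemma delta_self: "y \<in> G \<Longrightarrow> delta y x y = x"
  by (simp add: delta_def star_mult_right)

subsection \<open>Evaluation of the Hecke operator\<close>

abbreviation T where "T \<equiv> hecke_op D \<kappa> sc \<sigma>"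

lemma rcoset_eq: "K #>\<^bsub>U21 D\<^esub> y = (\<lambda>k. k ** y) ` K"
  by (auto simp: r_coset_def)

lemma rcoset_cases: "C \<in> rcosets\<^bsub>U21 D\<^esub> K \<Longrightarrow> \<exists>y\<in>G. C = (\<lambda>k. k ** y) ` K"
  by (auto simp: RCOSETS_def rcoset_eq)

lemma rcoset_mem: "y \<in> G \<Longrightarrow> (\<lambda>k. k ** y) ` K \<in> rcosets\<^bsub>U21 D\<^esub> K"
  by (auto simp: RCOSETS_def rcoset_eq)

lemma hecke_term_eq:
  assumes f: "f \<in> Fin" and g: "g \<in> G" and y: "y \<in> G"
  shows "hecke_term D \<kappa> sc \<sigma> f g ((\<lambda>k. k ** y) ` K) = \<phi> (g ** star y) (f y)"
proof -
  define y' where "y' = (SOME y'. y' \<in> (\<lambda>k. k ** y) ` K)"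
  have "y' \<in> (\<lambda>k. k ** y) ` K"
    unfolding y'_def by (rule someI[of _ "mat 1 ** y"]) (use K_one in blast)
  then obtain k where k: "k \<in> K" "y' = k ** y"
    by blast
  have "\<phi> (g ** star y') (f y') = \<phi> (mat 1 ** (g ** star y) ** star k) (\<sigma> k (f y))"
    using k y f by (simp add: star_mult matrix_mul_assoc Fin_D(2))
  also have "\<dots> = \<phi> (g ** star y) (f y)"
    using k y g by (simp only: phi_equivariant K_one K_star mult_G star_G \<sigma>_star \<sigma>_one)
  finally show ?thesis
    using k y by (simp add: hecke_term_def Let_def y'_def[symmetric])
qed

lemma T_outside: "f \<in> Fin \<Longrightarrow> g \<notin> G \<Longrightarrow> T f g = 0"
proof -
  assume g: "g \<notin> G"
  have "hecke_term D \<kappa> sc \<sigma> f g C = 0" if C: "C \<in> rcosets\<^bsub>U21 D\<^esub> K" for C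
  proof -
    obtain y where y: "y \<in> G" "C = (\<lambda>k. k ** y) ` K"
      using rcoset_cases[OF C] by blast
    define y' where "y' = (SOME y'. y' \<in> C)"
    have "y' \<in> C"
      unfolding y'_def by (rule someI[of _ "mat 1 ** y"]) (use K_one y in blast)
    then have y': "y' \<in> G"
      using y by auto
    have "g ** star y' \<notin> KaK"
    proof
      assume "g ** star y' \<in> KaK"
      then have "(g ** star y') ** y' \<in> G"
        using y' KaK_G mult_G by blast
      then show False
        using y' g by simp
    qed
    then show ?thesis
      using y' by (simp add: hecke_term_def Let_def y'_def[symmetric] phi_outside)
  qed
  then show ?thesis
    by (simp add: hecke_op_def sum.neutral)
qed

lemma T_equivariant:
  assumes f: "f \<in> Fin" and k: "k \<in> K" and g: "g \<in> G"
  shows "T f (k ** g) = \<sigma> k (T f g)"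
proof -
  have e: "hecke_term D \<kappa> sc \<sigma> f (k ** g) C = \<sigma> k (hecke_term D \<kappa> sc \<sigma> f g C)"
    if C: "C \<in> rcosets\<^bsub>U21 D\<^esub> K" for C
  proof -
    obtain y where y: "y \<in> G" "C = (\<lambda>k. k ** y) ` K"
      using rcoset_cases[OF C] by blast
    have "\<phi> (k ** (g ** star y) ** mat 1) (f y) = \<sigma> k (\<phi> (g ** star y) (\<sigma> (mat 1) (f y)))"
      using k g y by (intro phi_equivariant) auto
    then show ?thesis
      using f k g y by (simp add: hecke_term_eq matrix_mul_assoc)
  qed
  have nz: "\<sigma> k x = 0 \<longleftrightarrow> x = 0" for x
    using k by (metis \<sigma>_star(1) lin linear_simps(3))
  have "{C \<in> rcosets\<^bsub>U21 D\<^esub> K. hecke_term D \<kappa> sc \<sigma> f (k ** g) C \<noteq> 0} =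
      {C \<in> rcosets\<^bsub>U21 D\<^esub> K. hecke_term D \<kappa> sc \<sigma> f g C \<noteq> 0}"
    using e nz by auto
  then show ?thesis
    unfolding hecke_op_def using k by (simp add: linear_simps[OF lin] e)
qed

lemma T_support:
  assumes f: "f \<in> Fin" and g: "g \<in> G" "T f g \<noteq> 0"
  obtains y where "y \<in> G" "f y \<noteq> 0" "g ** star y \<in> KaK"
proof -
  have "\<exists>C\<in>rcosets\<^bsub>U21 D\<^esub> K. hecke_term D \<kappa> sc \<sigma> f g C \<noteq> 0"
    using g(2) unfolding hecke_op_def by (metis (no_types, lifting) mem_Collect_eq sum.neutral)
  then obtain C where C: "C \<in> rcosets\<^bsub>U21 D\<^esub> K" "hecke_term D \<kappa> sc \<sigma> f g C \<noteq> 0"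
    by blast
  obtain y where y: "y \<in> G" "C = (\<lambda>k. k ** y) ` K"
    using rcoset_cases[OF C(1)] by blast
  then have "\<phi> (g ** star y) (f y) \<noteq> 0"
    using C f g by (simp add: hecke_term_eq)
  then show ?thesis
    using that[OF y(1)] phi_outside by fastforce
qed

lemma T_single:
  assumes f: "f \<in> Fin" and g: "g \<in> G" and y0: "y0 \<in> G"
    and unique: "\<And>y. y \<in> G \<Longrightarrow> f y \<noteq> 0 \<Longrightarrow> g ** star y \<in> KaK \<Longrightarrow> \<exists>k\<in>K. y = k ** y0"
  shows "T f g = \<phi> (g ** star y0) (f y0)"
proof -
  let ?t = "hecke_term D \<kappa> sc \<sigma> f g" and ?C0 = "(\<lambda>k. k ** y0) ` K"
  have "C = ?C0" if C: "C \<in> rcosets\<^bsub>U21 D\<^esub> K" "?t C \<noteq> 0" for C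
  proof -
    obtain y where y: "y \<in> G" "C = (\<lambda>k. k ** y) ` K"
      using rcoset_cases[OF C(1)] by blast
    then have nz: "\<phi> (g ** star y) (f y) \<noteq> 0"
      using C f g by (simp add: hecke_term_eq)
    then have "f y \<noteq> 0" "g ** star y \<in> KaK"
      using phi_outside[of "g ** star y" "f y"] by auto
    then obtain k where k: "k \<in> K" "y = k ** y0"
      using unique y(1) by blast
    have "h ** y \<in> ?C0" if "h \<in> K" for h
      using that k by (intro image_eqI[of _ _ "h ** k"]) (auto simp: matrix_mul_assoc)
    moreover have "h ** y0 \<in> C" if "h \<in> K" for h
      unfolding y(2) using that k by (intro image_eqI[of _ _ "h ** star k"]) (auto simp: matrix_mul_assoc)
    ultimately show ?thesis
      using y by auto
  qed
  then have "T f g = ?t ?C0"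
    unfolding hecke_op_def by (intro sum_nonzero_single rcoset_mem[OF y0])
  then show ?thesis
    using f g y0 by (simp add: hecke_term_eq)
qed

lemma KaK_finite_cosets:
  obtains F where "finite F" "F \<subseteq> K" "\<And>k. k \<in> K \<Longrightarrow> \<exists>f\<in>F. al 1 ** k ** star (al 1 ** f) \<in> K"
proof -
  \<comment> \<open>Level 4 puts the entry (1,3) into \<open>Q 2 (4 - 2 * c) = P (2 - c)\<close>,
    the hypothesis of \<open>al_K_al_inverse\<close>.\<close>
  obtain F where F: "finite F" "F \<subseteq> K" "\<And>k. k \<in> K \<Longrightarrow> \<exists>f\<in>F. k ** star f \<in> Gs 2 c 4"
    using Gs_finite_index[of K 4] by auto
  have "\<exists>f\<in>F. al 1 ** k ** star (al 1 ** f) \<in> K" if k: "k \<in> K" for k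
  proof -
    obtain f where f: "f \<in> F" "k ** star f \<in> Gs 2 c 4"
      using F k by blast
    have "(k ** star f)$1$3 \<in> P (2 - c)"
      using f(2) by (rule_tac disjE[OF c_cases]) (auto simp: Gs_def Sh_iff Q_P)
    then have "al 1 ** (k ** star f) ** al (- 1) \<in> K"
      using f(2) by (intro al_K_al_inverse Gs_K[of 4]) auto
    then show ?thesis
      using f(1) by (intro bexI[of _ f]) (simp_all add: star_mult matrix_mul_assoc)
  qed
  then show ?thesis
    using that F by blast
qed

lemma T_Fin: "f \<in> Fin \<Longrightarrow> T f \<in> Fin"
proof -
  assume f: "f \<in> Fin"
  obtain S where S: "finite S" "S \<subseteq> G" "supported_by S f"
    using f by (auto simp: Fin_def)
  obtain F where F: "finite F" "F \<subseteq> K" "\<And>k. k \<in> K \<Longrightarrow> \<exists>f\<in>F. al 1 ** k ** star (al 1 ** f) \<in> K"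
    using KaK_finite_cosets by metis
  define S' where "S' = (\<lambda>(h, y). al 1 ** h ** y) ` (F \<times> S)"
  have "supported_by S' (T f)"
    unfolding supported_by_def
  proof safe
    fix g assume g: "g \<in> G" "T f g \<noteq> 0"
    then obtain z where z: "z \<in> G" "f z \<noteq> 0" "g ** star z \<in> KaK"
      using T_support[OF f] by blast
    then obtain y where y: "y \<in> S" "z ** star y \<in> K"
      using S(3) by (auto simp: supported_by_def)
    have yG: "y \<in> G"
      using y S by auto
    obtain k k' where k: "k \<in> K" "k' \<in> K" "g ** star z = k ** al 1 ** k'"
      using z by (auto simp: KaK_iff)
    define k2 where "k2 = k' ** (z ** star y)"
    have k2: "k2 \<in> K"
      using k y by (simp add: k2_def)
    have "g = g ** star z ** z"
      using z by simp
    also have "\<dots> = k ** al 1 ** k' ** (z ** star y ** y)"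
      using yG by (simp add: k(3))
    also have "\<dots> = k ** (al 1 ** k2) ** y"
      by (simp add: k2_def matrix_mul_assoc)
    finally have g': "g = k ** (al 1 ** k2) ** y" .
    obtain h where h: "h \<in> F" "al 1 ** k2 ** star (al 1 ** h) \<in> K"
      using F k2 by blast
    have "g ** star (al 1 ** h ** y) = k ** (al 1 ** k2 ** star (al 1 ** h))"
      using yG unfolding g' by (simp add: star_mult matrix_mul_assoc)
    then have "g ** star (al 1 ** h ** y) \<in> K"
      using k h by simp
    then show "\<exists>y\<in>S'. g ** star y \<in> K"
      using h(1) y(1) by (auto simp: S'_def)
  qed
  moreover have "finite S'" "S' \<subseteq> G"
    using F S by (auto simp: S'_def subset_iff)
  ultimately show ?thesis
    using T_outside[OF f] T_equivariant[OF f] by (auto simp: Fin_def)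
qed

end

section \<open>Descent to the half-trees\<close>

context weight_rep
begin

definition restr :: "('e mat3 \<Rightarrow> 'v) \<Rightarrow> 'e mat3 \<Rightarrow> 'e mat3 \<Rightarrow> 'v" where
  "restr f y = (\<lambda>g. if g ** star y \<in> K then f g else 0)"

lemma restr_Fin: "f \<in> Fin \<Longrightarrow> y \<in> G \<Longrightarrow> restr f y \<in> Fin"
proof -
  assume f: "f \<in> Fin" and y: "y \<in> G"
  have "k ** g \<in> {g. g ** star y \<in> K} \<longleftrightarrow> g \<in> {g. g ** star y \<in> K}" if "k \<in> K" "g \<in> G" for k g
    using that y K_cancel_left[of k "g ** star y"] by (simp add: matrix_mul_assoc)
  from Fin_restrict[OF f this] show ?thesis
    by (simp add: restr_def)
qed

lemma coset_double_coset:
  assumes "y = k ** al n ** i" "k \<in> K" "i \<in> I" "g ** star y \<in> K"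
  shows "g \<in> double_coset D \<kappa> n I"
proof -
  have "y \<in> G"
    using assms by simp
  then have "g = ((g ** star y) ** k) ** al n ** i"
    using cancel_right(2)[of y g] by (simp add: assms(1) matrix_mul_assoc)
  moreover have "(g ** star y) ** k \<in> K"
    using assms by simp
  ultimately show ?thesis
    using assms(3) unfolding double_coset_def alpha_pow by blast
qed

lemma R_minus_restr:
  assumes "f \<in> Fin" "y = k ** al n ** i" "k \<in> K" "i \<in> I" "n \<le> - 1"
  shows "restr f y \<in> R_minus D \<kappa> \<sigma> (nat (- n - 1))"
proof -
  have "restr f y g = 0" if "g \<notin> double_coset D \<kappa> n I" for g
    using coset_double_coset[OF assms(2-4)] that by (auto simp: restr_def)
  moreover have "restr f y \<in> comp_ind D \<kappa> \<sigma>"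
    using assms by (intro Fin_comp_ind restr_Fin) auto
  moreover have "- (int (nat (- n - 1)) + 1) = n"
    using assms(5) by simp
  ultimately show ?thesis
    by (simp add: R_minus_def)
qed

lemma R_plus_restr:
  assumes "f \<in> Fin" "y = k ** al n ** i" "k \<in> K" "i \<in> I" "0 \<le> n"
  shows "restr f y \<in> R_plus D \<kappa> \<sigma> (nat n)"
proof -
  have "restr f y g = 0" if "g \<notin> double_coset D \<kappa> n I" for g
    using coset_double_coset[OF assms(2-4)] that by (auto simp: restr_def)
  moreover have "restr f y \<in> comp_ind D \<kappa> \<sigma>"
    using assms by (intro Fin_comp_ind restr_Fin) auto
  ultimately show ?thesis
    using assms(5) by (simp add: R_plus_def)
qed

text \<open>\<open>f\<close> is cut into its restrictions to single cosets. The condition on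
  \<open>R\<close> is asked only where \<open>f\<close> does not vanish, which is where the support
  bounds give information; \<open>R\<close> stays abstract to serve both halves.\<close>

lemma Fin_span:
  fixes s' :: "'c \<Rightarrow> 'w::ab_group_add \<Rightarrow> 'w" and \<iota> :: "('e mat3 \<Rightarrow> 'v) \<Rightarrow> 'w"
  assumes vs: "vector_space s'"
    and add: "\<And>f f'. f \<in> Fin \<Longrightarrow> f' \<in> Fin \<Longrightarrow> \<iota> (\<lambda>g. f g + f' g) = \<iota> f + \<iota> f'"
    and scale: "\<And>a f. f \<in> Fin \<Longrightarrow> \<iota> (\<lambda>g. sc a (f g)) = s' a (\<iota> f)"
    and f: "f \<in> Fin" and R: "\<And>y. y \<in> G \<Longrightarrow> f y \<noteq> 0 \<Longrightarrow> \<exists>n. restr f y \<in> R n"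
  shows "\<iota> f \<in> module.span s' (\<Union>n. \<iota> ` R n)"
proof -
  interpret W: vector_space s'
    by (rule vs)
  obtain S where "finite S" "S \<subseteq> G" "supported_by S f"
    using f by (auto simp: Fin_def)
  then show ?thesis
    using f R
  proof (induction S arbitrary: f rule: finite_induct)
    case empty
    then have "f g = 0" for g
      using Fin_D(1)[of f g] by (auto simp: supported_by_def)
    then have "f = (\<lambda>g. sc 0 (f g))"
      by auto
    then have "\<iota> f = s' 0 (\<iota> f)"
      using scale[OF empty.prems(3), of 0] by simp
    then show ?case
      using W.span_zero by simp
  next
    case (insert y S)
    have y: "y \<in> G"
      using insert.prems by simp
    define f' where "f' g = f g - restr f y g" for g
    have f'_eq: "f' g = (if g ** star y \<in> K then 0 else f g)" for g
      by (simp add: f'_def restr_def)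
    have f': "f' \<in> Fin"
      unfolding f'_def by (intro Fin_diff restr_Fin insert.prems y)
    have "\<iota> f' \<in> W.span (\<Union>n. \<iota> ` R n)"
    proof (rule insert.IH)
      show "supported_by S f'"
        using insert.prems(2) by (auto simp: supported_by_def f'_eq)
      show "\<exists>n. restr f' z \<in> R n" if z: "z \<in> G" "f' z \<noteq> 0" for z
      proof -
        have zy: "z ** star y \<notin> K" "f z \<noteq> 0"
          using z(2) by (auto simp: f'_eq split: if_splits)
        have "restr f' z = restr f z"
        proof
          fix g
          show "restr f' z g = restr f z g"
          proof (cases "g ** star z \<in> K \<and> g ** star y \<in> K")
            case True
            then have "star (g ** star z) ** (g ** star y) \<in> K"
              using K_mult[of "star (g ** star z)" "g ** star y"] K_star[of "g ** star z"] by blast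
            moreover have "g \<in> G"
            proof -
              have "g ** star z ** z \<in> G"
                using True z(1) mult_G[of "g ** star z" z] K_G by blast
              then show ?thesis
                using z(1) by simp
            qed
            then have "star (g ** star z) ** (g ** star y) = z ** star y"
              by (simp add: star_mult matrix_mul_assoc[symmetric])
            ultimately show ?thesis
              using zy by simp
          qed (auto simp: restr_def f'_eq)
        qed
        then show ?thesis
          using insert.prems(4)[OF z(1) zy(2)] by simp
      qed
    qed (use f' insert.prems in auto)
    moreover have "\<iota> (restr f y) \<in> W.span (\<Union>n. \<iota> ` R n)"
    proof (cases "f y = 0")
      case True
      have "restr f y g = 0" for g
      proof (cases "g \<in> G \<and> g ** star y \<in> K")
        case True
        then show ?thesis
          using Fin_coset[OF insert.prems(3) _ y, of g] \<open>f y = 0\<close> by (simp add: restr_def linear_simps[OF lin])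
      qed (use Fin_D(1)[OF insert.prems(3)] in \<open>auto simp: restr_def\<close>)
      then have "restr f y = (\<lambda>g. sc 0 (restr f y g))"
        by auto
      then have "\<iota> (restr f y) = s' 0 (\<iota> (restr f y))"
        using scale[OF restr_Fin[OF insert.prems(3) y], of 0] by simp
      then show ?thesis
        using W.span_zero by simp
    next
      case False
      then show ?thesis
        using insert.prems(4)[OF y] by (blast intro: W.span_base)
    qed
    moreover have "\<iota> f = \<iota> f' + \<iota> (restr f y)"
      using add[OF f' restr_Fin[OF insert.prems(3) y]] by (simp add: f'_def)
    ultimately show ?case
      by (simp add: W.span_add)
  qed
qed

lemma poly_op_Fin: "h \<in> Fin \<Longrightarrow> poly_op sc Pl T h \<in> Fin"
proof -
  assume h: "h \<in> Fin"
  have "(T ^^ i) h \<in> Fin" for i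
    by (induction i) (use h T_Fin in auto)
  then have "(\<lambda>g. \<Sum>i\<in>{..degree Pl}. sc (coeff Pl i) ((T ^^ i) h g)) \<in> Fin"
    by (intro Fin_sum Fin_scale) auto
  moreover have "poly_op sc Pl T h = (\<lambda>g. \<Sum>i\<in>{..degree Pl}. sc (coeff Pl i) ((T ^^ i) h g))"
    by (auto simp: poly_op_def)
  ultimately show ?thesis
    by simp
qed

lemma poly_op_top:
  assumes "\<And>i. i < degree Pl \<Longrightarrow> (T ^^ i) h g = 0"
  shows "poly_op sc Pl T h g = sc (lead_coeff Pl) ((T ^^ degree Pl) h g)"
proof -
  have "poly_op sc Pl T h g = (\<Sum>i\<in>{degree Pl}. sc (coeff Pl i) ((T ^^ i) h g))"
    unfolding poly_op_def by (rule sum.mono_neutral_right) (use assms in auto)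
  then show ?thesis
    by simp
qed

lemma delta_support: "delta y x g \<noteq> 0 \<Longrightarrow> g \<in> G \<and> (\<exists>k\<in>K. g = k ** y)" if "y \<in> G"
  using that by (auto simp: delta_def split: if_splits intro!: bexI[of _ "g ** star y"])

text \<open>Each step lowers the column bound by one. At \<open>al (int i - int d)\<close> the bound
  is attained, so by \<open>neighbour_up_C1\<close> a single coset contributes to the next value
  there, and \<open>j\<close> fixes \<open>v0\<close>.\<close>

lemma iterate_C1:
  assumes v0: "v0 \<in> VI" and i: "i \<le> d"
  defines "H \<equiv> (T ^^ i) (delta (al (- int d)) v0)"
  shows "H \<in> Fin \<and> (\<forall>g\<in>G. H g \<noteq> 0 \<longrightarrow> C1 (int d - int i) g) \<and> H (al (int i - int d)) = v0"
  using i unfolding H_def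
proof (induction i)
  case 0
  have "C1 (int d) g" if "delta (al (- int d)) v0 g \<noteq> 0" for g
    using delta_support[OF al_G that] by (auto simp: C1_K_iff)
  then show ?case
    by (simp add: delta_Fin delta_self)
next
  case (Suc i)
  define F where "F = (T ^^ i) (delta (al (- int d)) v0)"
  define m where "m = int d - int i - 1"
  have F: "F \<in> Fin" "\<And>g. g \<in> G \<Longrightarrow> F g \<noteq> 0 \<Longrightarrow> C1 (m + 1) g" "F (al (- m - 1)) = v0"
    using Suc by (auto simp: F_def m_def)
  have "C1 m g" if g: "g \<in> G" "T F g \<noteq> 0" for g
  proof -
    obtain y where y: "y \<in> G" "F y \<noteq> 0" "g ** star y \<in> KaK"
      using T_support[OF F(1) g] by blast
    then show ?thesis
      using C1_neighbour[of y g "m + 1"] F(2) g by simp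
  qed
  moreover have "T F (al (- m)) = v0"
  proof -
    have "T F (al (- m)) = \<phi> (al (- m) ** star (al (- m - 1))) (F (al (- m - 1)))"
    proof (rule T_single[OF F(1)])
      show "\<exists>k\<in>K. y = k ** al (- m - 1)" if y: "y \<in> G" "F y \<noteq> 0" "al (- m) ** star y \<in> KaK" for y
        using neighbour_up_C1[OF y(1,3) F(2)[OF y(1,2)]] by blast
    qed auto
    also have "\<dots> = j v0"
      by (simp add: F(3) al_add phi_al)
    finally show ?thesis
      using v0 by (simp add: j_VI)
  qed
  moreover have "al (1 + int i - int d) = al (- m)"
    by (rule arg_cong[of _ _ al]) (simp add: m_def)
  moreover have "int d - int (Suc i) = m"
    by (simp add: m_def)
  ultimately show ?case
    using T_Fin[OF F(1)] by (simp add: F_def)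
qed

text \<open>As for \<open>iterate_C1\<close>, with \<open>\<phi> (al (- 1))\<close> being the
  conjugate of \<open>j\<close> by \<open>\<sigma> s\<close>, which fixes
  \<open>\<sigma> s v0\<close>. The last clause reaches every coset in the support of
  \<open>f_1\<close>; \<open>1 \<le> d\<close> makes it vacuous at \<open>i = 0\<close>.\<close>

lemma iterate_C3:
  assumes v0: "v0 \<in> VI" and i: "i \<le> d" and d: "1 \<le> d"
  defines "H \<equiv> (T ^^ i) (delta (al (int d - 1)) (\<sigma> s v0))"
  shows "H \<in> Fin \<and> (\<forall>g\<in>G. H g \<noteq> 0 \<longrightarrow> C3 (int d - 1 - int i) g) \<and>
    H (al (int d - 1 - int i)) = \<sigma> s v0 \<and> (i = d \<longrightarrow> (\<forall>u\<in>I1. H (al (- 1) ** u) = \<sigma> s v0))"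
  using i unfolding H_def
proof (induction i)
  case 0
  have "C3 (int d - 1) g" if "delta (al (int d - 1)) (\<sigma> s v0) g \<noteq> 0" for g
    using delta_support[OF al_G that] by (auto simp: C3_K_iff)
  then show ?case
    using d by (simp add: delta_Fin delta_self)
next
  case (Suc i)
  define F where "F = (T ^^ i) (delta (al (int d - 1)) (\<sigma> s v0))"
  define m where "m = int d - 2 - int i"
  have F: "F \<in> Fin" "\<And>g. g \<in> G \<Longrightarrow> F g \<noteq> 0 \<Longrightarrow> C3 (m + 1) g" "F (al (m + 1)) = \<sigma> s v0"
    using Suc by (auto simp: F_def m_def algebra_simps)
  have 1: "C3 m g" if g: "g \<in> G" "T F g \<noteq> 0" for g
  proof -
    obtain y where y: "y \<in> G" "F y \<noteq> 0" "g ** star y \<in> KaK"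
      using T_support[OF F(1) g] by blast
    then show ?thesis
      using C3_neighbour[of y g "m + 1"] F(2) g by simp
  qed
  have 2: "T F (al m ** u) = \<sigma> s v0" if u: "u \<in> I1" "m = - 1 \<or> u = mat 1" for u
  proof -
    have uK: "u \<in> K" "u \<in> G"
      using u by auto
    have "T F (al m ** u) = \<phi> ((al m ** u) ** star (al (m + 1) ** u)) (F (al (m + 1) ** u))"
    proof (rule T_single[OF F(1)])
      show "\<exists>k\<in>K. y = k ** (al (m + 1) ** u)" if y: "y \<in> G" "F y \<noteq> 0" "al m ** u ** star y \<in> KaK" for y
        using neighbour_up_C3[OF u y(1,3) F(2)[OF y(1,2)]] by (metis matrix_mul_assoc)
    qed (use uK in auto)
    also have "(al m ** u) ** star (al (m + 1) ** u) = al (- 1)"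
    proof -
      have "(al m ** u) ** star (al (m + 1) ** u) = al m ** (u ** star u) ** al (- (m + 1))"
        by (simp add: star_mult matrix_mul_assoc)
      then show ?thesis
        using uK by (simp add: star_mult_right al_add)
    qed
    also have "\<phi> (al (- 1)) (F (al (m + 1) ** u)) = \<sigma> s (j (\<sigma> s (F (al (m + 1) ** u))))"
      by (rule phi_al)
    also have "j (\<sigma> s (F (al (m + 1) ** u))) = v0"
    proof (cases "u = mat 1")
      case True
      then show ?thesis
        using v0 by (simp add: F(3) j_VI)
    next
      case False
      then have m: "m = - 1"
        using u by auto
      \<comment> \<open>As \<open>m + 1 = 0\<close>, the value at \<open>u\<close> is
        \<open>\<sigma> u (\<sigma> s v0)\<close>. Applying \<open>s\<close> leaves
        \<open>s ** u ** s\<close>, an element of \<open>I1'\<close>, acting on \<open>v0\<close>,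
        and \<open>j\<close> does not see it.\<close>
      have "F (u ** mat 1) = \<sigma> u (F (mat 1))"
        using uK by (intro Fin_D(2)[OF F(1)]) auto
      then have "\<sigma> s (F (al (m + 1) ** u)) = \<sigma> (s ** u ** s) v0"
        using F(3) uK by (simp add: m \<sigma>_mult)
      then show ?thesis
        using v0 j_I1'[OF s_conj_I1'[OF u(1)]] by (simp add: j_VI)
    qed
    finally show ?thesis .
  qed
  have e: "int d - 1 - int (Suc i) = m"
    by (simp add: m_def)
  have 3: "Suc i = d \<Longrightarrow> m = - 1"
    by (simp add: m_def)
  show ?case
    unfolding e using 1 2[of "mat 1"] 2 3 T_Fin[OF F(1)] by (auto simp: F_def)
qed

lemma f_fun_0:
  assumes v0: "v0 \<in> VI"
  shows "f_fun D \<kappa> \<sigma> v0 0 = delta (mat 1) v0" (is "_ = ?f")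
  unfolding f_fun_def
proof (rule the_equality)
  have e: "double_coset D \<kappa> (- 0) I1 = K"
  proof -
    have "g \<in> double_coset D \<kappa> (- 0) I1 \<longleftrightarrow> g \<in> K" for g
    proof
      assume "g \<in> double_coset D \<kappa> (- 0) I1"
      then show "g \<in> K"
        by (auto simp: double_coset_def alpha_pow)
    next
      assume "g \<in> K"
      then show "g \<in> double_coset D \<kappa> (- 0) I1"
        unfolding double_coset_def alpha_pow
        by (intro CollectI exI[of _ g] exI[of _ "mat 1"]) simp
    qed
    then show ?thesis
      by blast
  qed
  show "?f \<in> comp_ind D \<kappa> \<sigma> \<and> (\<forall>h\<in>I1. right_translate h ?f = ?f) \<and>
      (\<forall>g. g \<notin> double_coset D \<kappa> (- 0) I1 \<longrightarrow> ?f g = 0) \<and>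
      ?f (alpha D [^]\<^bsub>U21 D\<^esub> (- 0 :: int)) = (if (0::int) > 0 then \<sigma> s v0 else v0)"
  proof (intro conjI ballI allI impI)
    show "?f \<in> comp_ind D \<kappa> \<sigma>"
      by (intro Fin_comp_ind delta_Fin) simp
    show "right_translate h ?f = ?f" if h: "h \<in> I1" for h
    proof
      fix g
      have hK: "h \<in> K" "h \<in> G"
        using h by auto
      show "right_translate h ?f g = ?f g"
      proof (cases "g \<in> K")
        case True
        then show ?thesis
          using hK VI_D[OF v0 h] by (simp add: right_translate_def delta_def \<sigma>_mult)
      next
        case False
        have "g ** h \<notin> K"
        proof
          assume "g ** h \<in> K"
          then have "(g ** h) ** star h \<in> K"
            using hK by (rule_tac K_mult) auto
          then show False
            using False hK by simp
        qed
        then show ?thesis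
          using False by (simp add: right_translate_def delta_def)
      qed
    qed
    show "?f g = 0" if "g \<notin> double_coset D \<kappa> (- 0) I1" for g
      using that unfolding e by (auto simp: delta_def)
    show "?f (alpha D [^]\<^bsub>U21 D\<^esub> (- 0 :: int)) = (if (0::int) > 0 then \<sigma> s v0 else v0)"
      by (simp add: alpha_pow delta_def)
  qed
  fix f assume "f \<in> comp_ind D \<kappa> \<sigma> \<and> (\<forall>h\<in>I1. right_translate h f = f) \<and>
      (\<forall>g. g \<notin> double_coset D \<kappa> (- 0) I1 \<longrightarrow> f g = 0) \<and>
      f (alpha D [^]\<^bsub>U21 D\<^esub> (- 0 :: int)) = (if (0::int) > 0 then \<sigma> s v0 else v0)"
  then have f: "f \<in> comp_ind D \<kappa> \<sigma>" "\<And>g. g \<notin> K \<Longrightarrow> f g = 0" "f (mat 1) = v0"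
    unfolding e by (auto simp: alpha_pow)
  show "f = ?f"
  proof
    fix g
    show "f g = ?f g"
    proof (cases "g \<in> K")
      case True
      then have "f (g ** mat 1) = \<sigma> g (f (mat 1))"
        using f(1) one_G unfolding comp_ind_def Let_def by blast
      then show ?thesis
        using True f(3) by (simp add: delta_def)
    qed (use f(2) in \<open>auto simp: delta_def\<close>)
  qed
qed

lemma double_coset_mem:
  "g \<in> double_coset D \<kappa> n I1 \<longleftrightarrow> (\<exists>k\<in>K. \<exists>u\<in>I1. g = k ** al n ** u)"
  by (auto simp: double_coset_def alpha_pow)

text \<open>The torus commutes with \<open>al n\<close> and is absorbed by \<open>K\<close>, so
  \<open>I\<close> and \<open>I1\<close> give the same double cosets.\<close>

lemma double_coset_I:
  assumes "k \<in> K" "i \<in> I"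
  shows "k ** al n ** i \<in> double_coset D \<kappa> n I1"
proof -
  obtain t u where tu: "t \<in> Tor" "u \<in> I1" "i = t ** u"
    using assms(2) by (rule I_decomposition)
  have "k ** al n ** i = (k ** t) ** al n ** u"
    using Tor_al[OF tu(1), of n] by (simp add: tu(3) matrix_mul_assoc[symmetric])
  then show ?thesis
    using assms(1) tu unfolding double_coset_mem by (metis I_K K_mult Tor_I)
qed

lemma double_coset_K:
  assumes "k \<in> K" "g \<in> G"
  shows "k ** g \<in> double_coset D \<kappa> n I1 \<longleftrightarrow> g \<in> double_coset D \<kappa> n I1"
proof -
  have 1: "h ** x \<in> double_coset D \<kappa> n I1" if "h \<in> K" "x \<in> double_coset D \<kappa> n I1" for h x
    using that unfolding double_coset_mem by (metis K_mult matrix_mul_assoc)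
  show ?thesis
    using 1[of k g] 1[of "star k" "k ** g"] assms by auto
qed

text \<open>A function with the prescribed values must exist before the description can be
  evaluated. Cutting it out of \<open>H\<close> avoids checking that
  \<open>\<sigma> k (\<sigma> s v0)\<close> is independent of the expression
  \<open>k ** al (- 1) ** u\<close>.\<close>

lemma f_fun_1:
  assumes H: "H \<in> Fin" and u: "\<And>u. u \<in> I1 \<Longrightarrow> H (al (- 1) ** u) = \<sigma> s v0"
  shows "f_fun D \<kappa> \<sigma> v0 1 = (\<lambda>g. if g \<in> double_coset D \<kappa> (- 1) I1 then H g else 0)" (is "_ = ?f")
    and "(\<lambda>g. if g \<in> double_coset D \<kappa> (- 1) I1 then H g else 0) \<in> Fin"
proof -
  let ?DC = "double_coset D \<kappa> (- 1) I1"
  show Fin: "?f \<in> Fin"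
    by (rule Fin_restrict[OF H double_coset_K])
  have val: "H (k ** al (- 1) ** u') = \<sigma> k (\<sigma> s v0)" if k: "k \<in> K" "u' \<in> I1" for k u'
    using Fin_D(2)[OF H k(1), of "al (- 1) ** u'"] u[OF k(2)] k(2) by (simp add: matrix_mul_assoc)
  have memK: "k ** al (- 1) ** u' \<in> ?DC" if "k \<in> K" "u' \<in> I1" for k u'
    using that unfolding double_coset_mem by blast
  have base: "al (- 1) \<in> ?DC"
    using memK[of "mat 1" "mat 1"] by simp
  have DC_u: "g ** h \<in> ?DC" if "g \<in> ?DC" "h \<in> I1" for g h
    using that unfolding double_coset_mem by (metis I1_mult matrix_mul_assoc)
  show "f_fun D \<kappa> \<sigma> v0 1 = ?f"
    unfolding f_fun_def
  proof (rule the_equality)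
    show "?f \<in> comp_ind D \<kappa> \<sigma> \<and> (\<forall>h\<in>I1. right_translate h ?f = ?f) \<and>
        (\<forall>g. g \<notin> double_coset D \<kappa> (- 1) I1 \<longrightarrow> ?f g = 0) \<and>
        ?f (alpha D [^]\<^bsub>U21 D\<^esub> (- 1 :: int)) = (if (1::int) > 0 then \<sigma> s v0 else v0)"
    proof (intro conjI ballI allI impI)
      show "?f \<in> comp_ind D \<kappa> \<sigma>"
        by (rule Fin_comp_ind[OF Fin])
      show "right_translate h ?f = ?f" if h: "h \<in> I1" for h
      proof
        fix g
        show "right_translate h ?f g = ?f g"
        proof (cases "g \<in> ?DC")
          case True
          then obtain k u' where k: "k \<in> K" "u' \<in> I1" "g = k ** al (- 1) ** u'"
            unfolding double_coset_mem by blast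
          have "g ** h = k ** al (- 1) ** (u' ** h)"
            by (simp add: k(3) matrix_mul_assoc)
          then have "H (g ** h) = H g"
            using val[OF k(1) I1_mult[OF k(2) h]] val[OF k(1,2)] k(3) by simp
          then show ?thesis
            using True DC_u[OF True h] by (simp add: right_translate_def)
        next
          case False
          have "g ** h \<notin> ?DC"
          proof
            assume "g ** h \<in> ?DC"
            then have "(g ** h) ** star h \<in> ?DC"
              using DC_u I1_star[OF h] by blast
            then show False
              using False h by simp
          qed
          then show ?thesis
            using False by (simp add: right_translate_def)
        qed
      qed
      show "?f (alpha D [^]\<^bsub>U21 D\<^esub> (- 1 :: int)) = (if (1::int) > 0 then \<sigma> s v0 else v0)"
        unfolding alpha_pow using base u[of "mat 1"] by simp
    qed simp
  next
    fix f assume a: "f \<in> comp_ind D \<kappa> \<sigma> \<and> (\<forall>h\<in>I1. right_translate h f = f) \<and>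
        (\<forall>g. g \<notin> double_coset D \<kappa> (- 1) I1 \<longrightarrow> f g = 0) \<and>
        f (alpha D [^]\<^bsub>U21 D\<^esub> (- 1 :: int)) = (if (1::int) > 0 then \<sigma> s v0 else v0)"
    then have f: "\<And>h. h \<in> I1 \<Longrightarrow> right_translate h f = f" "\<And>g. g \<notin> ?DC \<Longrightarrow> f g = 0" "f (al (- 1)) = \<sigma> s v0"
      unfolding alpha_pow by auto
    have equi: "f (k ** g) = \<sigma> k (f g)" if "k \<in> K" "g \<in> G" for k g
      using a that unfolding comp_ind_def Let_def by blast
    show "f = ?f"
    proof
      fix g
      show "f g = ?f g"
      proof (cases "g \<in> ?DC")
        case True
        then obtain k u' where k: "k \<in> K" "u' \<in> I1" "g = k ** al (- 1) ** u'"
          unfolding double_coset_mem by blast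
        have "f (k ** (al (- 1) ** u')) = \<sigma> k (f (al (- 1) ** u'))"
          using k by (intro equi) auto
        also have "f (al (- 1) ** u') = f (al (- 1))"
          using fun_cong[OF f(1)[OF k(2)], of "al (- 1)"] by (simp add: right_translate_def)
        finally have "f g = \<sigma> k (\<sigma> s v0)"
          using f(3) by (simp add: k(3) matrix_mul_assoc)
        then show ?thesis
          using True val[OF k(1,2)] k(3) by simp
      qed (use f(2) in simp)
    qed
  qed
qed

text \<open>
  Apply \<open>P(T)\<close> to a function supported on one coset at distance \<open>deg P\<close>: up to functions supported on the
  half under consideration, only the top power of \<open>T\<close> reaches the coset of interest, with value \<open>j v0 = v0\<close>.
\<close>

lemma f_0_and_f_1_in_spans:
  fixes s' :: "'c \<Rightarrow> 'w::ab_group_add \<Rightarrow> 'w" and \<iota> :: "('e mat3 \<Rightarrow> 'v) \<Rightarrow> 'w"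
  assumes vs: "vector_space s'"
    and add: "\<And>f f'. f \<in> Fin \<Longrightarrow> f' \<in> Fin \<Longrightarrow> \<iota> (\<lambda>g. f g + f' g) = \<iota> f + \<iota> f'"
    and scale: "\<And>a f. f \<in> Fin \<Longrightarrow> \<iota> (\<lambda>g. sc a (f g)) = s' a (\<iota> f)"
    and deg: "degree Pl \<ge> 1"
    and kill: "\<And>f. f \<in> Fin \<Longrightarrow> \<iota> (poly_op sc Pl T f) = 0"
    and v0: "v0 \<in> VI"
  shows "\<iota> (f_fun D \<kappa> \<sigma> v0 0) \<in> module.span s' (\<Union>n. \<iota> ` R_minus D \<kappa> \<sigma> n)"
    and "\<iota> (f_fun D \<kappa> \<sigma> v0 1) \<in> module.span s' (\<Union>n. \<iota> ` R_plus D \<kappa> \<sigma> n)"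
proof -
  interpret W: vector_space s'
    by (rule vs)
  define d where "d = degree Pl"
  define a where "a = lead_coeff Pl"
  have a0: "a \<noteq> 0"
    using deg by (auto simp: a_def)
  \<comment> \<open>As \<open>\<iota>\<close> kills \<open>poly_op sc Pl T h\<close>, the image of
    \<open>f0\<close> times the leading coefficient \<open>a\<close> is minus the image of the
    remainder, to which \<open>Fin_span\<close> applies; then divide by \<open>a\<close>.\<close>
  have final: "\<iota> f0 \<in> W.span (\<Union>n. \<iota> ` R n)"
    if h: "h \<in> Fin" "f0 \<in> Fin"
      and R: "\<And>y. y \<in> G \<Longrightarrow> poly_op sc Pl T h y - sc a (f0 y) \<noteq> 0 \<Longrightarrow>
        \<exists>n. restr (\<lambda>g. poly_op sc Pl T h g - sc a (f0 g)) y \<in> R n"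
    for h f0 and R :: "nat \<Rightarrow> ('e mat3 \<Rightarrow> 'v) set"
  proof -
    let ?F = "poly_op sc Pl T h" and ?r = "\<lambda>g. poly_op sc Pl T h g - sc a (f0 g)"
    have F: "?F \<in> Fin" "?r \<in> Fin" "(\<lambda>g. sc a (f0 g)) \<in> Fin"
      using poly_op_Fin[OF h(1)] Fin_scale[OF h(2)] Fin_diff by auto
    have "\<iota> ?r \<in> W.span (\<Union>n. \<iota> ` R n)"
      by (rule Fin_span[OF vs add scale F(2) R])
    moreover have "\<iota> (\<lambda>g. ?r g + sc a (f0 g)) = \<iota> ?r + \<iota> (\<lambda>g. sc a (f0 g))"
      by (rule add[OF F(2,3)])
    then have "0 = \<iota> ?r + s' a (\<iota> f0)"
      using scale[OF h(2), of a] kill[OF h(1)] by simp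
    then have "s' a (\<iota> f0) = - \<iota> ?r"
      by (simp add: eq_neg_iff_add_eq_0 add.commute)
    then have "\<iota> f0 = s' (inverse a) (- \<iota> ?r)"
      using a0 by (metis W.scale_scale W.scale_one left_inverse)
    ultimately show ?thesis
      by (simp add: W.span_scale W.span_neg)
  qed
  show "\<iota> (f_fun D \<kappa> \<sigma> v0 0) \<in> W.span (\<Union>n. \<iota> ` R_minus D \<kappa> \<sigma> n)"
  proof -
    define h where "h = delta (al (- int d)) v0"
    define f0 where "f0 = delta (mat 1) v0"
    have F: "h \<in> Fin" "f0 \<in> Fin"
      by (simp_all add: h_def f0_def delta_Fin)
    have it: "(T ^^ i) h \<in> Fin" "\<And>g. g \<in> G \<Longrightarrow> (T ^^ i) h g \<noteq> 0 \<Longrightarrow> C1 (int d - int i) g"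
      "(T ^^ i) h (al (int i - int d)) = v0" if "i \<le> d" for i
      using iterate_C1[OF v0 that] by (auto simp: h_def)
    have "\<exists>n. restr (\<lambda>g. poly_op sc Pl T h g - sc a (f0 g)) y \<in> R_minus D \<kappa> \<sigma> n"
      if y: "y \<in> G" "poly_op sc Pl T h y - sc a (f0 y) \<noteq> 0" for y
    proof -
      obtain k n i where kni: "k \<in> K" "i \<in> I" "y = k ** al n ** i"
        using G_decomposition[OF y(1)] by blast
      have "n \<le> - 1"
      proof (rule ccontr)
        assume "\<not> n \<le> - 1"
        then have n: "0 \<le> n"
          by simp
        have low: "(T ^^ l) h y = 0" if "l < d" for l
        proof (rule ccontr)
          assume "(T ^^ l) h y \<noteq> 0"
          then have "C1 (int d - int l) (k ** al n ** i)"
            using it(2)[of l] that y(1) kni(3) by auto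
          then have "int d - int l \<le> - n"
            using C1_al_I[OF kni(1,2)] by blast
          then show False
            using n that by simp
        qed
        have top: "poly_op sc Pl T h y = sc a ((T ^^ d) h y)"
          unfolding a_def d_def by (rule poly_op_top) (use low d_def in auto)
        show False
        proof (cases "y \<in> K")
          case True
          have "(T ^^ d) h (y ** mat 1) = \<sigma> y ((T ^^ d) h (mat 1))"
            by (rule Fin_D(2)[OF it(1)[OF order_refl] True one_G])
          then have "(T ^^ d) h y = f0 y"
            using it(3)[of d] True by (simp add: f0_def delta_def)
          then show False
            using y(2) top by simp
        next
          case False
          then have "f0 y = 0"
            by (simp add: f0_def delta_def)
          then have "(T ^^ d) h y \<noteq> 0"
            using y(2) top by auto
          then have "C1 (int d - int d) (k ** al n ** i)"
            using it(2)[of d y] y(1) kni(3) by auto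
          then have "n = 0"
            using C1_al_I[OF kni(1,2)] n by fastforce
          then show False
            using False kni by simp
        qed
      qed
      then show ?thesis
        using R_minus_restr[OF _ kni(3,1,2)] Fin_diff[OF poly_op_Fin[OF F(1)] Fin_scale[OF F(2)]] by blast
    qed
    from final[OF F this] show ?thesis
      using f_fun_0[OF v0] by (simp add: f0_def)
  qed
  show "\<iota> (f_fun D \<kappa> \<sigma> v0 1) \<in> W.span (\<Union>n. \<iota> ` R_plus D \<kappa> \<sigma> n)"
  proof -
    have d1: "1 \<le> d"
      using deg by (simp add: d_def)
    \<comment> \<open>From exponent \<open>d - 1\<close>, exactly \<open>d\<close> steps lead to the
      exponent \<open>- 1\<close> of \<open>f_1\<close>, while all lower powers stay at exponents
      \<open>\<ge> 0\<close>.\<close>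
    define h where "h = delta (al (int d - 1)) (\<sigma> s v0)"
    have it: "(T ^^ i) h \<in> Fin" "\<And>g. g \<in> G \<Longrightarrow> (T ^^ i) h g \<noteq> 0 \<Longrightarrow> C3 (int d - 1 - int i) g"
      if "i \<le> d" for i
      using iterate_C3[OF v0 that d1] by (auto simp: h_def)
    have val: "(T ^^ d) h (al (- 1) ** u) = \<sigma> s v0" if "u \<in> I1" for u
      using iterate_C3[OF v0 order_refl d1] that by (auto simp: h_def)
    let ?DC = "double_coset D \<kappa> (- 1) I1"
    define f1 where "f1 = (\<lambda>g. if g \<in> ?DC then (T ^^ d) h g else 0)"
    have F: "h \<in> Fin" "f1 \<in> Fin"
      unfolding f1_def using f_fun_1(2)[OF it(1)[OF order_refl] val] by (simp_all add: h_def delta_Fin)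
    have "\<exists>n. restr (\<lambda>g. poly_op sc Pl T h g - sc a (f1 g)) y \<in> R_plus D \<kappa> \<sigma> n"
      if y: "y \<in> G" "poly_op sc Pl T h y - sc a (f1 y) \<noteq> 0" for y
    proof -
      obtain k n i where kni: "k \<in> K" "i \<in> I" "y = k ** al n ** i"
        using G_decomposition[OF y(1)] by blast
      have "0 \<le> n"
      proof (rule ccontr)
        assume n: "\<not> 0 \<le> n"
        have low: "(T ^^ l) h y = 0" if "l < d" for l
        proof (rule ccontr)
          assume "(T ^^ l) h y \<noteq> 0"
          then have "C3 (int d - 1 - int l) (k ** al n ** i)"
            using it(2)[of l] that y(1) kni(3) by auto
          then have "int d - 1 - int l \<le> n"
            using C3_al_I[OF kni(1,2)] by blast
          then show False
            using n that by simp
        qed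
        have top: "poly_op sc Pl T h y = sc a ((T ^^ d) h y)"
          unfolding a_def d_def by (rule poly_op_top) (use low d_def in auto)
        show False
        proof (cases "y \<in> ?DC")
          case True
          then show False
            using y(2) top by (simp add: f1_def)
        next
          case False
          then have "(T ^^ d) h y \<noteq> 0"
            using y(2) top by (auto simp: f1_def)
          then have "C3 (int d - 1 - int d) (k ** al n ** i)"
            using it(2)[of d y] y(1) kni(3) by auto
          then have "- 1 \<le> n"
            using C3_al_I[OF kni(1,2)] by fastforce
          then have "n = - 1"
            using n by simp
          then show False
            using False double_coset_I[OF kni(1,2), of n] kni(3) by simp
        qed
      qed
      then show ?thesis
        using R_plus_restr[OF _ kni(3,1,2)] Fin_diff[OF poly_op_Fin[OF F(1)] Fin_scale[OF F(2)]] by blast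
    qed
    from final[OF F this] show ?thesis
      using f_fun_1(1)[OF it(1)[OF order_refl] val] by (simp add: f1_def)
  qed
qed

end

theorem proposition4p1:
  fixes D :: "'e::field unram_datum" and p :: nat and \<kappa> :: maxcpt
    and s :: "'c::alg_closed_field \<Rightarrow> 'v::ab_group_add \<Rightarrow> 'v"
    and \<sigma> :: "'e mat3 \<Rightarrow> 'v \<Rightarrow> 'v"
    and s' :: "'c \<Rightarrow> 'w::ab_group_add \<Rightarrow> 'w"
    and \<pi> :: "'e mat3 \<Rightarrow> 'w \<Rightarrow> 'w"
    and e :: "'v \<Rightarrow> 'w"
    and \<iota> :: "('e mat3 \<Rightarrow> 'v) \<Rightarrow> 'w"
    and P :: "'c poly"
    and v0 :: 'v
  assumes "unramified_quadratic D" and "residue_char D p" and "odd p"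
    and "is_Fp_bar TYPE('c) p"
    and "weight D \<kappa> s \<sigma>"
    and "smooth_rep D (carrier (U21 D)) s' \<pi>"
    and "weight_embedding D \<kappa> s \<sigma> s' \<pi> e"
    and "frobenius_map D \<kappa> s \<sigma> s' \<pi> e \<iota>"
    and "\<iota> ` comp_ind D \<kappa> \<sigma> = UNIV"
    and "degree P \<ge> 1"
    and "\<forall>f\<in>comp_ind D \<kappa> \<sigma>. \<iota> (poly_op s P (hecke_op D \<kappa> s \<sigma>) f) = 0"
    and "v0 \<in> invariants (pro_p_iwahori D \<kappa>) \<sigma>" and "v0 \<noteq> 0"
  shows "\<iota> (f_fun D \<kappa> \<sigma> v0 0) \<in> module.span s' (\<Union>n. \<iota> ` R_minus D \<kappa> \<sigma> n) \<and>
         \<iota> (f_fun D \<kappa> \<sigma> v0 1) \<in> module.span s' (\<Union>n. \<iota> ` R_plus D \<kappa> \<sigma> n)"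
proof -
  have vs: "vector_space s" "vector_space s'"
    using assms(5,6) by (auto simp: weight_def smooth_rep_def Defs.representation_def)
  interpret weight_rep D \<kappa> s p \<sigma>
    using assms vs by (auto simp: weight_rep_def weight_rep_axioms_def unitary_compact_def unramified_def is_Fp_bar_def)
  have v0: "v0 \<in> VI"
    using assms(12) by (simp add: VI_invariants)
  note frob = assms(8)[unfolded frobenius_map_def]
  have add: "\<iota> (\<lambda>g. f g + f' g) = \<iota> f + \<iota> f'" if "f \<in> Fin" "f' \<in> Fin" for f f'
    using frob that Fin_comp_ind by blast
  have scale: "\<iota> (\<lambda>g. s a (f g)) = s' a (\<iota> f)" if "f \<in> Fin" for a f
    using frob that Fin_comp_ind by blast
  have kill: "\<iota> (poly_op s P (hecke_op D \<kappa> s \<sigma>) f) = 0" if "f \<in> Fin" for f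
    using assms(11) Fin_comp_ind[OF that] by blast
  show ?thesis
    using f_0_and_f_1_in_spans[OF vs(2) add scale assms(10) kill v0] by blast
qed

end
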